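(* Let $\nu>0$, and let $u,\Phi,\ell,R_0,A$ be as in the context, with $$b=u+4\nu\frac{x}{|x|^2}-2\nu\nabla\ln\Phi,\qquad \mathcal L=\partial_t-\nu\Delta+b\cdot\nabla .$$ Write $\hat x=x/|x|$, $b_r=b\cdot\hat x$, $u_r=u\cdot\hat x$, $(u_r)_-=\max(-u_r,0)$. Assume that on $A$: $\nabla\cdot u=0$, $|u(x,t)|\le C_u|x|^{-1}$, and that for some $k\in(0,3)$ $$\sup_A |x|\,(u_r)_-+2\nu C_\Phi\le(3-k)\nu .$$ Then: (i) (Supersolution and maximum principle.) $\mathcal L1=0$ and $$\mathcal L|x|^k=k|x|^{k-2}\big(|x|\,b_r-(k+1)\nu\big)\ge0\quad\text{on }A.$$ Consequently, if $\mathcal Lw\le0$ on $A$, then $\sup_Aw\le\sup_{\partial_pA}w$; in particular $\|w(t)\|_{L^\infty}$ is non-increasing for solutions. (ii) (Screening of outer data.) If $\mathcal Lw=0$ on $A$ and $|w|\le A_0(|x|/R_0)^k$ on $\partial_pA$ (in particular, if $w=0$ on the inner boundary and $|w|\le A_0$ on the outer one), then $|w(x,t)|\le A_0(|x|/R_0)^k$ on $A$. (iii) (Hitting time of the inner scale.) Fix $(x,t)\in A$ and let $X$ solve $dX_s=-b(X_s,t-s)\,ds+\sqrt{2\nu}\,dW_s$, $X_0=x$, up to the exit time $\tau_A$ from $A$ ($W$ a standard three-dimensional Brownian motion); let $\tau=\inf\{s:\ |X_s|=\ell(t-s)\}$. Then $$\mathbb P^x(\tau>s)\le\frac{1}{\Gamma(\frac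 k2+1)}\Big(\frac{|x|^2}{4\nu s}\Big)^{k/2}\quad\text{for all }s>0,$$ and $$\mathbb P^x\big(\tau<\epsilon|x|^2/\nu\big)\le\eta(\epsilon)\quad\text{whenever }\ell(t-s)\le|x|/2\text{ for the times }s\in[0,\epsilon|x|^2/\nu]\text{ involved},$$ where $\eta(\epsilon)\to0$ as $\epsilon\to0$ and $\eta$ depends only on $C_u/\nu$ and $C_\Phi$. (These two bounds are abbreviated $\tau\asymp|x|^2/\nu$.) (iv) (Barrier for logarithmic sources.) For every $\gamma>0$ there is a small $r_*=r_*(\gamma,k)\le e^{-1}$ such that $g(x)=|\log|x||^{-\gamma}$ satisfies, on $A\cap\{|x|<r_*\}$, $$\mathcal Lg\ge\frac{\nu\gamma k}{2}\,\frac{1}{|x|^2|\log|x||^{\gamma+1}} .$$ Consequently, if $\mathcal Lw\le\Lambda|x|^{-2}|\log|x||^{-\gamma-1}$ on $A\cap\{|x|<r_*\}$ and $w\le0$ on the corresponding parabolic boundary, then $w\le\frac{2\Lambda}{\nu\gamma k}|\log|x||^{-\gamma}$ there.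
   Context: Setting. $u$ is the velocity of a strong (smooth) solution of the 3D incompressible unforced Navier-Stokes equations with viscosity $\nu>0$ on $\mathbb R^3\times(0,T^* )$. $\ell$ is a positive function on $(t_0,T^* )$ with $\ell(t)\to0$ as $t\uparrow T^*$ (the inner scale), $R_0>0$, and $$A=\{(x,t):\ \ell(t)<|x|<R_0,\ t_0<t<T^*\}.$$ On $A$ the vorticity magnitude $\omega=|\nabla\times u|$ has the form $\omega(x,t)=\Phi(x,t)|x|^{-2}$ with $0<c_0\le\Phi\le C_0$ and $|\nabla\ln\Phi|\le C_\Phi|x|^{-1}$. $\partial_pA$ denotes the parabolic boundary of $A$: the initial slice $t=t_0$, the inner boundary $|x|=\ell(t)$, and the outer boundary $|x|=R_0$.
   Formalization: ℓ is taken continuous and Λ≥0; ‖w(t)‖ is non-increasing only if |w|≤‖w(s)‖ on the lateral boundary; the special case of (ii) keeps the initial bound; P(τ>s) counts only paths with s≤τ_A; η serves sample spaces of one type (all, via path space). *)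

theory Defs
  imports "HOL-Probability.Probability"
begin

section \<open>Differential operators on space-time functions\<close>

type_synonym spacetime = "(real^3) \<times> real"

definition grad :: "(real^3 \<Rightarrow> real) \<Rightarrow> real^3 \<Rightarrow> real^3" where
  "grad f x = (\<chi> i. frechet_derivative f (at x) (axis i 1))"

definition laplacian :: "(real^3 \<Rightarrow> real) \<Rightarrow> real^3 \<Rightarrow> real" where
  "laplacian f x = (\<Sum>i\<in>UNIV. frechet_derivative (\<lambda>y. grad f y $ i) (at x) (axis i 1))"

definition divergence :: "(real^3 \<Rightarrow> real^3) \<Rightarrow> real^3 \<Rightarrow> real" where
  "divergence v x = (\<Sum>i\<in>UNIV. grad (\<lambda>y. v y $ i) x $ i)"

definition curl :: "(real^3 \<Rightarrow> real^3) \<Rightarrow> real^3 \<Rightarrow> real^3" where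
  "curl v x = (let d = (\<lambda>i j. grad (\<lambda>y. v y $ j) x $ i) in
     vector [d 2 3 - d 3 2, d 3 1 - d 1 3, d 1 2 - d 2 1])"

text \<open>For open \<open>S\<close> in a finite-dimensional space, \<open>cont_diff_on n S f\<close> says that \<open>f\<close> is of
  class \<open>C\<^sup>n\<close> on \<open>S\<close>.\<close>

primrec cont_diff_on ::
    "nat \<Rightarrow> 'a::real_normed_vector set \<Rightarrow> ('a \<Rightarrow> 'b::real_normed_vector) \<Rightarrow> bool" where
  "cont_diff_on 0 S f \<longleftrightarrow> continuous_on S f"
| "cont_diff_on (Suc n) S f \<longleftrightarrow>
     (\<forall>x\<in>S. f differentiable (at x)) \<and>
     (\<forall>v. cont_diff_on n S (\<lambda>x. frechet_derivative f (at x) v))"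

definition smooth_on :: "'a::real_normed_vector set \<Rightarrow> ('a \<Rightarrow> 'b::real_normed_vector) \<Rightarrow> bool" where
  "smooth_on S f \<longleftrightarrow> (\<forall>n. cont_diff_on n S f)"

text \<open>Class \<open>C\<^sup>2\<^sup>,\<^sup>1\<close>: two continuous derivatives in space, one in time.\<close>

definition C21_on :: "spacetime set \<Rightarrow> (spacetime \<Rightarrow> real) \<Rightarrow> bool" where
  "C21_on S w \<longleftrightarrow>
     (\<forall>(x, t)\<in>S. (\<lambda>s. w (x, s)) differentiable (at t) \<and>
        (\<lambda>y. w (y, t)) differentiable (at x) \<and>
        (\<forall>i. (\<lambda>y. grad (\<lambda>z. w (z, t)) y $ i) differentiable (at x))) \<and>
     continuous_on S (\<lambda>(x, t). deriv (\<lambda>s. w (x, s)) t) \<and>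
     continuous_on S (\<lambda>(x, t). grad (\<lambda>y. w (y, t)) x) \<and>
     (\<forall>i j. continuous_on S
        (\<lambda>(x, t). frechet_derivative (\<lambda>y. grad (\<lambda>z. w (z, t)) y $ i) (at x) (axis j 1)))"

section \<open>The fluid and the annular region\<close>

definition navier_stokes :: "real \<Rightarrow> real \<Rightarrow> (spacetime \<Rightarrow> real^3) \<Rightarrow> bool" where
  "navier_stokes \<nu> T u \<longleftrightarrow>
     smooth_on (UNIV \<times> {0<..<T}) u \<and>
     (\<exists>p :: spacetime \<Rightarrow> real. smooth_on (UNIV \<times> {0<..<T}) p \<and>
       (\<forall>x. \<forall>t\<in>{0<..<T}.
          divergence (\<lambda>y. u (y, t)) x = 0 \<and>
          vector_derivative (\<lambda>s. u (x, s)) (at t)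
            + frechet_derivative (\<lambda>y. u (y, t)) (at x) (u (x, t))
          = \<nu> *\<^sub>R (\<chi> j. laplacian (\<lambda>y. u (y, t) $ j) x) - grad (\<lambda>y. p (y, t)) x))"

definition region :: "(real \<Rightarrow> real) \<Rightarrow> real \<Rightarrow> real \<Rightarrow> real \<Rightarrow> spacetime set" where
  "region l R t0 T = {(x, t). l t < norm x \<and> norm x < R \<and> t0 < t \<and> t < T}"

text \<open>The scale \<open>l\<close> is only given on the open interval \<open>(t0, T)\<close>, so the initial slice is read
  off from the closure of the region. If \<open>l\<close> exceeds \<open>R\<close> at some times, the spheres
  \<open>|x| = l t\<close> and \<open>|x| = R\<close> do not border the region there; taking the closure discards them.\<close>

definition initial_slice :: "(real \<Rightarrow> real) \<Rightarrow> real \<Rightarrow> real \<Rightarrow> real \<Rightarrow> spacetime set" where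
  "initial_slice l R t0 T = {(x, t) \<in> closure (region l R t0 T). t = t0}"

definition inner_boundary :: "(real \<Rightarrow> real) \<Rightarrow> real \<Rightarrow> real \<Rightarrow> real \<Rightarrow> spacetime set" where
  "inner_boundary l R t0 T =
     {(x, t) \<in> closure (region l R t0 T). t0 < t \<and> t < T \<and> norm x = l t}"

definition outer_boundary :: "(real \<Rightarrow> real) \<Rightarrow> real \<Rightarrow> real \<Rightarrow> real \<Rightarrow> spacetime set" where
  "outer_boundary l R t0 T =
     {(x, t) \<in> closure (region l R t0 T). t0 < t \<and> t < T \<and> norm x = R}"

definition parabolic_boundary :: "(real \<Rightarrow> real) \<Rightarrow> real \<Rightarrow> real \<Rightarrow> real \<Rightarrow> spacetime set" where
  "parabolic_boundary l R t0 T =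
     initial_slice l R t0 T \<union> inner_boundary l R t0 T \<union> outer_boundary l R t0 T"

text \<open>Continuity of \<open>l\<close> is what makes \<open>parabolic_boundary\<close> the parabolic boundary of the region:
  where \<open>l\<close> jumps down, a whole annulus would have to be added to the initial data.\<close>

definition annular_setting ::
    "real \<Rightarrow> (spacetime \<Rightarrow> real^3) \<Rightarrow> (spacetime \<Rightarrow> real) \<Rightarrow> (real \<Rightarrow> real) \<Rightarrow> real \<Rightarrow> real \<Rightarrow> real
      \<Rightarrow> real \<Rightarrow> real \<Rightarrow> real \<Rightarrow> bool" where
  "annular_setting \<nu> u \<Phi> l R0 t0 T c0 C0 C\<Phi> \<longleftrightarrow>
     0 < \<nu> \<and> navier_stokes \<nu> T u \<and>
     0 \<le> t0 \<and> t0 < T \<and> 0 < R0 \<and>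
     (\<forall>t\<in>{t0<..<T}. 0 < l t) \<and> continuous_on {t0<..<T} l \<and> (l \<longlongrightarrow> 0) (at_left T) \<and>
     0 < c0 \<and>
     (\<forall>(x, t)\<in>region l R0 t0 T.
        norm (curl (\<lambda>y. u (y, t)) x) = \<Phi> (x, t) / (norm x)\<^sup>2 \<and>
        c0 \<le> \<Phi> (x, t) \<and> \<Phi> (x, t) \<le> C0 \<and>
        norm (grad (\<lambda>y. ln (\<Phi> (y, t))) x) \<le> C\<Phi> / norm x)"

definition drift :: "real \<Rightarrow> (spacetime \<Rightarrow> real^3) \<Rightarrow> (spacetime \<Rightarrow> real) \<Rightarrow> spacetime \<Rightarrow> real^3" where
  "drift \<nu> u \<Phi> = (\<lambda>(x, t).
     u (x, t) + (4 * \<nu> / (norm x)\<^sup>2) *\<^sub>R x - (2 * \<nu>) *\<^sub>R grad (\<lambda>y. ln (\<Phi> (y, t))) x)"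

definition radial :: "(spacetime \<Rightarrow> real^3) \<Rightarrow> spacetime \<Rightarrow> real" where
  "radial v = (\<lambda>(x, t). v (x, t) \<bullet> (x /\<^sub>R norm x))"

definition parabolic_op ::
    "real \<Rightarrow> (spacetime \<Rightarrow> real^3) \<Rightarrow> (spacetime \<Rightarrow> real) \<Rightarrow> spacetime \<Rightarrow> real" where
  "parabolic_op \<nu> b w = (\<lambda>(x, t).
     deriv (\<lambda>s. w (x, s)) t - \<nu> * laplacian (\<lambda>y. w (y, t)) x
       + b (x, t) \<bullet> grad (\<lambda>y. w (y, t)) x)"

text \<open>The norm of \<open>w(t)\<close> in \<open>L\<^sup>\<infinity>\<close> of the time-\<open>t\<close> section of \<open>S\<close>. As the values
  are in \<open>ennreal\<close>, it is \<open>0\<close> when that section is empty.\<close>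

definition Linf_slice :: "spacetime set \<Rightarrow> (spacetime \<Rightarrow> real) \<Rightarrow> real \<Rightarrow> ennreal" where
  "Linf_slice S w t =
     esssup (restrict_space lborel {x. (x, t) \<in> S}) (\<lambda>x. ennreal \<bar>w (x, t)\<bar>)"

section \<open>The diffusion\<close>

definition standard_brownian_motion ::
    "'w measure \<Rightarrow> (real \<Rightarrow> 'w measure) \<Rightarrow> (real \<Rightarrow> 'w \<Rightarrow> real^3) \<Rightarrow> bool" where
  "standard_brownian_motion M F W \<longleftrightarrow>
     prob_space M \<and> filtration (space M) F \<and> (\<forall>s. sets (F s) \<subseteq> sets M) \<and>
     (\<forall>s\<ge>0. W s \<in> borel_measurable (F s)) \<and>
     (\<forall>\<omega>\<in>space M. W 0 \<omega> = 0 \<and> continuous_on {0..} (\<lambda>s. W s \<omega>)) \<and>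
     (\<forall>s r. 0 \<le> s \<and> s < r \<longrightarrow>
        prob_space.indep_set M (sets (F s))
          {(\<lambda>\<omega>. W r \<omega> - W s \<omega>) -` B \<inter> space M | B. B \<in> sets borel} \<and>
        distributed M lborel (\<lambda>\<omega>. W r \<omega> - W s \<omega>)
          (\<lambda>y. ennreal (\<Prod>i\<in>UNIV. normal_density 0 (sqrt (r - s)) (y $ i))))"

text \<open>Time runs backwards from \<open>t\<close> along the paths: the space-time position at time \<open>s\<close> is
  \<open>(X s, t - s)\<close>.\<close>

definition exit_time :: "spacetime set \<Rightarrow> real \<Rightarrow> (real \<Rightarrow> 'w \<Rightarrow> real^3) \<Rightarrow> 'w \<Rightarrow> ereal" where
  "exit_time S t X \<omega> = Inf {ereal s | s. 0 \<le> s \<and> (X s \<omega>, t - s) \<notin> S}"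

text \<open>Only the part of the path up to the exit time counts; the infimum is \<open>\<infinity>\<close> if the path
  leaves \<open>S\<close> without having met the inner scale.\<close>

definition inner_hitting_time ::
    "(real \<Rightarrow> real) \<Rightarrow> real \<Rightarrow> spacetime set \<Rightarrow> real \<Rightarrow> (real \<Rightarrow> 'w \<Rightarrow> real^3) \<Rightarrow> 'w \<Rightarrow> ereal" where
  "inner_hitting_time l t0 S t X \<omega> =
     Inf {ereal s | s. 0 \<le> s \<and> ereal s \<le> exit_time S t X \<omega> \<and> t0 < t - s \<and>
                       norm (X s \<omega>) = l (t - s)}"

text \<open>The noise is additive, so the stochastic differential equation is a pathwise integral equation.
  After the exit time the path is only required to be continuous (it may be frozen there, say).\<close>

definition solves_sde_until_exit ::
    "'w measure \<Rightarrow> (real \<Rightarrow> 'w measure) \<Rightarrow> (real \<Rightarrow> 'w \<Rightarrow> real^3) \<Rightarrow> real \<Rightarrow> (spacetime \<Rightarrow> real^3)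
      \<Rightarrow> spacetime set \<Rightarrow> real^3 \<Rightarrow> real \<Rightarrow> (real \<Rightarrow> 'w \<Rightarrow> real^3) \<Rightarrow> bool" where
  "solves_sde_until_exit M F W \<nu> b S x t X \<longleftrightarrow>
     (\<forall>s\<ge>0. X s \<in> borel_measurable (F s)) \<and>
     (\<forall>\<omega>\<in>space M. continuous_on {0..} (\<lambda>s. X s \<omega>)) \<and>
     (AE \<omega> in M. X 0 \<omega> = x \<and>
        (\<forall>s. 0 \<le> s \<and> ereal s < exit_time S t X \<omega> \<longrightarrow>
           X s \<omega> = x - integral {0..s} (\<lambda>r. b (X r \<omega>, t - r)) + sqrt (2 * \<nu>) *\<^sub>R W s \<omega>))"

end

(* On the slab between two times the closure of the region is compact and misses the blow-up time, so the
   maximum principle needs no growth condition on b; the inflow condition says x . b >= (k + 1) nu, which makes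
   |x|^k and |log |x||^(-gamma) supersolutions.
   For the hitting time no stochastic calculus is used. The noise is additive, so over a short step h, on paths
   that oscillate little, |X|^2 is bounded pathwise by |X + sqrt (2 nu) dW|^2 - 2 (k' + 1) nu h with k' < k.
   This is one step of a Bessel process of dimension 2 - k', whose survival probability is the regularised
   incomplete Gamma function of |x|^2 / (4 nu s). A Taylor expansion shows that each step loses O(h^(3/2)),
   so the total loss vanishes with h, and the Gamma function is bounded by its leading power.
   The second bound is Ottaviani's maximal inequality: before reaching |x|/2 the drift is at most C / |x|, so
   the noise must account for the displacement. *)
theory Submission
  imports Defs
begin

section \<open>Radial functions and local regularity\<close>

text \<open>The supersolution |x|^k carries no time, so it cannot give decay in s. The survival
  probability of the comparison process does, and its leading power supplies the constant 1 / Gamma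
  (k / 2 + 1). As a function of |x|^2 / (4 \<nu> T) it is singular at x = 0 and at T = 0. On a
  compact time interval a path in the region keeps a distance m from the origin, but a free Gaussian
  step need not, so the argument is clamped from below at some c > 0; the final time is shifted by
  \<theta> > 0. The rate has to drop from k to some k' < k because the drift is frozen over a step,
  at a cost proportional to the oscillation \<delta> of the path. Paths have no common modulus of
  continuity, so \<delta> is fixed by k - k', and every path meets it on all sufficiently fine
  grids. The parameters are removed in this order: the mesh h, then \<theta>, then k' together with
  a time slightly below s. The drift is treated only through its continuity and two bounds on the
  region; its continuity is itself a point to prove, since \<Phi> is only known through the
  vorticity.\<close>

lemma grad_eq:
  assumes "(f has_derivative f') (at x)"
  shows "grad f x = (\<chi> i. f' (axis i 1))"
  using frechet_derivative_at[OF assms] by (simp add: grad_def)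

lemma frechet_derivative_eq_grad:
  assumes "f differentiable (at x)"
  shows "frechet_derivative f (at x) v = grad f x \<bullet> v"
proof -
  let ?D = "frechet_derivative f (at x)"
  have lin: "linear ?D"
    using assms by (rule linear_frechet_derivative)
  have "?D v = ?D (\<Sum>i\<in>UNIV. v $ i *\<^sub>R axis i 1)"
    by (simp add: basis_expansion scalar_mult_eq_scaleR[symmetric])
  also have "\<dots> = (\<Sum>i\<in>UNIV. v $ i * ?D (axis i 1))"
    by (simp add: linear_sum[OF lin] linear_cmul[OF lin])
  finally show ?thesis
    by (simp add: grad_def inner_vec_def mult.commute)
qed

lemma grad_cong_eventually:
  assumes "eventually (\<lambda>y. f y = g y) (nhds x)"
  shows "grad f x = grad g x" "f differentiable (at x) \<longleftrightarrow> g differentiable (at x)"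
proof -
  have "(f has_derivative D) (at x) = (g has_derivative D) (at x)" for D
  proof -
    have *: "eventually (\<lambda>y. f y = g y) (at x)" "f x = g x"
      using assms by (auto simp: eventually_nhds_conv_at)
    show ?thesis
      using has_derivative_transform_eventually[of f D x UNIV g]
        has_derivative_transform_eventually[of g D x UNIV f] * by (auto simp: eq_commute)
  qed
  then show "grad f x = grad g x" "f differentiable (at x) \<longleftrightarrow> g differentiable (at x)"
    by (simp_all add: grad_def frechet_derivative_def differentiable_def)
qed

definition regular_at :: "(spacetime \<Rightarrow> real) \<Rightarrow> real^3 \<Rightarrow> real \<Rightarrow> bool" where
  "regular_at w x t \<longleftrightarrow> (\<lambda>s. w (x, s)) differentiable (at t) \<and>
     (\<forall>\<^sub>F y in nhds x. (\<lambda>z. w (z, t)) differentiable (at y)) \<and>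
     (\<forall>i. (\<lambda>y. grad (\<lambda>z. w (z, t)) y $ i) differentiable (at x))"

lemma open_slice:
  assumes "open S"
  shows "open {x. (x, t) \<in> S}"
proof -
  have "open ((\<lambda>x. (x, t)) -` S)"
    by (intro open_vimage assms continuous_intros)
  then show ?thesis by (simp add: vimage_def)
qed

lemma C21_on_imp_regular_at:
  assumes "open S" "C21_on S w" "(x, t) \<in> S"
  shows "regular_at w x t"
proof -
  have "\<forall>\<^sub>F y in nhds x. y \<in> {y. (y, t) \<in> S}"
    using open_slice[OF assms(1)] assms(3) by (intro eventually_nhds_in_open) auto
  then have "\<forall>\<^sub>F y in nhds x. (\<lambda>z. w (z, t)) differentiable (at y)"
    by eventually_elim (use assms(2) in \<open>auto simp: C21_on_def\<close>)
  with assms show ?thesis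
    by (auto simp: regular_at_def C21_on_def)
qed

lemma grad_linear:
  assumes "f differentiable (at x)" "g differentiable (at x)"
  shows "grad (\<lambda>y. a * f y + c * g y) x = a *\<^sub>R grad f x + c *\<^sub>R grad g x"
proof -
  have "((\<lambda>y. a * f y + c * g y) has_derivative
      (\<lambda>h. a * frechet_derivative f (at x) h + c * frechet_derivative g (at x) h)) (at x)"
    using assms[THEN frechet_derivative_works[THEN iffD1]] by (auto intro!: derivative_eq_intros)
  from grad_eq[OF this] show ?thesis
    by (simp add: grad_def vec_eq_iff)
qed

lemma
  assumes w: "regular_at w x t" and v: "regular_at v x t"
  shows regular_at_linear: "regular_at (\<lambda>p. a * w p + c * v p) x t"
    and parabolic_op_linear: "parabolic_op \<nu> b (\<lambda>p. a * w p + c * v p) (x, t) =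
      a * parabolic_op \<nu> b w (x, t) + c * parabolic_op \<nu> b v (x, t)"
proof -
  let ?u = "\<lambda>p. a * w p + c * v p"
  have ev: "\<forall>\<^sub>F y in nhds x. (\<lambda>z. w (z, t)) differentiable (at y) \<and> (\<lambda>z. v (z, t)) differentiable (at y)"
    using w v by (auto simp: regular_at_def eventually_conj)
  then have ev_grad: "\<forall>\<^sub>F y in nhds x. grad (\<lambda>z. ?u (z, t)) y $ i =
      a * (grad (\<lambda>z. w (z, t)) y $ i) + c * (grad (\<lambda>z. v (z, t)) y $ i)" for i
    by eventually_elim (simp add: grad_linear)
  have wv: "(\<lambda>y. grad (\<lambda>z. w (z, t)) y $ i) differentiable (at x)"
    "(\<lambda>y. grad (\<lambda>z. v (z, t)) y $ i) differentiable (at x)" for i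
    using w v by (auto simp: regular_at_def)
  have d: "(\<lambda>y. grad (\<lambda>z. ?u (z, t)) y $ i) differentiable (at x)" for i
    unfolding grad_cong_eventually(2)[OF ev_grad]
    by (intro derivative_intros wv)
  have t: "(\<lambda>s. w (x, s)) differentiable (at t)" "(\<lambda>s. v (x, s)) differentiable (at t)"
    using w v by (auto simp: regular_at_def)
  show "regular_at ?u x t"
    unfolding regular_at_def
  proof (intro conjI allI d)
    show "(\<lambda>s. ?u (x, s)) differentiable (at t)"
      by (intro derivative_intros t)
    show "\<forall>\<^sub>F y in nhds x. (\<lambda>z. ?u (z, t)) differentiable (at y)"
      using ev by eventually_elim (auto intro!: derivative_intros)
  qed
  have sec: "frechet_derivative (\<lambda>y. grad (\<lambda>z. ?u (z, t)) y $ i) (at x) (axis i 1) =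
    a * frechet_derivative (\<lambda>y. grad (\<lambda>z. w (z, t)) y $ i) (at x) (axis i 1) +
    c * frechet_derivative (\<lambda>y. grad (\<lambda>z. v (z, t)) y $ i) (at x) (axis i 1)" for i
    using grad_cong_eventually(1)[OF ev_grad, of i] grad_linear[OF wv(1)[of i] wv(2)[of i], where a = a and c = c]
    by (simp add: grad_def vec_eq_iff)
  have lap: "laplacian (\<lambda>y. ?u (y, t)) x =
      a * laplacian (\<lambda>y. w (y, t)) x + c * laplacian (\<lambda>y. v (y, t)) x"
    unfolding laplacian_def by (simp only: sec sum.distrib sum_distrib_left)
  have gr: "grad (\<lambda>y. ?u (y, t)) x = a *\<^sub>R grad (\<lambda>y. w (y, t)) x + c *\<^sub>R grad (\<lambda>y. v (y, t)) x"
    using eventually_nhds_x_imp_x[OF ev] by (intro grad_linear) auto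
  have "deriv (\<lambda>s. ?u (x, s)) t = a * deriv (\<lambda>s. w (x, s)) t + c * deriv (\<lambda>s. v (x, s)) t"
    using t[unfolded real_differentiable_def]
    by (auto intro!: DERIV_imp_deriv derivative_eq_intros simp: DERIV_imp_deriv)
  then show "parabolic_op \<nu> b ?u (x, t) =
      a * parabolic_op \<nu> b w (x, t) + c * parabolic_op \<nu> b v (x, t)"
    unfolding parabolic_op_def by (simp add: lap gr inner_add_right algebra_simps)
qed

text \<open>Radial functions are written in z = |x|^2, a polynomial in x, so the norm itself is
  never differentiated. The 6 is twice the dimension.\<close>

lemma
  fixes x :: "real^3"
  assumes S: "open S" "x \<bullet> x \<in> S"
    and \<phi>: "\<And>z. z \<in> S \<Longrightarrow> (\<phi> has_real_derivative \<phi>1 z) (at z)"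
    and \<phi>1: "(\<phi>1 has_real_derivative \<phi>2) (at (x \<bullet> x))"
  shows regular_at_radial: "regular_at (\<lambda>p. \<phi> (fst p \<bullet> fst p)) x t"
    and parabolic_op_radial: "parabolic_op \<nu> b (\<lambda>p. \<phi> (fst p \<bullet> fst p)) (x, t) =
      2 * \<phi>1 (x \<bullet> x) * (x \<bullet> b (x, t)) - \<nu> * (4 * (x \<bullet> x) * \<phi>2 + 6 * \<phi>1 (x \<bullet> x))"
proof -
  have der: "((\<lambda>y. \<phi> (y \<bullet> y)) has_derivative (\<lambda>h. 2 * \<phi>1 (y \<bullet> y) * (y \<bullet> h))) (at y)"
    if "y \<bullet> y \<in> S" for y :: "real^3"
  proof -
    have "((\<lambda>y. y \<bullet> y) has_derivative (\<lambda>h. 2 * (y \<bullet> h))) (at y)"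
      by (auto intro!: derivative_eq_intros simp: inner_commute)
    from DERIV_compose_FDERIV[OF \<phi>[OF that] this] show ?thesis
      by (simp add: algebra_simps)
  qed
  have "\<forall>\<^sub>F y in nhds x. y \<in> (\<lambda>y. y \<bullet> y) -` S"
    using S by (intro eventually_nhds_in_open open_vimage continuous_intros) auto
  then have ev: "\<forall>\<^sub>F y in nhds x. y \<bullet> y \<in> S" by simp
  then have ev_grad: "\<forall>\<^sub>F y in nhds x. grad (\<lambda>y. \<phi> (y \<bullet> y)) y $ i = 2 * \<phi>1 (y \<bullet> y) * y $ i" for i
    by eventually_elim (simp add: grad_eq[OF der] inner_axis)
  have der2: "((\<lambda>y. 2 * \<phi>1 (y \<bullet> y) * y $ i) has_derivative
      (\<lambda>h. 4 * \<phi>2 * (x \<bullet> h) * x $ i + 2 * \<phi>1 (x \<bullet> x) * h $ i)) (at x)" for i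
  proof -
    have "((\<lambda>y. y \<bullet> y) has_derivative (\<lambda>h. 2 * (x \<bullet> h))) (at x)"
      by (auto intro!: derivative_eq_intros simp: inner_commute)
    from DERIV_compose_FDERIV[OF \<phi>1 this] show ?thesis
      by (auto intro!: derivative_eq_intros bounded_linear.has_derivative[OF bounded_linear_vec_nth has_derivative_ident]
          simp: algebra_simps)
  qed
  have gd: "(\<lambda>y. grad (\<lambda>y. \<phi> (y \<bullet> y)) y $ i) differentiable (at x)" for i
    unfolding grad_cong_eventually(2)[OF ev_grad] using der2 by (auto simp: differentiable_def)
  show "regular_at (\<lambda>p. \<phi> (fst p \<bullet> fst p)) x t"
    unfolding regular_at_def using gd ev
    by (auto elim!: eventually_mono simp: differentiable_def intro: der)
  have "frechet_derivative (\<lambda>y. grad (\<lambda>y. \<phi> (y \<bullet> y)) y $ i) (at x) (axis i 1)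
      = 4 * \<phi>2 * (x $ i)\<^sup>2 + 2 * \<phi>1 (x \<bullet> x)" for i
  proof -
    have "frechet_derivative (\<lambda>y. grad (\<lambda>y. \<phi> (y \<bullet> y)) y $ i) (at x) (axis i 1)
        = grad (\<lambda>y. grad (\<lambda>y. \<phi> (y \<bullet> y)) y $ i) x $ i"
      by (simp add: grad_def)
    also have "\<dots> = grad (\<lambda>y. 2 * \<phi>1 (y \<bullet> y) * y $ i) x $ i"
      by (simp only: grad_cong_eventually(1)[OF ev_grad])
    finally show ?thesis
      by (simp add: grad_eq[OF der2] inner_axis power2_eq_square)
  qed
  then have "laplacian (\<lambda>y. \<phi> (y \<bullet> y)) x = 4 * (x \<bullet> x) * \<phi>2 + 6 * \<phi>1 (x \<bullet> x)"
    by (simp add: laplacian_def sum.distrib sum_distrib_left[symmetric] inner_vec_def power2_eq_square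
        mult.commute)
  moreover have "grad (\<lambda>y. \<phi> (y \<bullet> y)) x = (2 * \<phi>1 (x \<bullet> x)) *\<^sub>R x"
    using grad_eq[OF der[OF S(2)]] by (simp add: vec_eq_iff inner_axis)
  ultimately show "parabolic_op \<nu> b (\<lambda>p. \<phi> (fst p \<bullet> fst p)) (x, t) =
      2 * \<phi>1 (x \<bullet> x) * (x \<bullet> b (x, t)) - \<nu> * (4 * (x \<bullet> x) * \<phi>2 + 6 * \<phi>1 (x \<bullet> x))"
    by (simp add: parabolic_op_def inner_commute)
qed

section \<open>The maximum principle\<close>

text \<open>The i-th component of the gradient vanishes at x, so a positive second derivative would
  make it positive just beyond x; the mean value theorem then finds a larger value of f on that
  axis. This argument gets by with a gradient that is differentiable at x alone.\<close>

lemma second_derivative_nonpos_at_max: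
  fixes f :: "real^3 \<Rightarrow> real"
  assumes d: "\<forall>\<^sub>F y in nhds x. f differentiable (at y)"
    and d2: "(\<lambda>y. grad f y $ i) differentiable (at x)"
    and max: "\<forall>\<^sub>F y in nhds x. f y \<le> f x"
    and g0: "grad f x = 0"
  shows "frechet_derivative (\<lambda>y. grad f y $ i) (at x) (axis i 1) \<le> 0"
proof (rule ccontr)
  let ?e = "axis i 1 :: real^3"
  let ?D = "frechet_derivative (\<lambda>y. grad f y $ i) (at x)"
  assume neg: "\<not> ?D ?e \<le> 0"
  obtain r where r: "r > 0" "\<And>y. dist y x < r \<Longrightarrow> f differentiable (at y) \<and> f y \<le> f x"
    using eventually_conj[OF d max] by (auto simp: eventually_nhds_metric)
  have line: "((\<lambda>s. x + s *\<^sub>R ?e) has_derivative (\<lambda>h. h *\<^sub>R ?e)) (at s)" for s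
    by (auto intro!: derivative_eq_intros)
  have lin: "linear ?D"
    using d2 by (rule linear_frechet_derivative)
  have "((\<lambda>s. grad f (x + s *\<^sub>R ?e) $ i) has_derivative (\<lambda>h. ?D (h *\<^sub>R ?e))) (at 0)"
    using has_derivative_compose[OF line[of 0], of "\<lambda>y. grad f y $ i" ?D] frechet_derivative_works[THEN iffD1, OF d2]
    by simp
  then have "((\<lambda>s. grad f (x + s *\<^sub>R ?e) $ i) has_real_derivative ?D ?e) (at 0)"
    unfolding has_field_derivative_def by (simp add: linear_cmul[OF lin] mult_commute_abs)
  then obtain e where e: "e > 0"
      "\<And>h. 0 < h \<Longrightarrow> h < e \<Longrightarrow> grad f x $ i < grad f (x + h *\<^sub>R ?e) $ i"
    using DERIV_pos_inc_right[of "\<lambda>s. grad f (x + s *\<^sub>R ?e) $ i" "?D ?e" 0] neg by auto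
  define h where "h = min r e / 2"
  have h: "0 < h" "h < r" "h < e" using r e by (auto simp: h_def min_def)
  have "\<exists>z>0. z < h \<and> f (x + h *\<^sub>R ?e) - f (x + 0 *\<^sub>R ?e) = (h - 0) * (grad f (x + z *\<^sub>R ?e) $ i)"
  proof (rule MVT2[OF h(1)])
    fix s assume s: "0 \<le> s" "s \<le> h"
    have "f differentiable (at (x + s *\<^sub>R ?e))"
      using s h by (intro conjunct1[OF r(2)]) (simp add: dist_norm)
    from has_derivative_compose[OF line frechet_derivative_works[THEN iffD1, OF this]]
    show "((\<lambda>s. f (x + s *\<^sub>R ?e)) has_real_derivative grad f (x + s *\<^sub>R ?e) $ i) (at s)"
      by (simp add: has_field_derivative_def frechet_derivative_eq_grad[OF \<open>f differentiable (at (x + s *\<^sub>R ?e))\<close>]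
          inner_axis mult_commute_abs)
  qed
  then obtain z where z: "0 < z" "z < h" "f (x + h *\<^sub>R ?e) - f x = h * (grad f (x + z *\<^sub>R ?e) $ i)"
    by auto
  have "f (x + h *\<^sub>R ?e) \<le> f x"
    using h by (intro conjunct2[OF r(2)]) (simp add: dist_norm)
  moreover have "grad f (x + z *\<^sub>R ?e) $ i > 0"
    using e(2)[of z] z h g0 by simp
  ultimately show False using z h mult_pos_pos[of h "grad f (x + z *\<^sub>R ?e) $ i"] by linarith
qed

text \<open>At such a point the gradient vanishes, which removes the drift whatever \<open>b\<close>
  is; the Laplacian is at most 0 and the time derivative at least \<delta>. Only earlier times are
  compared, because the maximum may lie on the last time slice.\<close>

lemma parabolic_op_ge_at_max:
  assumes \<nu>: "\<nu> \<ge> 0" and reg: "regular_at w x t"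
    and max: "\<forall>\<^sub>F y in nhds x. w (y, t) \<le> w (x, t)"
    and maxt: "\<forall>\<^sub>F s in at_left t. w (x, s) - \<delta> * s \<le> w (x, t) - \<delta> * t"
  shows "\<delta> \<le> parabolic_op \<nu> b w (x, t)"
proof -
  let ?f = "\<lambda>y. w (y, t)"
  have ev: "\<forall>\<^sub>F y in nhds x. ?f differentiable (at y)" using reg by (simp add: regular_at_def)
  have fd: "?f differentiable (at x)" by (rule eventually_nhds_x_imp_x[OF ev])
  have "frechet_derivative ?f (at x) = (\<lambda>v. 0)"
  proof -
    obtain r where r: "r > 0" "\<And>y. dist y x < r \<Longrightarrow> ?f y \<le> ?f x"
      using max by (auto simp: eventually_nhds_metric)
    show ?thesis
      using r by (intro differential_zero_maxmin[of x "ball x r" ?f] frechet_derivative_works[THEN iffD1] fd)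
        (auto simp: dist_commute)
  qed
  then have g0: "grad ?f x = 0" by (simp add: grad_def vec_eq_iff)
  have lap: "laplacian ?f x \<le> 0"
    unfolding laplacian_def using reg
    by (intro sum_nonpos second_derivative_nonpos_at_max ev max g0) (auto simp: regular_at_def)
  obtain D where D: "((\<lambda>s. w (x, s)) has_real_derivative D) (at t)"
    using reg by (auto simp: regular_at_def real_differentiable_def)
  have "\<delta> \<le> D"
  proof (rule ccontr)
    assume "\<not> \<delta> \<le> D"
    moreover have "((\<lambda>s. w (x, s) - \<delta> * s) has_real_derivative D - \<delta>) (at t)"
      by (auto intro!: derivative_eq_intros D)
    ultimately obtain e where e: "e > 0"
        "\<And>h. 0 < h \<Longrightarrow> h < e \<Longrightarrow> w (x, t) - \<delta> * t < w (x, t - h) - \<delta> * (t - h)"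
      using DERIV_neg_dec_left[of "\<lambda>s. w (x, s) - \<delta> * s" "D - \<delta>" t] by auto
    obtain a where a: "a < t" "\<And>s. a < s \<Longrightarrow> s < t \<Longrightarrow> w (x, s) - \<delta> * s \<le> w (x, t) - \<delta> * t"
      using maxt by (auto simp: eventually_at_left[of "t - 1"])
    define h where "h = min e (t - a) / 2"
    have "0 < h" "h < e" "a < t - h" using a e by (auto simp: h_def min_def field_simps)
    with e(2)[of h] a(2)[of "t - h"] show False by auto
  qed
  then show ?thesis
    using mult_nonneg_nonpos[OF \<nu> lap] g0 DERIV_imp_deriv[OF D] by (simp add: parabolic_op_def)
qed

lemma open_region:
  assumes "continuous_on {t0<..<T} l"
  shows "open (region l R t0 T)"
proof -
  let ?U = "UNIV \<times> {t0<..<T} :: spacetime set"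
  have U: "open ?U" by (intro open_Times) auto
  have "continuous_on ?U (\<lambda>p. norm (fst p) - l (snd p))"
    by (intro continuous_intros continuous_on_compose2[OF assms]) auto
  then have "open (?U \<inter> (\<lambda>p. norm (fst p) - l (snd p)) -` {0<..})"
    using U by (intro continuous_open_preimage) auto
  moreover have "open ((\<lambda>p :: spacetime. norm (fst p)) -` {..<R})"
    by (intro open_vimage continuous_intros)
  ultimately have "open (?U \<inter> (\<lambda>p. norm (fst p) - l (snd p)) -` {0<..}
      \<inter> (\<lambda>p :: spacetime. norm (fst p)) -` {..<R})"
    by (rule open_Int)
  moreover have "region l R t0 T = ?U \<inter> (\<lambda>p. norm (fst p) - l (snd p)) -` {0<..}
      \<inter> (\<lambda>p :: spacetime. norm (fst p)) -` {..<R}"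
    by (auto simp: region_def)
  ultimately show ?thesis by simp
qed

lemma closure_region:
  assumes l: "continuous_on {t0<..<T} l" and p: "(x, t) \<in> closure (region l R t0 T)"
  shows "norm x \<le> R" "t0 \<le> t" "t0 < t \<Longrightarrow> t < T \<Longrightarrow> l t \<le> norm x"
proof -
  obtain f where f: "\<And>n. f n \<in> region l R t0 T" "f \<longlonglongrightarrow> (x, t)"
    using p by (auto simp: closure_sequential)
  have x: "(\<lambda>n. norm (fst (f n))) \<longlonglongrightarrow> norm x" and t: "(\<lambda>n. snd (f n)) \<longlonglongrightarrow> t"
    using f(2) by (auto intro!: tendsto_norm dest: tendsto_fst tendsto_snd)
  have A: "l (snd (f n)) < norm (fst (f n))" "norm (fst (f n)) < R" "t0 < snd (f n)" for n
    using f(1)[of n] by (auto simp: region_def split: prod.splits)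
  show "norm x \<le> R" using x A(2) by (intro LIMSEQ_le_const2[OF x]) (auto intro: less_imp_le)
  show "t0 \<le> t" using t A(3) by (intro LIMSEQ_le_const[OF t]) (auto intro: less_imp_le)
  assume "t0 < t" "t < T"
  then have "isCont l t" using l by (simp add: continuous_on_eq_continuous_at)
  then have "(\<lambda>n. l (snd (f n))) \<longlonglongrightarrow> l t" using t by (rule isCont_tendsto_compose)
  from LIMSEQ_le[OF this x] A(1) show "l t \<le> norm x" by (auto intro: less_imp_le)
qed

text \<open>Continuity of \<open>l\<close> excludes limit points below the inner scale, so before
  time T the closure adds parabolic boundary points only.\<close>

lemma closure_region_subset:
  assumes "continuous_on {t0<..<T} l" "(x, t) \<in> closure (region l R t0 T)" "t < T"
  shows "(x, t) \<in> region l R t0 T \<union> parabolic_boundary l R t0 T"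
  using closure_region[OF assms(1,2)] assms(2,3)
  by (force simp: region_def parabolic_boundary_def initial_slice_def inner_boundary_def outer_boundary_def)

text \<open>An arbitrary starting time s0 serves two uses: for s0 = t0 the slice condition
  \<open>bd0\<close> is vacuous, since the region contains no point with time t0, and for a later s0
  it carries the data of that slice.\<close>

lemma max_principle:
  assumes l: "continuous_on {t0<..<T} l" and \<nu>: "\<nu> \<ge> 0" and s0: "t0 \<le> s0" and t1: "t1 < T"
    and A: "A = region l R t0 T" and PA: "PA = parabolic_boundary l R t0 T"
    and reg: "\<And>x t. (x, t) \<in> A \<Longrightarrow> regular_at w x t"
    and cont: "continuous_on (A \<union> PA) w"
    and L: "\<And>x t. (x, t) \<in> A \<Longrightarrow> parabolic_op \<nu> b w (x, t) \<le> 0"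
    and bd: "\<And>x t. (x, t) \<in> PA \<Longrightarrow> s0 \<le> t \<Longrightarrow> t \<le> t1 \<Longrightarrow> w (x, t) \<le> c"
    and bd0: "\<And>x. (x, s0) \<in> A \<Longrightarrow> w (x, s0) \<le> c"
    and p: "(x, t) \<in> A" "s0 \<le> t" "t \<le> t1"
  shows "w (x, t) \<le> c"
proof (rule field_le_epsilon)
  fix e :: real assume e: "0 < e"
  \<comment> \<open>The penalty \<delta> (t - s0) forces the operator to be at least \<delta> > 0 at
    an interior maximum, against \<open>L\<close>. It costs at most e at time t; the 1 in the
    denominator covers t = s0.\<close>
  define \<delta> where "\<delta> = e / (t - s0 + 1)"
  have \<delta>: "\<delta> > 0" "\<delta> * (t - s0) \<le> e" using e p by (auto simp: \<delta>_def field_simps)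
  define Q where "Q = closure A \<inter> {p. s0 \<le> snd p \<and> snd p \<le> t1}"
  have opA: "open A" unfolding A by (rule open_region[OF l])
  have QA: "Q \<subseteq> A \<union> PA"
  proof safe
    fix y r assume "(y, r) \<in> Q" "(y, r) \<notin> PA"
    with closure_region_subset[OF l, of y r R] t1 show "(y, r) \<in> A" by (auto simp: Q_def A PA)
  qed
  have "closed Q" unfolding Q_def
    by (intro closed_Int closed_closure closed_Collect_conj closed_Collect_le continuous_intros)
  moreover have "Q \<subseteq> cball 0 R \<times> {s0..t1}"
    using closure_region(1)[OF l] by (auto simp: Q_def A)
  then have "bounded Q"
    by (rule bounded_subset[rotated]) (intro bounded_Times bounded_cball bounded_closed_interval)
  ultimately have "compact Q" by (simp add: compact_eq_bounded_closed)
  moreover have pQ: "(x, t) \<in> Q" using p closure_subset[of A] by (auto simp: Q_def)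
  moreover have "continuous_on Q (\<lambda>p. w p - \<delta> * (snd p - s0))"
    by (intro continuous_intros continuous_on_subset[OF cont QA])
  ultimately obtain P where P: "P \<in> Q"
      "\<And>q. q \<in> Q \<Longrightarrow> w q - \<delta> * (snd q - s0) \<le> w P - \<delta> * (snd P - s0)"
    using continuous_attains_sup[of Q "\<lambda>p. w p - \<delta> * (snd p - s0)"] by blast
  obtain y r where yr: "P = (y, r)" by (cases P)
  have r: "s0 \<le> r" "r \<le> t1" using P yr by (auto simp: Q_def)
  have "w (y, r) \<le> c"
  proof (cases "(y, r) \<in> PA \<or> r = s0")
    case True
    then show ?thesis using bd r bd0 P QA yr by auto
  next
    case False
    then have yA: "(y, r) \<in> A" and r0: "s0 < r" using QA P r yr by auto
    have "\<forall>\<^sub>F z in nhds y. z \<in> {z. (z, r) \<in> A}"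
      using open_slice[OF opA] yA by (intro eventually_nhds_in_open) auto
    then have 1: "\<forall>\<^sub>F z in nhds y. w (z, r) \<le> w (y, r)"
    proof eventually_elim
      case (elim z)
      then have "(z, r) \<in> Q" using r closure_subset[of A] by (auto simp: Q_def)
      from P(2)[OF this] show ?case by (simp add: yr)
    qed
    have "open ((\<lambda>s. (y, s)) -` A)" by (intro open_vimage opA continuous_intros)
    then have "\<forall>\<^sub>F s in nhds r. s \<in> (\<lambda>s. (y, s)) -` A"
      using yA by (intro eventually_nhds_in_open) auto
    then have "\<forall>\<^sub>F s in at_left r. (y, s) \<in> A"
      by (auto simp: at_within_def eventually_inf_principal elim: eventually_mono)
    moreover have "\<forall>\<^sub>F s in at_left r. s0 < s \<and> s < r"
      using r0 by (auto simp: eventually_at_left[OF r0])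
    ultimately have 2: "\<forall>\<^sub>F s in at_left r. w (y, s) - \<delta> * s \<le> w (y, r) - \<delta> * r"
    proof eventually_elim
      case (elim s)
      then have "(y, s) \<in> Q" using r closure_subset[of A] by (auto simp: Q_def)
      from P(2)[OF this] show ?case by (simp add: yr algebra_simps)
    qed
    have "\<delta> \<le> parabolic_op \<nu> b w (y, r)"
      using yA by (intro parabolic_op_ge_at_max \<nu> reg 1 2)
    with L[OF yA] \<delta> show ?thesis by auto
  qed
  moreover have "w (x, t) - \<delta> * (t - s0) \<le> w (y, r) - \<delta> * (r - s0)"
    using P(2)[OF pQ] by (simp add: yr)
  moreover have "0 \<le> \<delta> * (r - s0)" using \<delta> r by simp
  ultimately show "w (x, t) \<le> c + e" using \<delta> by linarith
qed

section \<open>The supersolutions\<close>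

lemma norm_powr_eq: "norm (y :: real^3) powr k = (y \<bullet> y) powr (k / 2)"
  by (simp add: dot_square_norm powr_powr flip: powr_numeral)

text \<open>The set where a continuous |w| exceeds a bound is open, and an open null set is empty;
  so the essential supremum is a true one.\<close>

lemma esssup_slice_le_iff:
  assumes "open S" "continuous_on S w"
  shows "Linf_slice S w t \<le> c \<longleftrightarrow> (\<forall>x. (x, t) \<in> S \<longrightarrow> ennreal \<bar>w (x, t)\<bar> \<le> c)"
proof -
  let ?U = "{x. (x, t) \<in> S}"
  let ?f = "\<lambda>x. ennreal \<bar>w (x, t)\<bar>"
  have U: "open ?U" using assms(1) by (rule open_slice)
  have c: "continuous_on ?U (\<lambda>x. \<bar>w (x, t)\<bar>)"
    by (intro continuous_intros continuous_on_compose2[OF assms(2)]) auto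
  have "(\<lambda>x. \<bar>w (x, t)\<bar>) \<in> borel_measurable (restrict_space lborel ?U)"
    using borel_measurable_continuous_on_restrict[OF c]
    by (simp add: measurable_def sets_restrict_space space_restrict_space)
  then have meas: "?f \<in> borel_measurable (restrict_space lborel ?U)"
    by measurable
  show ?thesis
  proof
    assume *: "\<forall>x. (x, t) \<in> S \<longrightarrow> ?f x \<le> c"
    then show "Linf_slice S w t \<le> c"
      unfolding Linf_slice_def by (intro esssup_I meas) (auto simp: space_restrict_space)
  next
    assume le: "Linf_slice S w t \<le> c"
    show "\<forall>x. (x, t) \<in> S \<longrightarrow> ?f x \<le> c"
    proof (cases "c = top")
      case False
      then obtain m where m: "c = ennreal m" "m \<ge> 0" by (cases c) auto
      have "AE x in restrict_space lborel ?U. ?f x \<le> c"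
        using esssup_AE[of ?f "restrict_space lborel ?U"] le unfolding Linf_slice_def
        by (auto elim: eventually_mono order_trans)
      then have ae: "AE x in lborel. x \<in> ?U \<longrightarrow> \<bar>w (x, t)\<bar> \<le> m"
        using U m by (simp add: AE_restrict_space_iff)
      have "open (?U \<inter> (\<lambda>x. \<bar>w (x, t)\<bar>) -` {m<..})"
        by (intro continuous_open_preimage c U open_greaterThan)
      moreover have "?U \<inter> (\<lambda>x. \<bar>w (x, t)\<bar>) -` {m<..} \<in> null_sets lborel"
        using calculation by (subst AE_iff_null_sets) (auto intro: eventually_mono[OF ae])
      ultimately have "?U \<inter> (\<lambda>x. \<bar>w (x, t)\<bar>) -` {m<..} = {}"
        using open_not_negligible null_sets_completionI by (auto simp: negligible_iff_null_sets)
      then show ?thesis using m by (force simp: not_le)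
    qed simp
  qed
qed

abbreviation (input) power_barrier :: "real \<Rightarrow> spacetime \<Rightarrow> real" where
  "power_barrier k \<equiv> \<lambda>(y, s). norm y powr k"

abbreviation (input) log_barrier :: "real \<Rightarrow> spacetime \<Rightarrow> real" where
  "log_barrier \<gamma> \<equiv> \<lambda>(y, s). \<bar>ln (norm y)\<bar> powr (- \<gamma>)"

lemma boundary_subset_closure: "parabolic_boundary l R t0 T \<subseteq> closure (region l R t0 T)"
  by (auto simp: parabolic_boundary_def initial_slice_def inner_boundary_def outer_boundary_def)

section \<open>The hypotheses on the fluid and the two barriers\<close>

locale screening =
  fixes \<nu> :: real and u \<Phi> l R0 t0 T c0 C0 C\<Phi> Cu k
  assumes setting: "annular_setting \<nu> u \<Phi> l R0 t0 T c0 C0 C\<Phi>"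
    and u_bound: "\<And>x t. (x, t) \<in> region l R0 t0 T \<Longrightarrow> norm (u (x, t)) \<le> Cu / norm x"
    and k: "0 < k" "k < 3"
    and inflow: "(SUP (x, t)\<in>region l R0 t0 T. ereal (norm x * max (- radial u (x, t)) 0))
      + ereal (2 * \<nu> * C\<Phi>) \<le> ereal ((3 - k) * \<nu>)"
begin

abbreviation "A \<equiv> region l R0 t0 T"
abbreviation "PA \<equiv> parabolic_boundary l R0 t0 T"
abbreviation "b \<equiv> drift \<nu> u \<Phi>"

lemma basic: "\<nu> > 0" "0 \<le> t0" "t0 < T" "R0 > 0" "continuous_on {t0<..<T} l" "(l \<longlongrightarrow> 0) (at_left T)" "c0 > 0"
  using setting by (auto simp: annular_setting_def)

lemma open_A: "open A"
  by (rule open_region[OF basic(5)])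

lemma norm_pos: "(x, t) \<in> A \<Longrightarrow> norm x > 0"
  proof -
  assume p: "(x, t) \<in> A"
  then have "0 < l t" using setting by (auto simp: annular_setting_def region_def)
  with p show ?thesis by (auto simp: region_def)
qed

lemma grad_ln_bound: "(x, t) \<in> A \<Longrightarrow> norm (grad (\<lambda>y. ln (\<Phi> (y, t))) x) \<le> C\<Phi> / norm x"
  using setting by (auto simp: annular_setting_def)

lemma inflow_at:
  assumes "(x, t) \<in> A"
  shows "norm x * max (- radial u (x, t)) 0 + 2 * \<nu> * C\<Phi> \<le> (3 - k) * \<nu>"
proof -
  have "ereal (norm x * max (- radial u (x, t)) 0) \<le>
      (SUP (x, t)\<in>A. ereal (norm x * max (- radial u (x, t)) 0))"
    using SUP_upper[OF assms, of "\<lambda>(x, t). ereal (norm x * max (- radial u (x, t)) 0)"] by simp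
  then have "ereal (norm x * max (- radial u (x, t)) 0) + ereal (2 * \<nu> * C\<Phi>) \<le> ereal ((3 - k) * \<nu>)"
    using inflow by (meson add_right_mono order_trans)
  then show ?thesis by simp
qed

lemma norm_radial: "(x, t) \<in> A \<Longrightarrow> norm x * radial v (x, t) = x \<bullet> v (x, t)"
  using norm_pos[of x t] by (simp add: radial_def inner_commute)

text \<open>The balance behind the inflow condition: the term 4 \<nu> x / |x|^2 contributes 4 \<nu>,
  and the inflow and the gradient of ln \<Phi> together take away at most (3 - k) \<nu>.\<close>

lemma drift_inner:
  assumes "(x, t) \<in> A"
  shows "(k + 1) * \<nu> \<le> x \<bullet> b (x, t)"
proof -
  let ?g = "grad (\<lambda>y. ln (\<Phi> (y, t))) x"
  have n: "norm x > 0" using assms by (rule norm_pos)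
  have "x \<bullet> ?g \<le> norm x * norm ?g" by (rule norm_cauchy_schwarz)
  also have "\<dots> \<le> norm x * (C\<Phi> / norm x)"
    using grad_ln_bound[OF assms] n by (intro mult_left_mono) auto
  finally have "x \<bullet> ?g \<le> C\<Phi>" using n by simp
  then have g: "2 * \<nu> * (x \<bullet> ?g) \<le> 2 * \<nu> * C\<Phi>" using basic by (intro mult_left_mono) auto
  have "norm x * (- radial u (x, t)) \<le> norm x * max (- radial u (x, t)) 0"
    by (intro mult_left_mono) auto
  with inflow_at[OF assms] norm_radial[OF assms, of u]
  have "- (x \<bullet> u (x, t)) + 2 * \<nu> * C\<Phi> \<le> (3 - k) * \<nu>" by simp
  moreover have "x \<bullet> b (x, t) = x \<bullet> u (x, t) + 4 * \<nu> - 2 * \<nu> * (x \<bullet> ?g)"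
    using n by (simp add: drift_def inner_add_right inner_diff_right dot_square_norm)
  ultimately show ?thesis using g by (simp add: algebra_simps)
qed

text \<open>The factor \<nu> is taken out so that the remaining constant depends only on Cu / \<nu>
  and C\<Phi>, as the modulus \<eta> must.\<close>

lemma drift_norm:
  assumes "(x, t) \<in> A"
  shows "norm (b (x, t)) \<le> \<nu> * (Cu / \<nu> + 4 + 2 * C\<Phi>) / norm x"
proof -
  let ?g = "grad (\<lambda>y. ln (\<Phi> (y, t))) x"
  have n: "norm x > 0" using assms by (rule norm_pos)
  have "norm (b (x, t)) \<le> norm (u (x, t)) + norm ((4 * \<nu> / (norm x)\<^sup>2) *\<^sub>R x) + norm ((2 * \<nu>) *\<^sub>R ?g)"
    using norm_triangle_ineq4[of "u (x, t) + (4 * \<nu> / (norm x)\<^sup>2) *\<^sub>R x" "(2 * \<nu>) *\<^sub>R ?g"]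
      norm_triangle_ineq[of "u (x, t)" "(4 * \<nu> / (norm x)\<^sup>2) *\<^sub>R x"] by (simp add: drift_def)
  also have "\<dots> \<le> Cu / norm x + 4 * \<nu> / norm x + 2 * \<nu> * (C\<Phi> / norm x)"
    using basic n u_bound[OF assms] mult_left_mono[OF grad_ln_bound[OF assms], of "2 * \<nu>"]
    by (intro add_mono) (auto simp: power2_eq_square)
  also have "\<dots> = \<nu> * (Cu / \<nu> + 4 + 2 * C\<Phi>) / norm x"
    using basic n by (simp add: field_simps)
  finally show ?thesis .
qed

text \<open>Here \<phi>(z) = z^(k/2). The Laplacian of |x|^k is k (k + 1) |x|^(k-2) and the drift
  contributes k |x|^(k-2) (x . b), so the sign is exactly the inequality
  \<open>drift_inner\<close>.\<close>

lemma
  assumes "(x, t) \<in> A"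
  shows regular_at_power: "regular_at (power_barrier k) x t"
    and op_power: "parabolic_op \<nu> b (power_barrier k) (x, t)
      = k * norm x powr (k - 2) * (norm x * radial b (x, t) - (k + 1) * \<nu>)"
    and op_power_nonneg: "parabolic_op \<nu> b (power_barrier k) (x, t) \<ge> 0"
proof -
  have z: "x \<bullet> x > 0" using norm_pos[OF assms] by simp
  have d1: "((\<lambda>z. z powr (k / 2)) has_real_derivative k / 2 * z powr (k / 2 - 1)) (at z)"
    if "z \<in> {0<..}" for z
    using that by (auto intro!: derivative_eq_intros)
  have d2: "((\<lambda>z. k / 2 * z powr (k / 2 - 1)) has_real_derivative
      k / 2 * ((k / 2 - 1) * (x \<bullet> x) powr (k / 2 - 2))) (at (x \<bullet> x))"
    using z by (auto intro!: derivative_eq_intros)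
  have eq: "power_barrier k = (\<lambda>p. (fst p \<bullet> fst p) powr (k / 2))"
    by (auto simp: norm_powr_eq)
  have S: "open {0 :: real<..}" "x \<bullet> x \<in> {0<..}" using z by auto
  show "regular_at (power_barrier k) x t"
    unfolding eq by (rule regular_at_radial[OF S d1 d2])
  have p: "(x \<bullet> x) * (x \<bullet> x) powr (k / 2 - 2) = (x \<bullet> x) powr (k / 2 - 1)"
    using z by (subst powr_mult_base) (auto simp: add.commute)
  have "parabolic_op \<nu> b (power_barrier k) (x, t) =
      2 * (k / 2 * (x \<bullet> x) powr (k / 2 - 1)) * (x \<bullet> b (x, t)) -
      \<nu> * (4 * (x \<bullet> x) * (k / 2 * ((k / 2 - 1) * (x \<bullet> x) powr (k / 2 - 2)))
        + 6 * (k / 2 * (x \<bullet> x) powr (k / 2 - 1)))"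
    unfolding eq by (rule parabolic_op_radial[OF S d1 d2])
  also have "\<dots> = 2 * (k / 2 * (x \<bullet> x) powr (k / 2 - 1)) * (x \<bullet> b (x, t)) -
      \<nu> * (4 * (k / 2 - 1) * (k / 2) * ((x \<bullet> x) * (x \<bullet> x) powr (k / 2 - 2))
        + 6 * (k / 2 * (x \<bullet> x) powr (k / 2 - 1)))"
    by (simp add: algebra_simps)
  also have "\<dots> = k * (x \<bullet> x) powr ((k - 2) / 2) * (x \<bullet> b (x, t) - (k + 1) * \<nu>)"
    unfolding p by (simp add: field_simps)
  finally show *: "parabolic_op \<nu> b (power_barrier k) (x, t)
      = k * norm x powr (k - 2) * (norm x * radial b (x, t) - (k + 1) * \<nu>)"
    by (simp add: norm_powr_eq norm_radial[OF assms])
  show "parabolic_op \<nu> b (power_barrier k) (x, t) \<ge> 0"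
    unfolding * using k drift_inner[OF assms] by (simp add: norm_radial[OF assms])
qed

text \<open>For 0 < |x| < 1 one has |ln |x|| = - ln z / 2 with z = |x|^2, which is smooth in z. The
  Laplacian yields the term \<nu>, since the Laplacian of ln |x| is 1 / |x|^2 in dimension 3, and a
  correction smaller by the factor 1 / |ln |x||.\<close>

lemma
  assumes "(x, t) \<in> A" and x1: "norm x < 1" and \<gamma>: "\<gamma> > 0"
  shows regular_at_log: "regular_at (log_barrier \<gamma>) x t"
    and op_log: "parabolic_op \<nu> b (log_barrier \<gamma>) (x, t)
      = \<gamma> / (norm x)\<^sup>2 * \<bar>ln (norm x)\<bar> powr (- \<gamma> - 1) *
        (x \<bullet> b (x, t) - \<nu> - \<nu> * (\<gamma> + 1) / \<bar>ln (norm x)\<bar>)"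
proof -
  have n: "norm x > 0" by (rule norm_pos[OF assms(1)])
  have z: "0 < x \<bullet> x" "x \<bullet> x < 1"
    using n x1 by (auto simp: dot_square_norm power_less_one_iff)
  let ?\<phi> = "\<lambda>z. (- ln z / 2) powr (- \<gamma>)"
  let ?\<phi>1 = "\<lambda>z. \<gamma> / (2 * z) * (- ln z / 2) powr (- \<gamma> - 1)"
  let ?\<phi>2 = "\<lambda>z. - \<gamma> / (2 * z\<^sup>2) * (- ln z / 2) powr (- \<gamma> - 1)
      + \<gamma> * (\<gamma> + 1) / (4 * z\<^sup>2) * (- ln z / 2) powr (- \<gamma> - 2)"
  have eq: "\<bar>ln (norm y)\<bar> powr (- \<gamma>) = ?\<phi> (y \<bullet> y)" if "y \<bullet> y < 1" "y \<noteq> 0" for y :: "real^3"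
  proof -
    have "ln (y \<bullet> y) = 2 * ln (norm y)"
      using that by (simp add: dot_square_norm ln_realpow)
    moreover have "ln (y \<bullet> y) < 0" using that by (intro ln_less_zero) auto
    ultimately show ?thesis by simp
  qed
  have d1: "(?\<phi> has_real_derivative ?\<phi>1 z) (at z)" if "z \<in> {0<..<1}" for z
    using that by (auto intro!: derivative_eq_intros simp: field_simps)
  have d2: "(?\<phi>1 has_real_derivative ?\<phi>2 (x \<bullet> x)) (at (x \<bullet> x))"
  proof -
    have p: "(- ln (x \<bullet> x) / 2) > 0" using z by simp
    have "(?\<phi>1 has_real_derivative
       - (\<gamma> * 2) / (2 * (x \<bullet> x))\<^sup>2 * (- ln (x \<bullet> x) / 2) powr (- \<gamma> - 1) +
       ((- \<gamma> - 1) * (- ln (x \<bullet> x) / 2) powr (- \<gamma> - 1 - 1) * (- (1 / (x \<bullet> x)) / 2)) * (\<gamma> / (2 * (x \<bullet> x)))) (at (x \<bullet> x))"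
      using z p by (auto intro!: derivative_eq_intros simp: power2_eq_square divide_simps)
    moreover have alg: "- (\<gamma> * 2) / (2 * Z)\<^sup>2 * P + ((- \<gamma> - 1) * Q * (- (1 / Z) / 2)) * (\<gamma> / (2 * Z))
       = - \<gamma> / (2 * Z\<^sup>2) * P + \<gamma> * (\<gamma> + 1) / (4 * Z\<^sup>2) * Q" if "Z \<noteq> 0" for Z P Q :: real
      using that by (simp add: power2_eq_square field_simps)
    moreover have "- \<gamma> - 1 - 1 = - \<gamma> - 2" by simp
    moreover have "x \<bullet> x \<noteq> 0" using z by simp
    ultimately show ?thesis by (simp only: alg[OF \<open>x \<bullet> x \<noteq> 0\<close>] \<open>- \<gamma> - 1 - 1 = - \<gamma> - 2\<close>)
  qed
  have S: "open {0 :: real<..<1}" "x \<bullet> x \<in> {0<..<1}" using z by auto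
  have "\<forall>\<^sub>F y in nhds x. y \<in> (\<lambda>y. y \<bullet> y) -` {0<..<1}"
    using S by (intro eventually_nhds_in_open open_vimage continuous_intros) auto
  then have ev: "\<forall>\<^sub>F y in nhds x. \<bar>ln (norm y)\<bar> powr (- \<gamma>) = ?\<phi> (y \<bullet> y)"
    by eventually_elim (rule eq, auto)
  \<comment> \<open>The identity with \<open>?\<phi>\<close> holds on a neighbourhood of every point
    close to x, so the gradients agree close to x as well; the second derivatives at x need
    this.\<close>
  have ev2: "\<forall>\<^sub>F z in nhds x. grad (\<lambda>y. \<bar>ln (norm y)\<bar> powr (- \<gamma>)) z $ i = grad (\<lambda>y. ?\<phi> (y \<bullet> y)) z $ i" for i
    using ev[THEN eventually_eventually[THEN iffD2]] by eventually_elim (simp add: grad_cong_eventually(1))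
  have ev3: "\<forall>\<^sub>F z in nhds x. (\<lambda>y. \<bar>ln (norm y)\<bar> powr (- \<gamma>)) differentiable (at z) \<longleftrightarrow>
      (\<lambda>y. ?\<phi> (y \<bullet> y)) differentiable (at z)"
    using ev[THEN eventually_eventually[THEN iffD2]] by eventually_elim (simp add: grad_cong_eventually(2))
  have reg: "regular_at (\<lambda>p. ?\<phi> (fst p \<bullet> fst p)) x t"
    by (rule regular_at_radial[OF S d1 d2])
  show "regular_at (log_barrier \<gamma>) x t"
    using reg eventually_cong[OF ev3, of "\<lambda>y. (\<lambda>z. ?\<phi> (z \<bullet> z)) differentiable (at y)"] ev3
    by (auto simp: regular_at_def grad_cong_eventually(2)[OF ev2] elim: eventually_elim2)
  have "parabolic_op \<nu> b (log_barrier \<gamma>) (x, t) =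
      parabolic_op \<nu> b (\<lambda>p. ?\<phi> (fst p \<bullet> fst p)) (x, t)"
  proof -
    have fr: "frechet_derivative F (at x) (axis i 1) = grad F x $ i" for F :: "real^3 \<Rightarrow> real" and i
      by (simp add: grad_def)
    show ?thesis
      by (simp add: parabolic_op_def laplacian_def fr grad_cong_eventually(1)[OF ev] grad_cong_eventually(1)[OF ev2])
  qed
  also have "\<dots> = 2 * ?\<phi>1 (x \<bullet> x) * (x \<bullet> b (x, t)) - \<nu> * (4 * (x \<bullet> x) * ?\<phi>2 (x \<bullet> x) + 6 * ?\<phi>1 (x \<bullet> x))"
    by (rule parabolic_op_radial[OF S d1 d2])
  also have "\<dots> = \<gamma> / (x \<bullet> x) * (- ln (x \<bullet> x) / 2) powr (- \<gamma> - 1) *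
      (x \<bullet> b (x, t) - \<nu> - \<nu> * (\<gamma> + 1) / (- ln (x \<bullet> x) / 2))"
  proof -
    define q where "q = - ln (x \<bullet> x) / 2"
    have q: "q > 0" using z by (simp add: q_def)
    have pq: "q powr (- \<gamma> - 2) = q powr (- \<gamma> - 1) / q"
    proof -
      have e: "- \<gamma> - 2 = (- \<gamma> - 1) - 1" by simp
      show ?thesis unfolding e by (subst powr_diff) (use q in simp)
    qed
    have alg: "2 * (\<gamma> / (2 * Z) * P) * X - \<nu> * (4 * Z * (- \<gamma> / (2 * Z\<^sup>2) * P + \<gamma> * (\<gamma> + 1) / (4 * Z\<^sup>2) * (P / q))
        + 6 * (\<gamma> / (2 * Z) * P)) = \<gamma> / Z * P * (X - \<nu> - \<nu> * (\<gamma> + 1) / q)" if "Z \<noteq> 0" for Z P X :: real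
      using that q by (simp add: power2_eq_square field_simps)
    show ?thesis
      unfolding q_def[symmetric] pq by (rule alg) (use z in simp)
  qed
  also have "- ln (x \<bullet> x) / 2 = \<bar>ln (norm x)\<bar>"
    using n x1 by (simp add: dot_square_norm ln_realpow)
  finally show "parabolic_op \<nu> b (log_barrier \<gamma>) (x, t)
      = \<gamma> / (norm x)\<^sup>2 * \<bar>ln (norm x)\<bar> powr (- \<gamma> - 1) *
        (x \<bullet> b (x, t) - \<nu> - \<nu> * (\<gamma> + 1) / \<bar>ln (norm x)\<bar>)"
    by (simp add: dot_square_norm)
qed

end

text \<open>The 1 enforces a radius of at most exp (-1). The other entry makes |ln |x|| exceed 2
  (\<gamma> + 1) / k inside the ball, so that the correction in \<open>op_log\<close> uses up at
  most half of the reserve k \<nu>.\<close>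

definition log_radius :: "real \<Rightarrow> real \<Rightarrow> real" where
  "log_radius \<gamma> k = exp (- max 1 (2 * (\<gamma> + 1) / k))"

lemma log_radius_bounds: "0 < log_radius \<gamma> k" "log_radius \<gamma> k \<le> exp (-1)" "log_radius \<gamma> k < 1"
  by (auto simp: log_radius_def)

lemma continuous_on_norm_powr:
  "0 < k \<Longrightarrow> continuous_on S (power_barrier k)"
  unfolding case_prod_beta by (intro continuous_on_powr' continuous_intros) auto

text \<open>At the origin Isabelle's \<open>ln 0 = 0\<close> and \<open>0 powr a = 0\<close> give the barrier its limit value \<open>0\<close>.\<close>

lemma continuous_on_log_barrier:
  assumes "\<gamma> > 0" "S \<subseteq> {p. norm (fst p) \<le> exp (-1)}"
  shows "continuous_on S (log_barrier \<gamma>)"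
proof -
  let ?H = "\<lambda>r :: real. \<bar>ln r\<bar> powr (- \<gamma>)"
  have "continuous (at r within {0..exp (-1)}) ?H" if "r \<in> {0..exp (-1)}" for r
  proof (cases "r = 0")
    case True
    have "filterlim (\<lambda>r :: real. - ln r) at_top (at_right 0)"
      using ln_at_0 by (simp add: filterlim_uminus_at_top)
    then have "filterlim (\<lambda>r :: real. \<bar>ln r\<bar>) at_top (at_right 0)"
      by (rule filterlim_at_top_mono) (simp add: abs_ge_minus_self)
    then have "(?H \<longlongrightarrow> 0) (at_right 0)"
      using assms by (intro tendsto_neg_powr) auto
    then have "(?H \<longlongrightarrow> 0) (at 0 within {0..exp (-1)})"
      using at_within_Icc_at_right[of 0 "exp (-1) :: real"] by simp
    then show ?thesis using True by (simp add: continuous_within)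
  next
    case False
    then have r: "0 < r" "r < 1" using that by (auto intro: le_less_trans[of _ "exp (-1)"])
    then have "isCont ?H r"
      using ln_less_zero[OF r] by (intro continuous_intros) auto
    then show ?thesis by (rule continuous_at_imp_continuous_at_within)
  qed
  then have "continuous_on {0..exp (-1)} ?H"
    by (simp add: continuous_on_eq_continuous_within)
  then show ?thesis
    unfolding case_prod_beta using assms(2)
    by (intro continuous_on_compose2[of _ ?H _ "\<lambda>p. norm (fst p)"]) (auto intro!: continuous_intros)
qed

lemma powr_minus_one_eq: "(x :: real) powr (- a - 1) = 1 / x powr (a + 1)"
  using powr_minus_divide[of x "a + 1"] by (metis minus_add_distrib diff_conv_add_uminus)

section \<open>Consequences of the maximum principle\<close>

context screening begin

lemma sup_le_parabolic_boundary:
  assumes w: "C21_on A w" "continuous_on (A \<union> PA) w" "\<And>p. p \<in> A \<Longrightarrow> parabolic_op \<nu> b w p \<le> 0"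
  shows "(SUP p\<in>A. ereal (w p)) \<le> (SUP p\<in>PA. ereal (w p))"
\<comment> \<open>Testing against every real c above the boundary supremum also covers its infinite
  values.\<close>
proof (rule SUP_least, rule ereal_le_real)
  fix p c assume p: "p \<in> A" and c: "(SUP p\<in>PA. ereal (w p)) \<le> ereal c"
  obtain x t where xt: "p = (x, t)" by (cases p)
  have t: "t0 \<le> t" "t < T" using p by (auto simp: xt region_def)
  have bd: "w q \<le> c" if "q \<in> PA" for q
    using order_trans[OF SUP_upper[OF that, of "\<lambda>p. ereal (w p)"] c] by simp
  have "w (x, t) \<le> c"
  proof (rule max_principle[OF basic(5) less_imp_le[OF basic(1)] order_refl t(2) refl refl _ w(2), where b = b])
    show "regular_at w y r" if "(y, r) \<in> A" for y r
      using that by (rule C21_on_imp_regular_at[OF open_A w(1)])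
    show "w (y, t0) \<le> c" if "(y, t0) \<in> A" for y
      using that by (simp add: region_def)
  qed (use w(3) bd t p in \<open>simp_all add: xt\<close>)
  then show "ereal (w p) \<le> ereal c" by (simp add: xt)
qed

lemma regular_at_uminus: "regular_at w x t \<Longrightarrow> regular_at (\<lambda>p. - w p) x t"
  and op_uminus: "regular_at w x t \<Longrightarrow> parabolic_op \<nu> c (\<lambda>p. - w p) (x, t) = - parabolic_op \<nu> c w (x, t)"
  using regular_at_linear[of w x t w "-1" 0] parabolic_op_linear[of w x t w \<nu> c "-1" 0] by simp_all

text \<open>The maximum principle starts on the slice s and is applied to w and to - w. The lateral
  boundary could feed in larger values, so its data are bounded by the norm on that slice.\<close>

lemma Linf_slice_antimono:
  assumes w: "C21_on A w" "continuous_on (A \<union> PA) w" "\<And>p. p \<in> A \<Longrightarrow> parabolic_op \<nu> b w p = 0"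
    and st: "t0 < s" "s \<le> t" "t < T"
    and bd: "\<And>y r. (y, r) \<in> inner_boundary l R0 t0 T \<union> outer_boundary l R0 t0 T \<Longrightarrow>
      s \<le> r \<Longrightarrow> r \<le> t \<Longrightarrow> ennreal \<bar>w (y, r)\<bar> \<le> Linf_slice A w s"
  shows "Linf_slice A w t \<le> Linf_slice A w s"
proof (cases "Linf_slice A w s")
  case (real m)
  have cA: "continuous_on A w" using w(2) by (rule continuous_on_subset) auto
  have slice: "\<bar>w (y, s)\<bar> \<le> m" if "(y, s) \<in> A" for y
    using esssup_slice_le_iff[OF open_A cA, of s "Linf_slice A w s"] real that by auto
  \<comment> \<open>Times from s on are later than t0, so the initial slice drops out.\<close>
  have bdry: "\<bar>w (y, r)\<bar> \<le> m" if "(y, r) \<in> PA" "s \<le> r" "r \<le> t" for y r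
    using bd[of y r] that real st by (auto simp: parabolic_boundary_def initial_slice_def)
  have reg: "regular_at w x t" if "(x, t) \<in> A" for x t
    using that by (rule C21_on_imp_regular_at[OF open_A w(1)])
  have s: "t0 \<le> s" using st by simp
  have "w (x, t) \<le> m" if p: "(x, t) \<in> A" for x
  proof (rule max_principle[OF basic(5) less_imp_le[OF basic(1)] s st(3) refl refl, where b = b and w = "w"])
    show "regular_at w y r" if "(y, r) \<in> A" for y r
      using that by (intro reg)
    show "continuous_on (A \<union> PA) w"
      by (intro w(2))
    show "parabolic_op \<nu> b w (y, r) \<le> 0" if "(y, r) \<in> A" for y r
      using that by (simp add: w(3))
    show "w (y, r) \<le> m" if "(y, r) \<in> PA" "s \<le> r" "r \<le> t" for y r
      using bdry[OF that] by simp
    show "w (y, s) \<le> m" if "(y, s) \<in> A" for y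
      using slice[OF that] by simp
  qed (use p st in simp_all)
  moreover have "- w (x, t) \<le> m" if p: "(x, t) \<in> A" for x
  proof (rule max_principle[OF basic(5) less_imp_le[OF basic(1)] s st(3) refl refl, where b = b and w = "\<lambda>p. - w p"])
    show "regular_at (\<lambda>p. - w p) y r" if "(y, r) \<in> A" for y r
      using that by (intro regular_at_uminus reg)
    show "continuous_on (A \<union> PA) (\<lambda>p. - w p)"
      by (intro continuous_intros w(2))
    show "parabolic_op \<nu> b (\<lambda>p. - w p) (y, r) \<le> 0" if "(y, r) \<in> A" for y r
      using that by (simp add: w(3) op_uminus reg)
    show "- w (y, r) \<le> m" if "(y, r) \<in> PA" "s \<le> r" "r \<le> t" for y r
      using bdry[OF that] by simp
    show "- w (y, s) \<le> m" if "(y, s) \<in> A" for y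
      using slice[OF that] by simp
  qed (use p st in simp_all)
  ultimately show ?thesis
    using real by (auto simp: esssup_slice_le_iff[OF open_A cA] abs_le_iff)
qed simp

text \<open>Subtracting C |x|^k with C \<ge> 0 from a subsolution leaves a subsolution, now with
  data at most 0.\<close>

lemma power_comparison:
  assumes reg: "\<And>x t. (x, t) \<in> A \<Longrightarrow> regular_at w x t"
    and cont: "continuous_on (A \<union> PA) w" and L: "\<And>p. p \<in> A \<Longrightarrow> parabolic_op \<nu> b w p \<le> 0"
    and C: "C \<ge> 0" and bd: "\<And>x t. (x, t) \<in> PA \<Longrightarrow> w (x, t) \<le> C * norm x powr k"
    and p: "(x, t) \<in> A"
  shows "w (x, t) \<le> C * norm x powr k"
proof -
  let ?v = "power_barrier k"
  let ?w = "\<lambda>p. 1 * w p + (- C) * ?v p"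
  have t: "t0 \<le> t" "t < T" using p by (auto simp: region_def)
  have "?w (x, t) \<le> 0"
  proof (rule max_principle[OF basic(5) less_imp_le[OF basic(1)] order_refl t(2) refl refl, where b = b])
    show "regular_at ?w y s" if "(y, s) \<in> A" for y s
      using that by (intro regular_at_linear reg regular_at_power)
    show "continuous_on (A \<union> PA) ?w"
      using k by (intro continuous_intros cont continuous_on_norm_powr)
    show "parabolic_op \<nu> b ?w (y, s) \<le> 0" if "(y, s) \<in> A" for y s
      unfolding parabolic_op_linear[OF reg[OF that] regular_at_power[OF that]]
      using L[OF that] mult_nonneg_nonneg[OF C op_power_nonneg[OF that]] by simp
      show "?w (y, t0) \<le> 0" if "(y, t0) \<in> A" for y
      using that by (simp add: region_def)
    show "?w (y, s) \<le> 0" if "(y, s) \<in> PA" for y s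
      using bd[OF that] by simp
  qed (use p t in simp_all)
  then show ?thesis by simp
qed

text \<open>Serves to derive A0 \<ge> 0 from the bounds on |w|. Close to T the inner scale is below
  R0, so the outer sphere does border the region there.\<close>

lemma outer_boundary_nonempty: "\<exists>x t. (x, t) \<in> outer_boundary l R0 t0 T \<and> norm x = R0"
proof -
  have "\<forall>\<^sub>F t in at_left T. l t < R0"
    using basic(4,6) by (intro order_tendstoD) auto
  moreover have "\<forall>\<^sub>F t in at_left T. t0 < t \<and> t < T"
    using basic(3) by (auto simp: eventually_at_left[OF basic(3)])
  ultimately have "\<forall>\<^sub>F t in at_left T. l t < R0 \<and> t0 < t \<and> t < T"
    by eventually_elim auto
  then obtain t where t: "l t < R0" "t0 < t" "t < T"
    using eventually_happens'[OF trivial_limit_at_left_real] by blast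
  have lt: "0 < l t" using setting t by (auto simp: annular_setting_def)
  let ?e = "axis 1 1 :: real^3"
  have "(R0 *\<^sub>R ?e, t) \<in> closure A"
    unfolding closure_approachable
  proof (intro allI impI)
    fix e :: real assume e: "0 < e"
    define d where "d = min (e / 2) ((R0 - l t) / 2)"
    have d: "0 < d" "d < e" "2 * d \<le> R0 - l t" using e t by (auto simp: d_def min_def)
    have "dist ((R0 - d) *\<^sub>R ?e, t) (R0 *\<^sub>R ?e, t) = \<bar>d\<bar>"
      by (simp add: dist_Pair_Pair dist_norm flip: scaleR_diff_left)
    moreover have "((R0 - d) *\<^sub>R ?e, t) \<in> A" using d t lt by (auto simp: region_def)
    ultimately show "\<exists>y\<in>A. dist y (R0 *\<^sub>R ?e, t) < e" using d by force
  qed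
  then have "(R0 *\<^sub>R ?e, t) \<in> outer_boundary l R0 t0 T \<and> norm (R0 *\<^sub>R ?e) = R0"
    using t basic(4) by (auto simp: outer_boundary_def)
  then show ?thesis by blast
qed

lemma screening_bound:
  assumes w: "C21_on A w" "continuous_on (A \<union> PA) w" "\<And>p. p \<in> A \<Longrightarrow> parabolic_op \<nu> b w p = 0"
    and bd: "(\<forall>(x, t)\<in>PA. \<bar>w (x, t)\<bar> \<le> A0 * (norm x / R0) powr k) \<or>
          (\<forall>(x, t)\<in>initial_slice l R0 t0 T. \<bar>w (x, t)\<bar> \<le> A0 * (norm x / R0) powr k) \<and>
          (\<forall>p\<in>inner_boundary l R0 t0 T. w p = 0) \<and>
          (\<forall>p\<in>outer_boundary l R0 t0 T. \<bar>w p\<bar> \<le> A0)"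
    and p: "(x, t) \<in> A"
  shows "\<bar>w (x, t)\<bar> \<le> A0 * (norm x / R0) powr k"
proof -
  obtain y s where ys: "(y, s) \<in> outer_boundary l R0 t0 T" "norm y = R0"
    using outer_boundary_nonempty by blast
  have "\<bar>w (y, s)\<bar> \<le> A0"
    using bd
  proof
    assume *: "\<forall>(x, t)\<in>PA. \<bar>w (x, t)\<bar> \<le> A0 * (norm x / R0) powr k"
    have "(y, s) \<in> PA" using ys by (simp add: parabolic_boundary_def)
    from bspec[OF * this] show ?thesis using ys basic(4) by simp
  qed (use ys in auto)
  then have A0: "A0 \<ge> 0" by linarith
  have bd': "\<bar>w (x, t)\<bar> \<le> A0 * (norm x / R0) powr k" if "(x, t) \<in> PA" for x t
    using bd
  proof
    assume *: "(\<forall>(x, t)\<in>initial_slice l R0 t0 T. \<bar>w (x, t)\<bar> \<le> A0 * (norm x / R0) powr k) \<and>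
          (\<forall>p\<in>inner_boundary l R0 t0 T. w p = 0) \<and>
          (\<forall>p\<in>outer_boundary l R0 t0 T. \<bar>w p\<bar> \<le> A0)"
    \<comment> \<open>On the outer sphere the barrier is A0 itself; on the inner one it is
      nonnegative and w = 0. So the second form of data is a case of the first.\<close>
    have "norm x / R0 = 1" if "(x, t) \<in> outer_boundary l R0 t0 T"
      using that basic(4) by (auto simp: outer_boundary_def)
    with * that A0 show ?thesis by (auto simp: parabolic_boundary_def)
  qed (use that in auto)
  define C where "C = A0 / R0 powr k"
  have C: "C \<ge> 0" "A0 * (norm x / R0) powr k = C * norm x powr k" for x :: "real^3"
    using A0 basic(4) by (auto simp: C_def powr_divide)
  have reg: "regular_at w x t" if "(x, t) \<in> A" for x t
    using that by (rule C21_on_imp_regular_at[OF open_A w(1)])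
  have "w (x, t) \<le> C * norm x powr k"
  proof (rule power_comparison[OF reg w(2) _ C(1) _ p])
    show "w (y, s) \<le> C * norm y powr k" if "(y, s) \<in> PA" for y s
      using bd'[OF that] by (simp add: C(2))
  qed (simp_all add: w(3))
  moreover have "- w (x, t) \<le> C * norm x powr k"
  proof (rule power_comparison[OF regular_at_uminus[OF reg] _ _ C(1) _ p])
    show "- w (y, s) \<le> C * norm y powr k" if "(y, s) \<in> PA" for y s
      using bd'[OF that] by (simp add: C(2))
    show "continuous_on (A \<union> PA) (\<lambda>p. - w p)" by (intro continuous_intros w(2))
    show "parabolic_op \<nu> b (\<lambda>p. - w p) p \<le> 0" if "p \<in> A" for p
      using that by (cases p) (simp add: op_uminus reg w(3))
  qed
  ultimately show ?thesis by (simp add: C abs_le_iff)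
qed

text \<open>\<open>drift_inner\<close> leaves k \<nu> in the bracket of \<open>op_log\<close>. Half
  of it absorbs the logarithmic correction, and the other half is the factor \<nu> k / 2 of the
  bound.\<close>

lemma op_log_ge:
  assumes p: "(x, t) \<in> A" and x: "norm x < log_radius \<gamma> k" and \<gamma>: "\<gamma> > 0"
  shows "parabolic_op \<nu> b (log_barrier \<gamma>) (x, t)
    \<ge> \<nu> * \<gamma> * k / 2 * (1 / ((norm x)\<^sup>2 * \<bar>ln (norm x)\<bar> powr (\<gamma> + 1)))"
proof -
  have n: "norm x > 0" by (rule norm_pos[OF p])
  have x1: "norm x < 1" using x log_radius_bounds(3)[of \<gamma> k] by linarith
  have "ln (norm x) < ln (log_radius \<gamma> k)" using n x log_radius_bounds(1)[of \<gamma> k] by simp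
  then have l: "1 < \<bar>ln (norm x)\<bar>" "2 * (\<gamma> + 1) / k < \<bar>ln (norm x)\<bar>"
    using ln_less_zero[OF n x1] by (auto simp: log_radius_def)
  let ?l = "\<bar>ln (norm x)\<bar>"
  have "(\<gamma> + 1) / ?l \<le> k / 2" using l k by (simp add: field_simps)
  then have q: "\<nu> * (\<gamma> + 1) / ?l \<le> \<nu> * k / 2"
    using mult_left_mono[of "(\<gamma> + 1) / ?l" "k / 2" \<nu>] basic(1) by simp
  have "\<nu> * k / 2 \<le> X - \<nu> - q" if "q \<le> \<nu> * k / 2" "(k + 1) * \<nu> \<le> X" for q X
    using that by (simp add: algebra_simps)
  from this[OF q drift_inner[OF p]]
  have "\<gamma> / (norm x)\<^sup>2 * ?l powr (- \<gamma> - 1) * (\<nu> * k / 2) \<le>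
      \<gamma> / (norm x)\<^sup>2 * ?l powr (- \<gamma> - 1) * (x \<bullet> b (x, t) - \<nu> - \<nu> * (\<gamma> + 1) / ?l)"
    using \<gamma> by (intro mult_left_mono) auto
  moreover have "?l powr (- \<gamma> - 1) = 1 / ?l powr (\<gamma> + 1)"
    by (rule powr_minus_one_eq)
  ultimately show ?thesis
    unfolding op_log[OF p x1 \<gamma>] by (simp add: mult_ac)
qed

lemma log_comparison:
  assumes \<gamma>: "\<gamma> > 0" and \<Lambda>: "\<Lambda> \<ge> 0"
    and B: "B = A \<inter> {(x, t). norm x < log_radius \<gamma> k}"
    and PB: "PB = parabolic_boundary l (min R0 (log_radius \<gamma> k)) t0 T"
    and w: "C21_on B w" "continuous_on (B \<union> PB) w"
    and L: "\<And>x t. (x, t) \<in> B \<Longrightarrow>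
      parabolic_op \<nu> b w (x, t) \<le> \<Lambda> / (norm x)\<^sup>2 * \<bar>ln (norm x)\<bar> powr (- \<gamma> - 1)"
    and bd: "\<And>p. p \<in> PB \<Longrightarrow> w p \<le> 0"
    and p: "(x, t) \<in> B"
  shows "w (x, t) \<le> 2 * \<Lambda> / (\<nu> * \<gamma> * k) * \<bar>ln (norm x)\<bar> powr (- \<gamma>)"
proof -
  let ?R = "min R0 (log_radius \<gamma> k)"
  \<comment> \<open>The constant for which C times the lower bound of \<open>op_log_ge\<close>
    equals the source.\<close>
  define C where "C = 2 * \<Lambda> / (\<nu> * \<gamma> * k)"
  have C: "C \<ge> 0" "C * (\<nu> * \<gamma> * k / 2) = \<Lambda>" using \<gamma> \<Lambda> basic(1) k by (auto simp: C_def)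
  \<comment> \<open>The truncated set is again a region, with outer radius \<open>?R\<close>, so the
    maximum principle applies to it as it stands.\<close>
  have BR: "B = region l ?R t0 T" by (auto simp: B region_def)
  let ?v = "log_barrier \<gamma>"
  let ?w = "\<lambda>p. 1 * w p + (- C) * ?v p"
  have t: "t0 \<le> t" "t < T" using p by (auto simp: B region_def)
  have BA: "q \<in> A" if "q \<in> B" for q using that by (auto simp: B)
  have x1: "norm y < 1" "norm y < log_radius \<gamma> k" if "(y, s) \<in> B" for y s
    using that log_radius_bounds(3)[of \<gamma> k] by (auto simp: B)
  have reg: "regular_at w y s" if "(y, s) \<in> B" for y s
    using that open_region[OF basic(5)] w(1) by (intro C21_on_imp_regular_at[of B]) (auto simp: BR)
  have "?w (x, t) \<le> 0"
  proof (rule max_principle[OF basic(5) less_imp_le[OF basic(1)] order_refl t(2) BR PB, where b = b])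
    show "regular_at ?w y s" if "(y, s) \<in> B" for y s
      using that \<gamma> by (intro regular_at_linear reg regular_at_log BA x1(1)[of y s])
    \<comment> \<open>The closure stays within |x| \<le> exp (-1), where the barrier is continuous,
      the origin included.\<close>
    have "B \<union> PB \<subseteq> closure (region l ?R t0 T)"
      using closure_subset boundary_subset_closure unfolding BR PB by blast
    then have "B \<union> PB \<subseteq> {p. norm (fst p) \<le> exp (-1)}"
      using closure_region(1)[OF basic(5), of _ _ ?R] log_radius_bounds(2)[of \<gamma> k] by fastforce
    then show "continuous_on (B \<union> PB) ?w"
      using \<gamma> by (intro continuous_intros w continuous_on_log_barrier)
    show "parabolic_op \<nu> b ?w (y, s) \<le> 0" if q: "(y, s) \<in> B" for y s
    proof -
      have "\<Lambda> / (norm y)\<^sup>2 * \<bar>ln (norm y)\<bar> powr (- \<gamma> - 1) =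
          C * (\<nu> * \<gamma> * k / 2 * (1 / ((norm y)\<^sup>2 * \<bar>ln (norm y)\<bar> powr (\<gamma> + 1))))"
        unfolding powr_minus_one_eq C(2)[symmetric] by simp
      also have "\<dots> \<le> C * parabolic_op \<nu> b ?v (y, s)"
        using C(1) by (intro mult_left_mono op_log_ge BA q x1 \<gamma>) (use q x1 in auto)
      finally show ?thesis
        unfolding parabolic_op_linear[OF reg[OF q] regular_at_log[OF BA[OF q] x1(1)[OF q] \<gamma>]]
        using L[OF q] by simp
    qed
    show "?w (y, s) \<le> 0" if "(y, s) \<in> PB" for y s
      using bd[OF that] mult_nonneg_nonneg[OF C(1), of "\<bar>ln (norm y)\<bar> powr (- \<gamma>)"] by simp
    show "?w (y, t0) \<le> 0" if "(y, t0) \<in> B" for y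
      using that by (simp add: B region_def)
  qed (use p t in simp_all)
  then show ?thesis by (simp add: C_def)
qed

end

section \<open>The standard Gaussian measure in space\<close>

text \<open>Fubini, since \<open>lborel\<close> is the image of the product of the coordinate
  measures.\<close>

lemma has_bochner_integral_lborel_prod:
  fixes f :: "'a :: euclidean_space \<Rightarrow> real \<Rightarrow> real"
  assumes f: "\<And>b. b \<in> Basis \<Longrightarrow> integrable lborel (f b)"
  shows "has_bochner_integral lborel (\<lambda>x :: 'a. \<Prod>b\<in>Basis. f b (x \<bullet> b)) (\<Prod>b\<in>Basis. \<integral>x. f b x \<partial>lborel)"
proof -
  interpret product_sigma_finite "\<lambda>_ :: 'a. lborel :: real measure" ..
  have fm[measurable]: "f b \<in> borel_measurable borel" if "b \<in> Basis" for b
    using borel_measurable_integrable[OF f[OF that]] by simp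
  have [measurable]: "(\<lambda>g. \<Sum>b\<in>Basis. g b *\<^sub>R b) \<in> (\<Pi>\<^sub>M b\<in>Basis. lborel) \<rightarrow>\<^sub>M (borel :: 'a measure)"
    by measurable
  have m: "(\<lambda>x :: 'a. \<Prod>b\<in>Basis. f b (x \<bullet> b)) \<in> borel_measurable borel"
    by (intro borel_measurable_prod measurable_compose[OF _ fm]) auto
  have eq: "(\<Prod>b\<in>Basis. f b ((\<Sum>b\<in>Basis. g b *\<^sub>R b) \<bullet> b)) = (\<Prod>b\<in>Basis. f b (g b))" for g
    by (intro prod.cong) auto
  have "integrable (\<Pi>\<^sub>M b\<in>Basis. lborel) (\<lambda>g. \<Prod>b\<in>Basis. f b (g b))"
    by (intro product_integrable_prod f) auto
  moreover have "(\<integral>g. (\<Prod>b\<in>Basis. f b (g b)) \<partial>(\<Pi>\<^sub>M b\<in>Basis. lborel)) = (\<Prod>b\<in>Basis. \<integral>x. f b x \<partial>lborel)"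
    by (intro product_integral_prod f) auto
  ultimately show ?thesis
    using m by (subst lborel_eq) (simp add: has_bochner_integral_iff integrable_distr_eq integral_distr eq)
qed

lemma prod_Basis_vec: "(\<Prod>b\<in>(Basis :: (real^'n) set). g b) = (\<Prod>i\<in>UNIV. g (axis i 1))"
proof -
  have B: "Basis = range (\<lambda>i. axis i 1 :: real^'n)" by (auto simp: Basis_vec_def)
  have inj: "inj (\<lambda>i. axis i 1 :: real^'n)" by (auto intro!: injI simp: axis_eq_axis)
  show ?thesis unfolding B using prod.reindex[OF inj, of g] by (simp add: o_def)
qed

lemma has_bochner_integral_lborel_vec_prod:
  fixes f :: "'n :: finite \<Rightarrow> real \<Rightarrow> real"
  assumes f: "\<And>i. integrable lborel (f i)"
  shows "has_bochner_integral lborel (\<lambda>x :: real^'n. \<Prod>i\<in>UNIV. f i (x $ i)) (\<Prod>i\<in>UNIV. \<integral>x. f i x \<partial>lborel)"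
proof -
  show ?thesis
    using has_bochner_integral_lborel_prod[of "\<lambda>b :: real^'n. f (axis_index b)"] f
    by (simp add: prod_Basis_vec inner_axis)
qed

text \<open>Here \<sigma> is the standard deviation. The density is written as in
  \<open>standard_brownian_motion\<close>, so that the law of an increment can be read off.\<close>

definition gaussian :: "real \<Rightarrow> (real^3) measure" where
  "gaussian \<sigma> = density lborel (\<lambda>y. ennreal (\<Prod>i\<in>UNIV. normal_density 0 \<sigma> (y $ i)))"

lemma sets_gaussian[simp, measurable_cong]: "sets (gaussian \<sigma>) = sets borel"
  and space_gaussian[simp]: "space (gaussian \<sigma>) = UNIV"
  by (simp_all add: gaussian_def)

lemma measurable_gaussian_density[measurable]:
  "(\<lambda>y :: real^3. \<Prod>i\<in>UNIV. normal_density 0 \<sigma> (y $ i)) \<in> borel_measurable borel"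
  by (intro borel_measurable_prod measurable_compose[OF _ borel_measurable_normal_density]
      borel_measurable_continuous_onI continuous_intros)

definition std_moment :: "nat \<Rightarrow> real" where
  "std_moment n = (\<integral>x. std_normal_density x * x ^ n \<partial>lborel)"

lemma std_moment: "std_moment 0 = 1" "std_moment (Suc 0) = 0" "std_moment 2 = 1"
  using integral_std_normal_moment_even[of 1] integral_std_normal_moment_odd[of 0]
    integral_std_normal_moment_even[of 0]
  by (simp_all add: std_moment_def fact_numeral)

text \<open>The coordinates are independent, so a mixed moment factors into moments on the line.
  Total mass, mean, covariance and the sixth moment of the norm all come from special
  exponents.\<close>

lemma gaussian_moment:
  "has_bochner_integral (gaussian 1) (\<lambda>y. \<Prod>i\<in>UNIV. y $ i ^ p i) (\<Prod>i\<in>UNIV. std_moment (p i))"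
proof -
  have "has_bochner_integral lborel (\<lambda>y :: real^3. \<Prod>i\<in>UNIV. std_normal_density (y $ i) * y $ i ^ p i)
     (\<Prod>i\<in>UNIV. std_moment (p i))"
    unfolding std_moment_def by (rule has_bochner_integral_lborel_vec_prod) (rule integrable_std_normal_moment)
  then show ?thesis
    unfolding gaussian_def
    by (intro has_bochner_integral_density)
      (auto simp: prod.distrib intro!: prod_nonneg borel_measurable_continuous_onI continuous_intros)
qed

interpretation gaussian: prob_space "gaussian 1"
proof
  show "emeasure (gaussian 1) (space (gaussian 1)) = 1"
    using gaussian_moment[of "\<lambda>_. 0"]
    by (cases "emeasure (gaussian 1) UNIV") (auto simp: has_bochner_integral_iff std_moment measure_def)
qed

lemma prod_coordinate_power: "(\<Prod>j\<in>UNIV. (y :: real^3) $ j ^ (if j = i then n else 0)) = y $ i ^ n"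
proof -
  have "y $ j ^ (if j = i then n else 0) = (if j = i then y $ j ^ n else 1)" for j by simp
  then show ?thesis by simp
qed

lemma gaussian_mean: "has_bochner_integral (gaussian 1) (\<lambda>y. y $ i) 0"
proof -
  have "(\<Prod>j\<in>UNIV. std_moment (if j = i then 1 else 0)) = 0"
    by (rule prod_zero) (auto simp: std_moment intro!: bexI[of _ i])
  then show ?thesis
    using gaussian_moment[of "\<lambda>j. if j = i then 1 else 0"]
    by (simp only: prod_coordinate_power power_one_right)
qed

lemma gaussian_covariance:
  "has_bochner_integral (gaussian 1) (\<lambda>y. y $ i * y $ j) (if i = j then 1 else 0)"
proof (cases "i = j")
  case True
  have "std_moment (if m = i then 2 else 0) = 1" for m by (simp add: std_moment)
  then show ?thesis
    using gaussian_moment[of "\<lambda>j. if j = i then 2 else 0"] True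
    by (simp add: prod_coordinate_power power2_eq_square)
next
  case False
  have "(\<Prod>m\<in>UNIV. std_moment ((if m = i then 1 else 0) + (if m = j then 1 else 0))) = 0"
    using False by (intro prod_zero) (auto simp: std_moment intro!: bexI[of _ i])
  then show ?thesis
    using gaussian_moment[of "\<lambda>m. (if m = i then 1 else 0) + (if m = j then 1 else 0)"] False
    by (simp only: power_add prod.distrib prod_coordinate_power power_one_right if_False)
qed

text \<open>The Taylor remainder asks for the sixth moment: the increment of the argument is
  quadratic in the noise, and it is cubed. The sixth power of the norm is the cube of a sum of
  squares, hence a sum of monomials.\<close>

lemma gaussian_integrable_norm6: "integrable (gaussian 1) (\<lambda>y. norm y ^ 6)"
proof -
  have "integrable (gaussian 1) (\<lambda>y. (y $ i)\<^sup>2 * (y $ j)\<^sup>2 * (y $ k)\<^sup>2)" for i j k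
  proof -
    have "(\<lambda>y :: real^3. (y $ i)\<^sup>2 * (y $ j)\<^sup>2 * (y $ k)\<^sup>2) = (\<lambda>y. \<Prod>m\<in>UNIV. y $ m ^
        ((if m = i then 2 else 0) + (if m = j then 2 else 0) + (if m = k then 2 else 0)))"
      by (simp add: power_add prod.distrib prod_coordinate_power)
    then show ?thesis using gaussian_moment by (auto simp: has_bochner_integral_iff)
  qed
  then have "integrable (gaussian 1) (\<lambda>y. \<Sum>i\<in>UNIV. \<Sum>j\<in>UNIV. \<Sum>k\<in>UNIV. (y $ i)\<^sup>2 * (y $ j)\<^sup>2 * (y $ k)\<^sup>2)"
    by (intro Bochner_Integration.integrable_sum)
  also have "(\<lambda>y :: real^3. \<Sum>i\<in>UNIV. \<Sum>j\<in>UNIV. \<Sum>k\<in>UNIV. (y $ i)\<^sup>2 * (y $ j)\<^sup>2 * (y $ k)\<^sup>2) = (\<lambda>y. norm y ^ 6)"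
  proof
    fix y :: "real^3"
    have "norm y ^ 6 = ((norm y)\<^sup>2) ^ 3" by (simp flip: power_mult)
    also have "\<dots> = (\<Sum>i\<in>UNIV. (y $ i)\<^sup>2) ^ 3" by (simp add: norm_vec_def L2_set_def sum_nonneg)
    finally show "(\<Sum>i\<in>UNIV. \<Sum>j\<in>UNIV. \<Sum>k\<in>UNIV. (y $ i)\<^sup>2 * (y $ j)\<^sup>2 * (y $ k)\<^sup>2) = norm y ^ 6"
      by (simp add: power3_eq_cube flip: sum_distrib_left sum_distrib_right)
  qed
  finally show ?thesis .
qed

text \<open>Refers all increments to one fixed measure, so that the constant of a time step does not
  depend on its length.\<close>

lemma gaussian_scale:
  assumes "\<sigma> > 0"
  shows "gaussian \<sigma> = distr (gaussian 1) borel (\<lambda>y. \<sigma> *\<^sub>R y)"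
proof -
  have nd: "normal_density 0 \<sigma> (\<sigma> * x) = normal_density 0 1 x / \<sigma>" for x
    using assms by (simp add: normal_density_def real_sqrt_mult power_mult_distrib field_simps)
  have "lborel = density (distr lborel borel (\<lambda>x :: real^3. 0 + \<sigma> *\<^sub>R x)) (\<lambda>_. \<bar>\<sigma>\<bar> ^ DIM(real^3))"
    using assms by (intro lborel_affine) auto
  then have lb: "lborel = density (distr lborel borel (\<lambda>x :: real^3. \<sigma> *\<^sub>R x)) (\<lambda>_. ennreal (\<sigma> ^ 3))"
    using assms by simp
  show ?thesis
  proof (rule measure_eqI)
    fix S assume "S \<in> sets (gaussian \<sigma>)"
    then have S[measurable]: "S \<in> sets borel" by simp
    have "emeasure (gaussian \<sigma>) S =
      (\<integral>\<^sup>+y. ennreal (\<Prod>i\<in>UNIV. normal_density 0 \<sigma> (y $ i)) * indicator S y \<partial>lborel)"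
      by (simp add: gaussian_def emeasure_density)
    also have "\<dots> = (\<integral>\<^sup>+y. ennreal (\<sigma> ^ 3) * (ennreal (\<Prod>i\<in>UNIV. normal_density 0 \<sigma> (\<sigma> * y $ i)) * indicator S (\<sigma> *\<^sub>R y)) \<partial>lborel)"
      by (subst lb) (simp add: nn_integral_density nn_integral_distr)
    also have "\<dots> = (\<integral>\<^sup>+y. ennreal (\<Prod>i\<in>UNIV. normal_density 0 1 (y $ i)) * indicator S (\<sigma> *\<^sub>R y) \<partial>lborel)"
    proof (intro nn_integral_cong)
      fix y :: "real^3"
      \<comment> \<open>The Jacobian \<sigma>^3 cancels the factor 1 / \<sigma> of each of the three
        densities.\<close>
      have "\<sigma> ^ 3 * (\<Prod>i\<in>UNIV. normal_density 0 \<sigma> (\<sigma> * y $ i)) = (\<Prod>i\<in>UNIV. normal_density 0 1 (y $ i))"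
        using assms by (simp add: nd prod_dividef)
      then show "ennreal (\<sigma> ^ 3) * (ennreal (\<Prod>i\<in>UNIV. normal_density 0 \<sigma> (\<sigma> * y $ i)) * indicator S (\<sigma> *\<^sub>R y))
          = ennreal (\<Prod>i\<in>UNIV. normal_density 0 1 (y $ i)) * indicator S (\<sigma> *\<^sub>R y)"
        using assms by (simp add: mult.assoc[symmetric] flip: ennreal_mult')
    qed
    also have "\<dots> = emeasure (distr (gaussian 1) borel (\<lambda>y. \<sigma> *\<^sub>R y)) S"
    proof -
      have "(\<lambda>y :: real^3. \<sigma> *\<^sub>R y) -` S \<in> sets borel"
        by (rule measurable_sets_borel[OF _ S]) simp
      then show ?thesis
        by (subst emeasure_distr) (auto simp: gaussian_def emeasure_density intro!: nn_integral_cong split: split_indicator)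
    qed
    finally show "emeasure (gaussian \<sigma>) S = emeasure (distr (gaussian 1) borel (\<lambda>y. \<sigma> *\<^sub>R y)) S" .
  qed simp
qed

section \<open>The regularised incomplete Gamma function\<close>

text \<open>The factor 1 / Gamma a normalises the limit at infinity to 1. For y < 0 the interval is
  empty and the value is 0, so monotonicity and the bounds hold on the whole line.\<close>

definition lower_gamma :: "real \<Rightarrow> real \<Rightarrow> real" where
  "lower_gamma a y = integral {0..y} (\<lambda>t. t powr (a - 1) / exp t) / Gamma a"

context
  fixes a :: real
  assumes a: "0 < a"
begin

lemma lower_gamma_integrable: "(\<lambda>t. t powr (a - 1) / exp t) integrable_on {0..y}"
  by (rule integrable_on_subinterval[OF has_integral_integrable[OF Gamma_integral_real[OF a]]]) auto

lemma lower_gamma_nonneg: "0 \<le> lower_gamma a y"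
  using a by (auto simp: lower_gamma_def intro!: divide_nonneg_pos integral_nonneg lower_gamma_integrable)

lemma lower_gamma_le_1: "lower_gamma a y \<le> 1"
proof -
  have "integral {0..y} (\<lambda>t. t powr (a - 1) / exp t) \<le> integral {0..} (\<lambda>t. t powr (a - 1) / exp t)"
    using Gamma_integral_real[OF a] by (intro integral_subset_le lower_gamma_integrable) auto
  also have "\<dots> = Gamma a" using Gamma_integral_real[OF a] by (rule integral_unique)
  finally show ?thesis using a by (simp add: lower_gamma_def)
qed

lemma lower_gamma_mono: "y \<le> z \<Longrightarrow> lower_gamma a y \<le> lower_gamma a z"
proof -
  assume "y \<le> z"
  then have "integral {0..y} (\<lambda>t. t powr (a - 1) / exp t) \<le> integral {0..z} (\<lambda>t. t powr (a - 1) / exp t)"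
    by (intro integral_subset_le[OF _ lower_gamma_integrable lower_gamma_integrable]) auto
  then show ?thesis unfolding lower_gamma_def using a by (intro divide_right_mono) auto
qed

text \<open>Dropping the factor exp (- t) \<le> 1 leaves y^a / a, and a Gamma a = Gamma (a + 1):
  this is the constant of the hitting time bound.\<close>

lemma lower_gamma_le_powr:
  assumes "0 \<le> y"
  shows "lower_gamma a y \<le> 1 / Gamma (a + 1) * y powr a"
proof -
  have p: "((\<lambda>t. t powr (a - 1)) has_integral (y powr (a - 1 + 1) / (a - 1 + 1))) {0..y}"
    using a assms by (intro has_integral_powr_from_0) auto
  have "integral {0..y} (\<lambda>t. t powr (a - 1) / exp t) \<le> integral {0..y} (\<lambda>t. t powr (a - 1))"
  proof (rule integral_le[OF lower_gamma_integrable has_integral_integrable[OF p]])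
    fix t :: real assume "t \<in> {0..y}"
    then have "t powr (a - 1) * 1 \<le> t powr (a - 1) * exp t" by (intro mult_left_mono) auto
    then show "t powr (a - 1) / exp t \<le> t powr (a - 1)" by (simp add: divide_le_eq)
  qed
  also have "\<dots> = y powr a / a" using integral_unique[OF p] by simp
  finally have "lower_gamma a y \<le> y powr a / a / Gamma a"
    unfolding lower_gamma_def using a by (intro divide_right_mono) auto
  moreover have "Gamma (a + 1) = a * Gamma a"
    by (rule Gamma_plus1) (use a nonpos_Ints_nonpos[of a] in linarith)
  ultimately show ?thesis by simp
qed

text \<open>Removes the factor that the shift \<theta> of the final time leaves beside the
  probability.\<close>

lemma lower_gamma_tendsto: "(\<lambda>n. lower_gamma a (real n)) \<longlonglongrightarrow> 1"
proof -
  let ?g = "\<lambda>t. t powr (a - 1) / exp t :: real"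
  have G: "Gamma a \<noteq> 0" using Gamma_real_pos[OF a] by (metis less_irrefl)
  have eq: "integral {0..} (\<lambda>t. if t \<in> {0..real n} then ?g t else 0) = integral {0..real n} ?g" for n
    unfolding integral_restrict_Int by (rule arg_cong[of _ _ "\<lambda>S. integral S ?g"]) auto
  have "(\<lambda>n. integral {0..} (\<lambda>t. if t \<in> {0..real n} then ?g t else 0)) \<longlonglongrightarrow> integral {0..} ?g"
  proof (rule conjunct2[OF monotone_convergence_increasing])
    show "(\<lambda>t. if t \<in> {0..real n} then ?g t else 0) integrable_on {0..}" for n
      unfolding integrable_restrict_Int
      using lower_gamma_integrable[of "real n"] by (simp add: Int_absorb2)
    show "(\<lambda>n. if t \<in> {0..real n} then ?g t else 0) \<longlonglongrightarrow> ?g t" if "t \<in> {0..}" for t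
    proof (rule tendsto_eventually)
      show "\<forall>\<^sub>F n in sequentially. (if t \<in> {0..real n} then ?g t else 0) = ?g t"
        by (rule eventually_mono[OF eventually_ge_at_top[of "nat \<lceil>t\<rceil>"]]) (use that in \<open>auto simp: nat_le_iff ceiling_le_iff\<close>)
    qed
    have "\<bar>integral {0..real n} ?g\<bar> \<le> Gamma a" for n
      using lower_gamma_le_1[of "real n"] lower_gamma_nonneg[of "real n"] Gamma_real_pos[OF a]
      by (auto simp: lower_gamma_def divide_le_eq zero_le_divide_iff)
    then show "bounded (range (\<lambda>n. integral {0..} (\<lambda>t. if t \<in> {0..real n} then ?g t else 0)))"
      unfolding eq by (auto simp: bounded_iff)
  qed auto
  then have "(\<lambda>n. integral {0..real n} ?g / Gamma a) \<longlonglongrightarrow> Gamma a / Gamma a"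
    using a unfolding eq integral_unique[OF Gamma_integral_real[OF a]]
    by (intro tendsto_divide tendsto_const G)
  then show ?thesis using G by (simp add: lower_gamma_def del: Gamma_eq_zero_iff)
qed

lemma lower_gamma_deriv:
  assumes "0 < y"
  shows "(lower_gamma a has_real_derivative y powr (a - 1) / exp y / Gamma a) (at y)"
proof -
  have "((\<lambda>u. integral {0..u} (\<lambda>t. t powr (a - 1) / exp t)) has_vector_derivative y powr (a - 1) / exp y)
      (at y within {0..y + 1} - {})"
  proof (rule integral_has_vector_derivative_continuous_at[OF lower_gamma_integrable])
    show "continuous (at y within {0..y + 1} - {}) (\<lambda>t. t powr (a - 1) / exp t)"
      using assms by (intro continuous_intros) auto
  qed (use assms in auto)
  moreover have "at y within {0..y + 1} - {} = at y"
    using assms by (intro at_within_interior) (auto simp: interior_atLeastAtMost_real)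
  ultimately have "((\<lambda>u. integral {0..u} (\<lambda>t. t powr (a - 1) / exp t)) has_real_derivative y powr (a - 1) / exp y) (at y)"
    by (simp add: has_real_derivative_iff_has_vector_derivative)
  then show ?thesis unfolding lower_gamma_def[abs_def] by (rule DERIV_cdivide)
qed

end

text \<open>For a \<le> 1 the power is decreasing; for 1 < a \<le> 2 it is at most exp y, because y
  \<le> exp y and the exponent is at most 1. The application has a = k / 2 < 3 / 2.\<close>

lemma powr_div_exp_bounded:
  assumes c: "0 < c" and a: "a \<le> 2" and y: "c \<le> (y :: real)"
  shows "y powr (a - 1) / exp y \<le> c powr (a - 1) + 1"
proof -
  have "y powr (a - 1) \<le> (c powr (a - 1) + 1) * exp y"
  proof (cases "a \<le> 1")
    case True
    then have "y powr (a - 1) \<le> c powr (a - 1)" using c y by (intro powr_mono2') auto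
    also have "\<dots> \<le> (c powr (a - 1) + 1) * 1" by simp
    also have "\<dots> \<le> (c powr (a - 1) + 1) * exp y" using c y by (intro mult_left_mono) auto
    finally show ?thesis .
  next
    case False
    have "y powr (a - 1) \<le> exp y powr (a - 1)"
    proof -
      have "y \<le> exp y" using exp_ge_add_one_self[of y] by linarith
      then show ?thesis using c y False by (intro powr_mono2) auto
    qed
    also have "\<dots> \<le> exp y powr 1" using False a c y by (intro powr_mono) auto
    also have "\<dots> = 1 * exp y" by simp
    also have "\<dots> \<le> (c powr (a - 1) + 1) * exp y" by (intro mult_right_mono) auto
    finally show ?thesis .
  qed
  then show ?thesis by (simp add: divide_le_eq)
qed

text \<open>Clamping at \<open>c\<close> removes the singularity at \<open>0\<close>. Since arguments below \<open>c\<close> are at distance at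
  least \<open>c\<close> from \<open>y\<close>, the clamped function still obeys a one-sided Taylor estimate.\<close>

lemma taylor_clamped:
  fixes f f1 f2 f3 :: "real \<Rightarrow> real"
  assumes c: "0 < c" and K: "0 \<le> K"
    and f: "\<And>y. 0 \<le> f y" "\<And>y. f y \<le> 1"
    and d: "\<And>y. c \<le> y \<Longrightarrow> (f has_real_derivative f1 y) (at y)"
      "\<And>y. c \<le> y \<Longrightarrow> (f1 has_real_derivative f2 y) (at y)"
      "\<And>y. c \<le> y \<Longrightarrow> (f2 has_real_derivative f3 y) (at y)"
    and b: "\<And>y. c \<le> y \<Longrightarrow> \<bar>f1 y\<bar> \<le> K" "\<And>y. c \<le> y \<Longrightarrow> \<bar>f2 y\<bar> \<le> K" "\<And>y. c \<le> y \<Longrightarrow> \<bar>f3 y\<bar> \<le> K"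
    and y: "2 * c \<le> y"
  shows "f (max (y + \<eta>) c) \<le> f y + f1 y * \<eta> + f2 y / 2 * \<eta>\<^sup>2 + (K + 1 / c ^ 3 + K / c\<^sup>2 + K / c) * \<bar>\<eta>\<bar> ^ 3"
proof (cases "c \<le> y + \<eta>")
  case True
  have "f (y + \<eta>) \<le> f y + f1 y * \<eta> + f2 y / 2 * \<eta>\<^sup>2 + K * \<bar>\<eta>\<bar> ^ 3"
  proof (cases "\<eta> = 0")
    case False
    define diff where "diff = (\<lambda>m :: nat. if m = 0 then f else if m = 1 then f1 else if m = 2 then f2 else f3)"
    have sum3: "(\<Sum>m<3. g m) = g 0 + g 1 + g 2" for g :: "nat \<Rightarrow> real"
      by (simp add: numeral_3_eq_3 numeral_2_eq_2)
    have "\<exists>t. (if y + \<eta> < y then y + \<eta> < t \<and> t < y else y < t \<and> t < y + \<eta>) \<and>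
      f (y + \<eta>) = (\<Sum>m<3. (diff m y / fact m) * (y + \<eta> - y)^m) + (diff 3 t / fact 3) * (y + \<eta> - y)^3"
    proof (rule Taylor[where a = c and b = "max y (y + \<eta>)"])
      show "\<forall>m t. m < 3 \<and> c \<le> t \<and> t \<le> max y (y + \<eta>) \<longrightarrow> DERIV (diff m) t :> diff (Suc m) t"
      proof (intro allI impI)
        fix m :: nat and t assume "m < 3 \<and> c \<le> t \<and> t \<le> max y (y + \<eta>)"
        then have "m = 0 \<or> m = 1 \<or> m = 2" "c \<le> t" by auto
        then show "DERIV (diff m) t :> diff (Suc m) t" using d[of t] by (auto simp: diff_def)
      qed
    qed (use True False y c in \<open>auto simp: diff_def\<close>)
    then obtain t where t: "if \<eta> < 0 then y + \<eta> < t \<and> t < y else y < t \<and> t < y + \<eta>"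
        "f (y + \<eta>) = f y + f1 y * \<eta> + f2 y / 2 * \<eta>\<^sup>2 + f3 t / 6 * \<eta> ^ 3"
      by (auto simp: diff_def sum3 fact_numeral)
    have "c \<le> t" using t(1) True y c by (auto split: if_splits)
    have "f3 t / 6 * \<eta> ^ 3 \<le> \<bar>f3 t\<bar> / 6 * \<bar>\<eta>\<bar> ^ 3"
      using abs_ge_self[of "f3 t / 6 * \<eta> ^ 3"] by (simp add: abs_mult power_abs)
    also have "\<dots> \<le> K * \<bar>\<eta>\<bar> ^ 3"
      using b(3)[OF \<open>c \<le> t\<close>] K by (intro mult_right_mono) auto
    finally show ?thesis using t(2) by simp
  qed (use K in auto)
  also have "\<dots> \<le> f y + f1 y * \<eta> + f2 y / 2 * \<eta>\<^sup>2 + (K + 1 / c ^ 3 + K / c\<^sup>2 + K / c) * \<bar>\<eta>\<bar> ^ 3"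
    using c K by (intro add_left_mono mult_right_mono) auto
  finally show ?thesis using True by (simp add: max_def)
next
  case False
  define e where "e = \<bar>\<eta>\<bar>"
  have e: "c \<le> e" "0 \<le> e" using False y c by (auto simp: e_def)
  have yc: "c \<le> y" using y c by simp
  \<comment> \<open>The value f c and the possibly negative Taylor terms are all absorbed into the
    cubic term by powers of 1 \<le> e / c. This is the origin of 1 / c^3, K / c^2 and K / c.\<close>
  have "f c \<le> 1" by (rule f)
  also have "1 \<le> e ^ 3 / c ^ 3" using c power_mono[OF e(1), of 3] by (simp add: divide_simps)
  finally have 1: "f c \<le> 1 / c ^ 3 * e ^ 3" by simp
  have "- (f1 y * \<eta>) \<le> K * e"
    using abs_ge_minus_self[of "f1 y * \<eta>"] mult_right_mono[OF b(1)[OF yc], of e] e by (simp add: abs_mult e_def)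
  also have "K * e \<le> K * (e ^ 3 / c\<^sup>2)"
    using c e power_mono[OF e(1), of 2] K
    by (intro mult_left_mono) (auto simp: divide_simps power2_eq_square power3_eq_cube intro!: mult_mono)
  finally have 2: "- (f1 y * \<eta>) \<le> K / c\<^sup>2 * e ^ 3" by simp
  have e2: "\<eta>\<^sup>2 = e\<^sup>2" by (simp add: e_def)
  have "- (f2 y / 2 * \<eta>\<^sup>2) \<le> \<bar>f2 y\<bar> * e\<^sup>2"
    unfolding e2 using mult_right_mono[of "- f2 y / 2" "\<bar>f2 y\<bar>" "e\<^sup>2"] by simp
  also have "\<dots> \<le> K * e\<^sup>2" using b(2)[OF yc] by (intro mult_right_mono) auto
  also have "\<dots> \<le> K * (e ^ 3 / c)"
    using c e K by (intro mult_left_mono) (auto simp: divide_simps power2_eq_square power3_eq_cube intro!: mult_mono)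
  finally have 3: "- (f2 y / 2 * \<eta>\<^sup>2) \<le> K / c * e ^ 3" by simp
  have "0 \<le> K * e ^ 3" using K e by simp
  then have "f c \<le> f y + f1 y * \<eta> + f2 y / 2 * \<eta>\<^sup>2 + (K + 1 / c ^ 3 + K / c\<^sup>2 + K / c) * e ^ 3"
    using 1 2 3 f(1)[of y] by (simp add: distrib_right)
  then show ?thesis using False by (simp add: max_def e_def)
qed

lemma gaussian_inner: "has_bochner_integral (gaussian 1) (\<lambda>n. x \<bullet> n) 0"
proof -
  have "has_bochner_integral (gaussian 1) (\<lambda>n. \<Sum>i\<in>UNIV. x $ i * n $ i) (\<Sum>i\<in>UNIV. x $ i * 0)"
    by (intro has_bochner_integral_sum has_bochner_integral_mult_right gaussian_mean)
  then show ?thesis by (simp add: inner_vec_def)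
qed

lemma gaussian_inner_sq: "has_bochner_integral (gaussian 1) (\<lambda>n. (x \<bullet> n)\<^sup>2) (x \<bullet> x)"
proof -
  have "has_bochner_integral (gaussian 1) (\<lambda>n. \<Sum>i\<in>UNIV. \<Sum>j\<in>UNIV. x $ i * x $ j * (n $ i * n $ j))
      (\<Sum>i\<in>UNIV. \<Sum>j\<in>UNIV. x $ i * x $ j * (if i = j then 1 else 0))"
    by (intro has_bochner_integral_sum has_bochner_integral_mult_right gaussian_covariance)
  moreover have "(x \<bullet> n)\<^sup>2 = (\<Sum>i\<in>UNIV. \<Sum>j\<in>UNIV. x $ i * x $ j * (n $ i * n $ j))" for n
    by (simp add: inner_vec_def power2_eq_square sum_product mult_ac)
  moreover have "(\<Sum>i\<in>UNIV. \<Sum>j\<in>UNIV. x $ i * x $ j * (if i = j then 1 else 0)) = x \<bullet> x"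
    by (simp add: inner_vec_def if_distrib cong: if_cong)
  ultimately show ?thesis by simp
qed

lemma gaussian_norm_sq: "has_bochner_integral (gaussian 1) (\<lambda>n. (norm n)\<^sup>2) 3"
proof -
  have "has_bochner_integral (gaussian 1) (\<lambda>n. \<Sum>i\<in>UNIV. n $ i * n $ i) (\<Sum>i\<in>(UNIV :: 3 set). 1)"
    by (rule has_bochner_integral_sum) (use gaussian_covariance[of i i for i] in simp)
  then show ?thesis
    by (simp add: power2_norm_eq_inner inner_vec_def)
qed

text \<open>One time step of the comparison process. In the variable \<open>y = |x|\<^sup>2 / (4 \<nu> T)\<close> the generator of a Bessel
  process of dimension \<open>2 - k\<close> becomes \<open>y f'' + (1 - k / 2 + y) f' = 0\<close>, solved by \<open>lower_gamma (k / 2)\<close>.\<close>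

lemma gaussian_step:
  fixes k \<nu> R m \<theta> S :: real
  assumes k: "0 < k" "k < 3" and \<nu>: "0 < \<nu>" and R: "0 < R" and m: "0 < m" and \<theta>: "0 < \<theta>" and S: "0 < S"
  defines "c \<equiv> m\<^sup>2 / (8 * \<nu> * S)"
  shows "\<exists>C\<ge>0. \<forall>x h T. m \<le> norm x \<longrightarrow> norm x \<le> R \<longrightarrow> 0 < h \<longrightarrow> h \<le> 1 \<longrightarrow> \<theta> \<le> T - h \<longrightarrow> T \<le> S \<longrightarrow>
    (\<integral>n. lower_gamma (k / 2) (max (((norm (x + sqrt (2 * \<nu> * h) *\<^sub>R n))\<^sup>2 - 2 * (k + 1) * \<nu> * h) / (4 * \<nu> * (T - h))) c)
       \<partial>gaussian 1) \<le> lower_gamma (k / 2) ((norm x)\<^sup>2 / (4 * \<nu> * T)) + C * (h * sqrt h)"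
proof -
  define a where "a = k / 2"
  have ka: "k = 2 * a" by (simp add: a_def)
  define f where "f = lower_gamma a"
  define f1 where "f1 y = y powr (a - 1) / exp y / Gamma a" for y
  define f2 where "f2 y = ((a - 1) / y - 1) * f1 y" for y
  define f3 where "f3 y = (- (a - 1) / y\<^sup>2 + ((a - 1) / y - 1)\<^sup>2) * f1 y" for y
  have a: "0 < a" "a \<le> 2" using k by (auto simp: a_def)
  have G: "Gamma a > 0" using a by simp
  have c: "0 < c" using \<nu> m S by (simp add: c_def)
  have d1: "(f has_real_derivative f1 y) (at y)" if "c \<le> y" for y
    unfolding f_def f1_def using a(1) c that by (intro lower_gamma_deriv) auto
  have d2: "(f1 has_real_derivative f2 y) (at y)" if "c \<le> y" for y
  proof -
    have y: "y > 0" using c that by simp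
    have f1_alt: "f1 = (\<lambda>y. y powr (a - 1) * exp (- y) / Gamma a)"
      by (simp add: fun_eq_iff f1_def exp_minus divide_inverse)
    have "((\<lambda>y. y powr (a - 1) * exp (- y) / Gamma a) has_real_derivative
      ((a - 1) * y powr (a - 1 - 1) * exp (- y) - y powr (a - 1) * exp (- y)) / Gamma a) (at y)"
      using y G by (auto intro!: derivative_eq_intros)
    moreover have py: "y powr (a - 1 - 1) = y powr (a - 1) / y" using y by (subst powr_diff) auto
    have "((a - 1) * (P / y) * e - P * e) / Gamma a = ((a - 1) / y - 1) * (P * e / Gamma a)" for P e
      using y G by (simp add: field_simps)
    ultimately show ?thesis unfolding f2_def f1_alt py by (simp only:)
  qed
  have d3: "(f2 has_real_derivative f3 y) (at y)" if "c \<le> y" for y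
  proof -
    have y: "y > 0" using c that by simp
    have "((\<lambda>y. ((a - 1) / y - 1) * f1 y) has_real_derivative
        (- (a - 1) / y\<^sup>2 * f1 y + ((a - 1) / y - 1) * f2 y)) (at y)"
      using y by (auto intro!: derivative_eq_intros d2[OF that] simp: power2_eq_square)
    moreover have "- (a - 1) / y\<^sup>2 * f1 y + ((a - 1) / y - 1) * f2 y = f3 y"
      unfolding f2_def f3_def by (simp only: power2_eq_square[of "(a - 1) / y - 1"] distrib_right mult.assoc)
    moreover have "f2 = (\<lambda>y. ((a - 1) / y - 1) * f1 y)" by (simp add: fun_eq_iff f2_def)
    ultimately show ?thesis by simp
  qed
  define K0 where "K0 = (c powr (a - 1) + 1) / Gamma a"
  \<comment> \<open>One bound for \<open>f1\<close>, \<open>f2\<close> and \<open>f3\<close>: the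
    three summands bound the factors that they carry in front of \<open>f1\<close>, where |a - 1|
    \<le> 1 is used.\<close>
  define K where "K = (1 + (1 / c + 1) + (1 / c\<^sup>2 + (1 / c + 1)\<^sup>2)) * K0"
  have K0: "0 \<le> K0" using G by (simp add: K0_def)
  have f1b: "0 \<le> f1 y" "f1 y \<le> K0" if "c \<le> y" for y
    using divide_right_mono[OF powr_div_exp_bounded[OF c a(2) that] less_imp_le[OF G]] G
    by (simp_all add: f1_def K0_def)
  have g1: "\<bar>(a - 1) / y - 1\<bar> \<le> 1 / c + 1" if "c \<le> y" for y
  proof -
    have "\<bar>a - 1\<bar> / y \<le> 1 / c" using that c a k ka by (intro frac_le) auto
    then show ?thesis using that c abs_triangle_ineq4[of "(a - 1) / y" 1] by simp
  qed
  have g2: "\<bar>- (a - 1) / y\<^sup>2\<bar> \<le> 1 / c\<^sup>2" if "c \<le> y" for y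
  proof -
    have "\<bar>a - 1\<bar> / y\<^sup>2 \<le> 1 / c\<^sup>2" using that c a k ka by (intro frac_le) (auto intro: power_mono)
    then show ?thesis by (simp add: abs_minus_commute)
  qed
  have b1: "\<bar>f1 y\<bar> \<le> K" if "c \<le> y" for y
  proof -
    have "\<bar>f1 y\<bar> \<le> 1 * K0" using f1b[OF that] by simp
    also have "\<dots> \<le> K" unfolding K_def using K0 c by (intro mult_right_mono) auto
    finally show ?thesis .
  qed
  have b2: "\<bar>f2 y\<bar> \<le> K" if "c \<le> y" for y
  proof -
    have "\<bar>f2 y\<bar> \<le> (1 / c + 1) * K0"
      unfolding f2_def abs_mult using g1[OF that] f1b[OF that] by (intro mult_mono) auto
    also have "\<dots> \<le> K" unfolding K_def using K0 c by (intro mult_right_mono) auto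
    finally show ?thesis .
  qed
  have b3: "\<bar>f3 y\<bar> \<le> K" if "c \<le> y" for y
  proof -
    have "((a - 1) / y - 1)\<^sup>2 \<le> (1 / c + 1)\<^sup>2"
      using g1[OF that] c by (intro abs_le_square_iff[THEN iffD1]) auto
    then have "\<bar>- (a - 1) / y\<^sup>2 + ((a - 1) / y - 1)\<^sup>2\<bar> \<le> 1 / c\<^sup>2 + (1 / c + 1)\<^sup>2"
      using g2[OF that] abs_triangle_ineq[of "- (a - 1) / y\<^sup>2" "((a - 1) / y - 1)\<^sup>2"] by simp
    then have "\<bar>f3 y\<bar> \<le> (1 / c\<^sup>2 + (1 / c + 1)\<^sup>2) * K0"
      unfolding f3_def abs_mult using f1b[OF that] by (intro mult_mono) auto
    also have "\<dots> \<le> K" unfolding K_def using K0 c by (intro mult_right_mono) auto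
    finally show ?thesis .
  qed
  have K: "0 \<le> K" using b1[of c] abs_ge_zero[of "f1 c"] by linarith
  define C0 where "C0 = K + 1 / c ^ 3 + K / c\<^sup>2 + K / c"
  have C0: "0 \<le> C0" using K c by (simp add: C0_def)
  have taylor: "f (max (y + \<eta>) c) \<le> f y + f1 y * \<eta> + f2 y / 2 * \<eta>\<^sup>2 + C0 * \<bar>\<eta>\<bar> ^ 3" if "2 * c \<le> y" for y \<eta>
    unfolding C0_def
    by (rule taylor_clamped[where f = f and ?f1.0 = f1 and ?f2.0 = f2 and ?f3.0 = f3])
      (use c K a d1 d2 d3 b1 b2 b3 that in \<open>auto simp: f_def intro: lower_gamma_nonneg lower_gamma_le_1\<close>)
  define Y where "Y = R\<^sup>2 / (4 * \<nu> * \<theta>)"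
  \<comment> \<open>Chosen so that |p n| + |q n| \<le> D (1 + |n|^2) for the coefficients
    \<open>p\<close> and \<open>q\<close> of the increment below.\<close>
  define D where "D = sqrt (2 * \<nu>) * R / (2 * \<nu> * \<theta>) + (Y / \<theta> + (k + 2) / (2 * \<theta>))"
  have Y: "0 \<le> Y" using \<nu> \<theta> by (simp add: Y_def)
  have D: "0 \<le> D" using Y \<nu> \<theta> R k by (auto simp: D_def intro!: add_nonneg_nonneg divide_nonneg_nonneg)
  define E where "E = 4 * C0 * D ^ 3 + 6 * K * D\<^sup>2"
  have E: "0 \<le> E" using C0 D K by (simp add: E_def)
  define M where "M = (\<integral>n. 1 + norm n ^ 6 \<partial>gaussian 1)"
  have M: "has_bochner_integral (gaussian 1) (\<lambda>n. 1 + norm n ^ 6) M"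
    unfolding M_def using gaussian_integrable_norm6 by (intro has_bochner_integral_integrable) auto
  have "0 \<le> M" unfolding M_def by (intro integral_nonneg_AE) auto
  define C where "C = E * M + K * Y / \<theta>\<^sup>2"
  have C: "0 \<le> C" using E K Y \<open>0 \<le> M\<close> by (simp add: C_def)
  show ?thesis
  proof (intro exI[of _ C] conjI allI impI C)
    fix x :: "real^3" and h T :: real
    assume x: "m \<le> norm x" "norm x \<le> R" and h: "0 < h" "h \<le> 1" and T: "\<theta> \<le> T - h" "T \<le> S"
    define T' where "T' = T - h"
    have T': "\<theta> \<le> T'" "0 < T'" "0 < T" "T = T' + h" using T h \<theta> by (auto simp: T'_def)
    define y where "y = (norm x)\<^sup>2 / (4 * \<nu> * T)"
    have y0: "0 \<le> y" using \<nu> T' by (simp add: y_def)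
    have yY: "y \<le> Y"
      unfolding y_def Y_def using x \<nu> \<theta> T' h by (intro frac_le power_mono mult_left_mono) auto
    \<comment> \<open>c is half of the least y that |x| \<ge> m and T \<le> S allow, which is the
      margin that the clamped Taylor estimate requires.\<close>
    have yc: "2 * c \<le> y"
    proof -
      have "2 * c = m\<^sup>2 / (4 * \<nu> * S)" using \<nu> S by (simp add: c_def)
      also have "\<dots> \<le> y" unfolding y_def using x m \<nu> S T T' by (intro frac_le power_mono mult_left_mono) auto
      finally show ?thesis .
    qed
    then have yc': "c \<le> y" "0 < y" using c by auto
    define s where "s = sqrt h"
    have s: "0 < s" "s \<le> 1" "s\<^sup>2 = h" using h by (auto simp: s_def)
    have hs: "h \<le> s" using s by (simp add: power2_eq_square flip: s(3))
    define p where "p n = sqrt (2 * \<nu>) / (2 * \<nu> * T') * (x \<bullet> n)" for n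
    define q where "q n = y / T' - (k + 1) / (2 * T') + 1 / (2 * T') * (norm n)\<^sup>2" for n :: "real^3"
    \<comment> \<open>The increment of the argument splits into a centred Gaussian part of order
      sqrt h and a part of order h; the latter contains the change from T to T - h and the
      subtracted 2 (k + 1) \<nu> h.\<close>
    have arg: "((norm (x + sqrt (2 * \<nu> * h) *\<^sub>R n))\<^sup>2 - 2 * (k + 1) * \<nu> * h) / (4 * \<nu> * (T - h))
        = y + (s * p n + h * q n)" for n
    proof -
      have sq: "sqrt (2 * \<nu> * h) = sqrt (2 * \<nu>) * s" by (simp add: real_sqrt_mult s_def)
      have sq2: "(sqrt (2 * \<nu>) * s)\<^sup>2 = 2 * \<nu> * h" using \<nu> s by (simp add: power_mult_distrib)
      have "(norm (x + sqrt (2 * \<nu> * h) *\<^sub>R n))\<^sup>2 = (norm x)\<^sup>2 + 2 * (sqrt (2 * \<nu>) * s) * (x \<bullet> n) + 2 * \<nu> * h * (norm n)\<^sup>2"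
      proof -
        have "(norm (x + c *\<^sub>R n))\<^sup>2 = (norm x)\<^sup>2 + 2 * c * (x \<bullet> n) + c\<^sup>2 * (norm n)\<^sup>2" for c
          unfolding power2_norm_eq_inner
          by (simp add: inner_add_left inner_add_right inner_commute power2_eq_square algebra_simps)
        then show ?thesis unfolding sq by (simp only: sq2)
      qed
      moreover have "(norm x)\<^sup>2 = y * (4 * \<nu> * (T' + h))"
        using \<nu> T' by (simp add: y_def)
      ultimately show ?thesis
        using \<nu> T' unfolding p_def q_def T'_def[symmetric] by (simp add: field_simps)
    qed
    have pb: "\<bar>p n\<bar> \<le> sqrt (2 * \<nu>) * R / (2 * \<nu> * \<theta>) * (1 + (norm n)\<^sup>2)" for n
    proof -
      have "\<bar>x \<bullet> n\<bar> \<le> R * norm n"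
        using Cauchy_Schwarz_ineq2[of x n] mult_right_mono[OF x(2), of "norm n"] by simp
      also have "\<dots> \<le> R * (1 + (norm n)\<^sup>2)"
      proof -
        have "0 \<le> (norm n - 1 / 2)\<^sup>2" by simp
        then have "norm n \<le> 1 / 4 + (norm n)\<^sup>2" by (simp add: power2_diff power_divide)
          then have "norm n \<le> 1 + (norm n)\<^sup>2" by linarith
        then show ?thesis using R by (intro mult_left_mono) auto
      qed
      finally have "\<bar>p n\<bar> \<le> sqrt (2 * \<nu>) / (2 * \<nu> * T') * (R * (1 + (norm n)\<^sup>2))"
        unfolding p_def abs_mult using \<nu> T' by (intro mult_mono) auto
      also have "\<dots> \<le> sqrt (2 * \<nu>) / (2 * \<nu> * \<theta>) * (R * (1 + (norm n)\<^sup>2))"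
        using \<nu> T' \<theta> R by (intro mult_right_mono frac_le) auto
      finally show ?thesis by simp
    qed
    have qb: "\<bar>q n\<bar> \<le> (Y / \<theta> + (k + 2) / (2 * \<theta>)) * (1 + (norm n)\<^sup>2)" for n
    proof -
      have t: "z / (2 * T') \<le> z / (2 * \<theta>)" if "0 \<le> z" for z using that T' \<theta> by (intro frac_le) auto
      have "\<bar>q n\<bar> \<le> y / T' + (k + 1) / (2 * T') + 1 / (2 * T') * (norm n)\<^sup>2"
        unfolding q_def using y0 T' k by (intro abs_leI) (auto simp: field_simps)
      also have "\<dots> \<le> Y / \<theta> + (k + 1) / (2 * \<theta>) + 1 / (2 * \<theta>) * (norm n)\<^sup>2"
        using y0 yY Y T' \<theta> t k by (intro add_mono mult_right_mono frac_le) auto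
      also have "\<dots> \<le> (Y / \<theta> + (k + 2) / (2 * \<theta>)) * (1 + (norm n)\<^sup>2)"
      proof -
        have "1 / (2 * \<theta>) * (norm n)\<^sup>2 \<le> (Y / \<theta> + (k + 2) / (2 * \<theta>)) * (norm n)\<^sup>2"
          using Y \<theta> k by (intro mult_right_mono) (auto simp: field_simps)
        moreover have "(k + 1) / (2 * \<theta>) \<le> (k + 2) / (2 * \<theta>)" using \<theta> by (intro divide_right_mono) auto
        ultimately show ?thesis by (simp add: distrib_left)
      qed
      finally show ?thesis .
    qed
    \<comment> \<open>The terms up to order h are kept exactly, because they will cancel under the
      integral; the others are at most \<open>E\<close> h^(3/2) (1 + |n|^6).\<close>
    have le: "f (max (y + (s * p n + h * q n)) c) \<le>
        f y + (f1 y * s * p n + f1 y * h * q n) + f2 y / 2 * h * (p n)\<^sup>2 + E * (h * s) * (1 + norm n ^ 6)" for n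
    proof -
      define \<eta> where "\<eta> = s * p n + h * q n"
      define w where "w = D * (1 + (norm n)\<^sup>2)"
      have w0: "0 \<le> w" using D by (simp add: w_def)
      have pqw: "\<bar>p n\<bar> + \<bar>q n\<bar> \<le> w"
        using pb[of n] qb[of n] unfolding w_def D_def by (simp add: distrib_right)
      have pw: "\<bar>p n\<bar> \<le> w" and qw: "\<bar>q n\<bar> \<le> w" using pqw by linarith+
      have "\<bar>\<eta>\<bar> \<le> s * \<bar>p n\<bar> + h * \<bar>q n\<bar>"
        unfolding \<eta>_def using abs_triangle_ineq[of "s * p n" "h * q n"] s h by (simp add: abs_mult)
      also have "\<dots> \<le> s * \<bar>p n\<bar> + s * \<bar>q n\<bar>" using hs by (intro add_left_mono mult_right_mono) auto
      also have "\<dots> \<le> s * w" using pqw s by (simp flip: distrib_left)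
      finally have "\<bar>\<eta>\<bar> ^ 3 \<le> (s * w) ^ 3" by (intro power_mono) auto
      also have "\<dots> = h * s * w ^ 3" using s(3) by (simp add: power_mult_distrib power3_eq_cube power2_eq_square)
      finally have e3: "\<bar>\<eta>\<bar> ^ 3 \<le> h * s * w ^ 3" .
      have e2: "f2 y / 2 * \<eta>\<^sup>2 \<le> f2 y / 2 * h * (p n)\<^sup>2 + K / 2 * (3 * (h * s) * w\<^sup>2)"
      proof -
        have "\<eta>\<^sup>2 = h * (p n)\<^sup>2 + (2 * (h * s) * (p n * q n) + h * h * (q n)\<^sup>2)"
          unfolding \<eta>_def s(3)[symmetric] by (simp add: power2_eq_square algebra_simps)
        moreover have "f2 y / 2 * (2 * (h * s) * (p n * q n) + h * h * (q n)\<^sup>2) \<le> K / 2 * (3 * (h * s) * w\<^sup>2)"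
        proof -
          have "\<bar>p n * q n\<bar> \<le> w\<^sup>2" unfolding abs_mult power2_eq_square using pw qw w0 by (intro mult_mono) auto
          then have 1: "\<bar>2 * (h * s) * (p n * q n)\<bar> \<le> 2 * (h * s) * w\<^sup>2"
            using h s by (simp add: abs_mult)
          have "(q n)\<^sup>2 \<le> w\<^sup>2" using qw w0 by (simp add: abs_le_square_iff[symmetric])
          then have 2: "h * h * (q n)\<^sup>2 \<le> h * s * w\<^sup>2" using h s hs by (intro mult_mono) auto
          have "\<bar>2 * (h * s) * (p n * q n) + h * h * (q n)\<^sup>2\<bar> \<le> 3 * (h * s) * w\<^sup>2"
            using 1 2 abs_triangle_ineq[of "2 * (h * s) * (p n * q n)" "h * h * (q n)\<^sup>2"] by simp
          then have "\<bar>f2 y / 2 * (2 * (h * s) * (p n * q n) + h * h * (q n)\<^sup>2)\<bar> \<le> K / 2 * (3 * (h * s) * w\<^sup>2)"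
            unfolding abs_mult using b2[OF yc'(1)] K by (intro mult_mono) auto
          then show ?thesis by (rule abs_le_D1)
        qed
        ultimately show ?thesis by (simp add: distrib_left)
      qed
      define r where "r = (norm n)\<^sup>2"
      have r: "0 \<le> r" "norm n ^ 6 = r ^ 3" by (auto simp: r_def simp flip: power_mult)
      \<comment> \<open>Convexity of the cube made explicit by a factorisation of the
        difference.\<close>
      have r3: "(1 + r) ^ 3 \<le> 4 * (1 + r ^ 3)"
      proof -
        have "4 * (1 + r ^ 3) - (1 + r) ^ 3 = 3 * (1 - r)\<^sup>2 * (1 + r)"
          by (simp add: power2_eq_square power3_eq_cube algebra_simps)
        moreover have "0 \<le> 3 * (1 - r)\<^sup>2 * (1 + r)" using r by simp
        ultimately show ?thesis by linarith
      qed
      have r2: "(1 + r)\<^sup>2 \<le> 4 * (1 + r ^ 3)"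
        using r3 power_increasing[of 2 3 "1 + r"] r by simp
      have w3: "w ^ 3 \<le> D ^ 3 * (4 * (1 + norm n ^ 6))"
        unfolding w_def power_mult_distrib r(2) r_def[symmetric] using D r3 by (intro mult_left_mono) auto
      have w2: "w\<^sup>2 \<le> D\<^sup>2 * (4 * (1 + norm n ^ 6))"
        unfolding w_def power_mult_distrib r(2) r_def[symmetric] using D r2 by (intro mult_left_mono) auto
      have "f (max (y + \<eta>) c) \<le> f y + f1 y * \<eta> + f2 y / 2 * \<eta>\<^sup>2 + C0 * \<bar>\<eta>\<bar> ^ 3" by (rule taylor[OF yc])
      also have "C0 * \<bar>\<eta>\<bar> ^ 3 \<le> C0 * (h * s * (D ^ 3 * (4 * (1 + norm n ^ 6))))"
        using e3 w3 C0 h s by (intro mult_left_mono order_trans[OF e3] mult_left_mono) auto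
      also have "f2 y / 2 * \<eta>\<^sup>2 \<le> f2 y / 2 * h * (p n)\<^sup>2 + K / 2 * (3 * (h * s) * (D\<^sup>2 * (4 * (1 + norm n ^ 6))))"
        using w2 K h s by (intro order_trans[OF e2] add_left_mono mult_left_mono) auto
      finally show ?thesis unfolding \<eta>_def E_def by (simp add: algebra_simps)
    qed
    have int: "has_bochner_integral (gaussian 1)
       (\<lambda>n. f y + (f1 y * s * p n + f1 y * h * q n) + f2 y / 2 * h * (p n)\<^sup>2 + E * (h * s) * (1 + norm n ^ 6))
       (f y + (f1 y * s * (sqrt (2 * \<nu>) / (2 * \<nu> * T') * 0) + f1 y * h * (y / T' - (k + 1) / (2 * T') + 1 / (2 * T') * 3))
        + f2 y / 2 * h * ((sqrt (2 * \<nu>) / (2 * \<nu> * T'))\<^sup>2 * (x \<bullet> x)) + E * (h * s) * M)"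
      unfolding p_def q_def power_mult_distrib
      by (intro has_bochner_integral_add has_bochner_integral_mult_right has_bochner_integral_diff M
          gaussian_inner gaussian_inner_sq gaussian_norm_sq)
        (simp_all add: has_bochner_integral_iff gaussian.prob_space[simplified])
    have "mono (\<lambda>z. f (max z c))"
      using a(1) by (auto intro!: monoI lower_gamma_mono simp: f_def)
    then have [measurable]: "(\<lambda>z. f (max z c)) \<in> borel_measurable borel" by (rule borel_measurable_mono)
    have [measurable]: "p \<in> borel_measurable borel" "q \<in> borel_measurable borel"
      unfolding p_def[abs_def] q_def[abs_def] by measurable
    have "integrable (gaussian 1) (\<lambda>n. f (max (y + (s * p n + h * q n)) c))"
      using a(1) by (intro gaussian.integrable_const_bound[of _ 1])
        (auto simp: f_def lower_gamma_nonneg lower_gamma_le_1 intro!: measurable_compose[OF _ \<open>(\<lambda>z. f (max z c)) \<in> borel_measurable borel\<close>[unfolded f_def]])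
    then have "(\<integral>n. f (max (y + (s * p n + h * q n)) c) \<partial>gaussian 1) \<le>
        f y + (f1 y * s * (sqrt (2 * \<nu>) / (2 * \<nu> * T') * 0) + f1 y * h * (y / T' - (k + 1) / (2 * T') + 1 / (2 * T') * 3))
        + f2 y / 2 * h * ((sqrt (2 * \<nu>) / (2 * \<nu> * T'))\<^sup>2 * (x \<bullet> x)) + E * (h * s) * M"
      using int le unfolding has_bochner_integral_iff by (metis (no_types, lifting) integral_mono)
    also have "(sqrt (2 * \<nu>) / (2 * \<nu> * T'))\<^sup>2 * (x \<bullet> x) = 2 * y * T / T'\<^sup>2"
      using \<nu> T'(2,3) by (simp add: y_def power_divide power_mult_distrib power2_norm_eq_inner) (simp add: field_simps power2_eq_square)
    \<comment> \<open>Writing T = T' + h gives T / T'^2 = 1 / T' + h / T'^2. The first part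
      completes the generator at order h, which the differential equation of f annihilates; the
      second leaves a remainder of order h^2.\<close>
    also have "f y + (f1 y * s * (sqrt (2 * \<nu>) / (2 * \<nu> * T') * 0) + f1 y * h * (y / T' - (k + 1) / (2 * T') + 1 / (2 * T') * 3))
        + f2 y / 2 * h * (2 * y * T / T'\<^sup>2) + E * (h * s) * M
        = f y + h / T' * (y * f2 y + (1 - a + y) * f1 y) + f2 y * (h * h) * y / T'\<^sup>2 + E * (h * s) * M"
      unfolding T'(4) ka using T'(2) by (simp add: field_simps power2_eq_square)
    also have "y * f2 y + (1 - a + y) * f1 y = 0"
      unfolding f2_def using yc' by (simp add: field_simps)
    also have "f2 y * (h * h) * y / T'\<^sup>2 \<le> K * (h * s) * Y / \<theta>\<^sup>2"
    proof (intro frac_le mult_mono power_mono)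
      show "f2 y \<le> K" using b2[OF yc'(1)] by simp
    qed (use K yY T' \<theta> h s hs y0 Y in auto)
    finally show "(\<integral>n. lower_gamma (k / 2) (max (((norm (x + sqrt (2 * \<nu> * h) *\<^sub>R n))\<^sup>2 - 2 * (k + 1) * \<nu> * h) / (4 * \<nu> * (T - h))) c)
       \<partial>gaussian 1) \<le> lower_gamma (k / 2) ((norm x)\<^sup>2 / (4 * \<nu> * T)) + C * (h * sqrt h)"
      unfolding arg a_def[symmetric] f_def[symmetric] y_def[symmetric] s_def[symmetric] C_def by (simp add: algebra_simps)
  qed
qed

section \<open>Continuity of the drift\<close>

lemma has_derivative_slice:
  assumes "(f has_derivative f') (at (x, t))"
  shows "((\<lambda>y. f (y, t)) has_derivative (\<lambda>h. f' (h, 0))) (at x)"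
proof -
  have "((\<lambda>y. (y, t)) has_derivative (\<lambda>h. (h, 0))) (at x)"
    by (auto intro!: derivative_eq_intros)
  from has_derivative_compose[OF this, of f f'] assms show ?thesis by simp
qed

context screening begin

abbreviation "U \<equiv> UNIV \<times> {0<..<T} :: spacetime set"

text \<open>Space derivatives of u as a function on space-time: its smoothness there gives
  continuity jointly in position and time, which derivatives of single time slices would
  not.\<close>

definition Du :: "3 \<Rightarrow> spacetime \<Rightarrow> real^3" where
  "Du i p = frechet_derivative u (at p) (axis i 1, 0)"

definition D2u :: "3 \<Rightarrow> 3 \<Rightarrow> spacetime \<Rightarrow> real^3" where
  "D2u i m p = frechet_derivative (Du i) (at p) (axis m 1, 0)"

lemma A_subset_U: "A \<subseteq> U"
  using basic(2) by (auto simp: region_def)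

lemma u_smooth: "cont_diff_on n U u"
  using setting by (simp add: annular_setting_def navier_stokes_def smooth_on_def)

lemma u_has_derivative: "p \<in> U \<Longrightarrow> (u has_derivative frechet_derivative u (at p)) (at p)"
  using u_smooth[of 1] by (auto simp: frechet_derivative_works[symmetric])

lemma Du_smooth: "cont_diff_on n U (Du i)"
  using u_smooth[of "Suc n"] by (simp add: Du_def[abs_def])

lemma Du_has_derivative: "p \<in> U \<Longrightarrow> (Du i has_derivative frechet_derivative (Du i) (at p)) (at p)"
  using Du_smooth[of 1 i] by (auto simp: frechet_derivative_works[symmetric])

lemma continuous_on_u: "continuous_on A u"
  using u_smooth[of 0] A_subset_U by (auto intro: continuous_on_subset)

lemma continuous_on_Du: "continuous_on A (Du i)"
  using Du_smooth[of 0 i] A_subset_U by (auto intro: continuous_on_subset)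

lemma continuous_on_D2u: "continuous_on A (D2u i m)"
proof -
  have "continuous_on U (D2u i m)" using Du_smooth[of 1 i] by (simp add: D2u_def[abs_def])
  then show ?thesis using A_subset_U by (rule continuous_on_subset)
qed

lemma grad_u: "(x, t) \<in> U \<Longrightarrow> grad (\<lambda>y. u (y, t) $ j) x $ i = Du i (x, t) $ j"
proof -
  assume "(x, t) \<in> U"
  from bounded_linear.has_derivative[OF bounded_linear_vec_nth has_derivative_slice[OF u_has_derivative[OF this]], of j]
  show ?thesis by (simp add: grad_eq Du_def)
qed

definition vort_sq :: "spacetime \<Rightarrow> real" where
  "vort_sq p = (Du 2 p $ 3 - Du 3 p $ 2)\<^sup>2 + (Du 3 p $ 1 - Du 1 p $ 3)\<^sup>2 + (Du 1 p $ 2 - Du 2 p $ 1)\<^sup>2"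

definition D_vort_sq :: "3 \<Rightarrow> spacetime \<Rightarrow> real" where
  "D_vort_sq m p = 2 * (Du 2 p $ 3 - Du 3 p $ 2) * (D2u 2 m p $ 3 - D2u 3 m p $ 2)
     + 2 * (Du 3 p $ 1 - Du 1 p $ 3) * (D2u 3 m p $ 1 - D2u 1 m p $ 3)
     + 2 * (Du 1 p $ 2 - Du 2 p $ 1) * (D2u 1 m p $ 2 - D2u 2 m p $ 1)"

text \<open>The setting bounds the gradient of ln \<Phi> but says nothing of its continuity. On the
  region \<Phi> is |x|^2 |curl u| and positive, so its logarithm inherits the smoothness of u. The
  squared vorticity is polynomial in the derivatives of u, so no norm is differentiated.\<close>

lemma ln_\<Phi>_eq:
  assumes "(x, t) \<in> A"
  shows "vort_sq (x, t) > 0" "ln (\<Phi> (x, t)) = ln (x \<bullet> x) + ln (vort_sq (x, t)) / 2"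
proof -
  let ?c = "curl (\<lambda>y. u (y, t)) x"
  have U: "(x, t) \<in> U" using assms A_subset_U by auto
  have n: "norm x > 0" using assms by (rule norm_pos)
  have \<Phi>: "norm ?c = \<Phi> (x, t) / (norm x)\<^sup>2" "0 < \<Phi> (x, t)"
    using setting assms by (auto simp: annular_setting_def intro: less_le_trans)
  have c: "(norm ?c)\<^sup>2 = vort_sq (x, t)"
    unfolding curl_def Let_def grad_u[OF U] power2_norm_eq_inner
    by (simp add: vort_sq_def inner_vec_def sum_3 power2_eq_square)
  have c0: "norm ?c > 0" using \<Phi> n by simp
  show "vort_sq (x, t) > 0" using c0 unfolding c[symmetric] by simp
  have "\<Phi> (x, t) = (norm x)\<^sup>2 * norm ?c" using \<Phi>(1) n by simp
  then have "ln (\<Phi> (x, t)) = ln ((norm x)\<^sup>2) + ln (norm ?c)"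
    using n c0 by (simp add: ln_mult)
  moreover have "ln (vort_sq (x, t)) = 2 * ln (norm ?c)"
    using c0 unfolding c[symmetric] by (simp add: ln_realpow)
  ultimately show "ln (\<Phi> (x, t)) = ln (x \<bullet> x) + ln (vort_sq (x, t)) / 2"
    by (simp add: power2_norm_eq_inner)
qed

lemma grad_ln_\<Phi>:
  assumes "(x, t) \<in> A"
  shows "grad (\<lambda>y. ln (\<Phi> (y, t))) x =
    (\<chi> m. 2 * x $ m / (x \<bullet> x) + D_vort_sq m (x, t) / (2 * vort_sq (x, t)))"
proof -
  have n: "x \<bullet> x > 0" using norm_pos[OF assms] by simp
  have U: "(x, t) \<in> U" using assms A_subset_U by auto
  have "\<forall>\<^sub>F y in nhds x. y \<in> {y. (y, t) \<in> A}"
    using open_slice[OF open_A] assms by (intro eventually_nhds_in_open) auto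
  then have ev: "\<forall>\<^sub>F y in nhds x. ln (\<Phi> (y, t)) = ln (y \<bullet> y) + ln (vort_sq (y, t)) / 2"
    by eventually_elim (simp add: ln_\<Phi>_eq(2))
  define D where "D i h = frechet_derivative (Du i) (at (x, t)) (h, 0)" for i :: 3 and h :: "real^3"
  have Du: "((\<lambda>y. Du i (y, t) $ j) has_derivative (\<lambda>h. D i h $ j)) (at x)" for i j
    unfolding D_def
    by (rule bounded_linear.has_derivative[OF bounded_linear_vec_nth has_derivative_slice[OF Du_has_derivative[OF U]]])
  define Q where "Q h = 2 * (Du 2 (x, t) $ 3 - Du 3 (x, t) $ 2) * (D 2 h $ 3 - D 3 h $ 2)
     + 2 * (Du 3 (x, t) $ 1 - Du 1 (x, t) $ 3) * (D 3 h $ 1 - D 1 h $ 3)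
     + 2 * (Du 1 (x, t) $ 2 - Du 2 (x, t) $ 1) * (D 1 h $ 2 - D 2 h $ 1)" for h
  have "((\<lambda>y. vort_sq (y, t)) has_derivative Q) (at x)"
    unfolding vort_sq_def by (auto intro!: derivative_eq_intros Du simp: Q_def fun_eq_iff algebra_simps)
  moreover have "(ln has_derivative (\<lambda>h. h / vort_sq (x, t))) (at (vort_sq (x, t)))"
    using ln_\<Phi>_eq(1)[OF assms] by (auto intro!: derivative_eq_intros simp: fun_eq_iff divide_inverse)
  ultimately have 1: "((\<lambda>y. ln (vort_sq (y, t))) has_derivative (\<lambda>h. Q h / vort_sq (x, t))) (at x)"
    by (rule has_derivative_compose)
  have "((\<lambda>y. y \<bullet> y) has_derivative (\<lambda>h. 2 * (x \<bullet> h))) (at x)"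
    by (auto intro!: derivative_eq_intros simp: inner_commute)
  moreover have "(ln has_derivative (\<lambda>h. h / (x \<bullet> x))) (at (x \<bullet> x))"
    using n by (auto intro!: derivative_eq_intros simp: fun_eq_iff divide_inverse)
  ultimately have "((\<lambda>y. ln (y \<bullet> y)) has_derivative (\<lambda>h. 2 * (x \<bullet> h) / (x \<bullet> x))) (at x)"
    by (rule has_derivative_compose)
  from has_derivative_add[OF this has_derivative_mult_right[OF 1, of "1 / 2"]]
  have "((\<lambda>y. ln (y \<bullet> y) + ln (vort_sq (y, t)) / 2) has_derivative (\<lambda>h. 2 * (x \<bullet> h) / (x \<bullet> x) +
      Q h / (2 * vort_sq (x, t)))) (at x)"
    by simp
  from grad_eq[OF this] grad_cong_eventually(1)[OF ev] show ?thesis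
    by (simp add: inner_axis Q_def D_def D2u_def D_vort_sq_def)
qed

text \<open>Makes the integrals of the drift along a path exist, split at intermediate times and
  obey the bound on the integrand.\<close>

lemma continuous_on_drift: "continuous_on A b"
proof -
  have x0: "fst p \<noteq> 0" "vort_sq p \<noteq> 0" if "p \<in> A" for p
    using that norm_pos[of "fst p" "snd p"] ln_\<Phi>_eq(1)[of "fst p" "snd p"] by auto
  have v: "continuous_on A vort_sq" "continuous_on A (D_vort_sq m)" for m
    unfolding vort_sq_def[abs_def] D_vort_sq_def[abs_def]
    by (intro continuous_intros continuous_on_Du continuous_on_D2u)+
  have "continuous_on A (\<lambda>p. \<chi> m. 2 * fst p $ m / (fst p \<bullet> fst p) + D_vort_sq m p / (2 * vort_sq p))"
    by (intro continuous_intros v) (use x0 in auto)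
  then have g: "continuous_on A (\<lambda>p. grad (\<lambda>y. ln (\<Phi> (y, snd p))) (fst p))"
    by (rule continuous_on_eq) (use grad_ln_\<Phi> in auto)
  have "continuous_on A (\<lambda>p. u p + (4 * \<nu> / (norm (fst p))\<^sup>2) *\<^sub>R fst p - (2 * \<nu>) *\<^sub>R grad (\<lambda>y. ln (\<Phi> (y, snd p))) (fst p))"
    by (intro continuous_intros g continuous_on_u) (use x0 in auto)
  then show ?thesis
    by (rule continuous_on_eq) (auto simp: drift_def)
qed

end

section \<open>Paths and events\<close>

lemma continuous_on_prefix:
  "continuous_on {0..} f \<Longrightarrow> 0 \<le> a \<Longrightarrow> continuous_on {a..b} (f :: real \<Rightarrow> 'a :: topological_space)"
  by (erule continuous_on_subset) auto

text \<open>Continuity in q reduces the uncountable condition to a countable dense set of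
  times.\<close>

lemma sets_all_interval:
  fixes g :: "real \<Rightarrow> 'w \<Rightarrow> real"
  assumes ab: "a \<le> b" and meas: "\<And>q. q \<in> {a..b} \<Longrightarrow> g q \<in> borel_measurable N"
    and cont: "\<And>w. w \<in> space N \<Longrightarrow> continuous_on {a..b} (\<lambda>q. g q w)"
  shows "{w\<in>space N. \<forall>q\<in>{a..b}. c \<le> g q w} \<in> sets N"
proof -
  \<comment> \<open>The end point a is added because [a, b] may be a single irrational
    point.\<close>
  define D where "D = insert a \<rat> \<inter> {a..b}"
  have D: "countable D" "D \<subseteq> {a..b}" "D \<noteq> {}"
    using countable_rat ab by (auto simp: D_def intro: countable_Int1)
  have dense: "{a..b} \<subseteq> closure D"
  proof
    fix q assume q: "q \<in> {a..b}"
    show "q \<in> closure D"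
      unfolding closure_approachable
    proof (intro allI impI)
      fix e :: real assume e: "0 < e"
      show "\<exists>y\<in>D. dist y q < e"
      proof (cases "q = a")
        case True
        then show ?thesis using e ab by (intro bexI[of _ a]) (auto simp: D_def)
      next
        case False
        then have "max a (q - e) < q" using q e by auto
        then obtain r where r: "r \<in> \<rat>" "max a (q - e) < r" "r < q"
          using Rats_dense_in_real by blast
        then show ?thesis using q by (intro bexI[of _ r]) (auto simp: D_def dist_real_def)
      qed
    qed
  qed
  have cl: "closure D = {a..b}" using D(2) dense by (metis closure_minimal closed_atLeastAtMost subset_antisym)
  have "{w\<in>space N. \<forall>q\<in>{a..b}. c \<le> g q w} = (\<Inter>q\<in>D. {w\<in>space N. c \<le> g q w})"
  proof (intro equalityI subsetI)
    fix w assume w: "w \<in> (\<Inter>q\<in>D. {w\<in>space N. c \<le> g q w})"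
    then have sp: "w \<in> space N" using D(3) by auto
    have "c \<le> g q w" if "q \<in> {a..b}" for q
      by (rule continuous_ge_on_closure[of D "\<lambda>q. g q w"]) (use w that cont[OF sp] in \<open>auto simp: cl\<close>)
    with sp show "w \<in> {w\<in>space N. \<forall>q\<in>{a..b}. c \<le> g q w}" by auto
  qed (use D(2) in auto)
  also have "\<dots> \<in> sets N"
  proof (rule sets.countable_INT'[OF D(1,3)])
    show "(\<lambda>q. {w\<in>space N. c \<le> g q w}) ` D \<subseteq> sets N"
      using meas D(2) by (auto intro!: borel_measurable_le)
  qed
  finally show ?thesis .
qed

text \<open>Fatou's lemma for events: almost all of E lies in the lower limit of the
  \<open>D n\<close>, the union of the increasing \<open>H n\<close>. It transfers bounds for events
  on a grid to statements about whole paths.\<close>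

lemma (in prob_space) measure_le_of_eventually:
  assumes D: "\<And>n. D n \<in> events"
    and ev: "AE w in M. w \<in> E \<longrightarrow> (\<forall>\<^sub>F n in sequentially. w \<in> D n)"
    and le: "\<forall>\<^sub>F n in sequentially. prob (D n) \<le> r n" and r: "r \<longlonglongrightarrow> L"
  shows "prob E \<le> L"
proof -
  define H where "H n = (\<Inter>m\<in>{n..}. D m)" for n
  have H: "H n \<in> events" for n unfolding H_def using D by (intro sets.countable_INT') auto
  have "prob E \<le> prob (\<Union>n. H n)"
  proof (rule finite_measure_mono_AE)
    show "AE w in M. w \<in> E \<longrightarrow> w \<in> (\<Union>n. H n)"
      using ev by eventually_elim (auto simp: H_def eventually_sequentially)
  qed (use H in auto)
  moreover have "prob (\<Union>n. H n) \<le> L"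
  proof (rule tendsto_le[OF sequentially_bot r])
    show "(\<lambda>n. prob (H n)) \<longlonglongrightarrow> prob (\<Union>n. H n)"
      using H by (intro finite_Lim_measure_incseq) (auto simp: incseq_def H_def)
    show "\<forall>\<^sub>F n in sequentially. prob (H n) \<le> r n"
      using le
    proof eventually_elim
      case (elim n)
      have "prob (H n) \<le> prob (D n)" by (intro finite_measure_mono D) (auto simp: H_def)
      with elim show ?case by simp
    qed
  qed
  ultimately show ?thesis by simp
qed

text \<open>The freezing lemma: as Y is independent of N, the joint law of Z and Y is the product
  law, so Z can be held fixed while Y is integrated out.\<close>

lemma (in prob_space) integral_indep_pair:
  fixes Z :: "'a \<Rightarrow> 'b :: second_countable_topology" and Y :: "'a \<Rightarrow> 'c :: second_countable_topology"
  assumes N: "sets N \<subseteq> events" "space N = space M"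
    and Z: "Z \<in> borel_measurable N" and Y: "Y \<in> borel_measurable M"
    and ind: "indep_set (sets N) {Y -` B \<inter> space M | B. B \<in> sets borel}"
    and H: "H \<in> borel_measurable (borel \<Otimes>\<^sub>M borel)" and K: "\<And>z y. \<bar>H (z, y)\<bar> \<le> (K :: real)"
  shows "(\<integral>w. H (Z w, Y w) \<partial>M) = (\<integral>w. (\<integral>y. H (Z w, y) \<partial>distr M borel Y) \<partial>M)"
proof -
  have ZM[measurable]: "Z \<in> borel_measurable M"
    using measurable_from_subalg[OF _ Z, of M] N by (simp add: subalgebra_def)
  note Y[measurable] H[measurable]
  interpret PZ: prob_space "distr M borel Z" by (rule prob_space_distr) simp
  interpret PY: prob_space "distr M borel Y" by (rule prob_space_distr) simp
  interpret P: pair_prob_space "distr M borel Z" "distr M borel Y" ..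
  have eq: "distr M borel Z \<Otimes>\<^sub>M distr M borel Y = distr M (borel \<Otimes>\<^sub>M borel) (\<lambda>w. (Z w, Y w))"
  proof (rule pair_measure_eqI)
    fix A B assume AB: "A \<in> sets (distr M borel Z)" "B \<in> sets (distr M borel Y)"
    then have [measurable]: "A \<in> sets borel" "B \<in> sets borel" by auto
    have "Z -` A \<inter> space M \<in> sets N" using measurable_sets[OF Z, of A] N by simp
    then have "prob ((Z -` A \<inter> space M) \<inter> (Y -` B \<inter> space M)) = prob (Z -` A \<inter> space M) * prob (Y -` B \<inter> space M)"
      by (intro indep_setD[OF ind]) auto
    moreover have "(\<lambda>w. (Z w, Y w)) -` (A \<times> B) \<inter> space M = (Z -` A \<inter> space M) \<inter> (Y -` B \<inter> space M)" by auto
    ultimately show "emeasure (distr M borel Z) A * emeasure (distr M borel Y) B =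
        emeasure (distr M (borel \<Otimes>\<^sub>M borel) (\<lambda>w. (Z w, Y w))) (A \<times> B)"
      by (simp add: emeasure_distr emeasure_eq_measure ennreal_mult')
  next
    have "sets (distr M borel Z \<Otimes>\<^sub>M distr M borel Y) = sets (borel \<Otimes>\<^sub>M borel)"
      by (rule sets_pair_measure_cong) simp_all
    then show "sets (distr M borel Z \<Otimes>\<^sub>M distr M borel Y) =
        sets (distr M (borel \<Otimes>\<^sub>M borel) (\<lambda>w. (Z w, Y w)))" by simp
  qed (rule PZ.sigma_finite_measure_axioms PY.sigma_finite_measure_axioms)+
  have HP: "H \<in> borel_measurable (distr M borel Z \<Otimes>\<^sub>M distr M borel Y)" by simp
  have "(\<integral>w. H (Z w, Y w) \<partial>M) = (\<integral>p. H p \<partial>(distr M borel Z \<Otimes>\<^sub>M distr M borel Y))"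
    unfolding eq by (subst integral_distr) auto
  also have "\<dots> = (\<integral>z. (\<integral>y. H (z, y) \<partial>distr M borel Y) \<partial>distr M borel Z)"
    using K by (intro P.integral_fst'[symmetric] P.integrable_const_bound[of _ K] HP) auto
  also have "\<dots> = (\<integral>w. (\<integral>y. H (Z w, y) \<partial>distr M borel Y) \<partial>M)"
    by (subst integral_distr) auto
  finally show ?thesis .
qed

text \<open>The oscillation bound \<open>\<delta>\<close> controls both the drift frozen at the left end point and the quadratic
  term, so the increment of \<open>|Y|\<^sup>2\<close> is bounded in terms of the noise increment \<open>\<xi>\<close> alone.\<close>

lemma step_bound:
  fixes Y \<beta> :: "real \<Rightarrow> real^3"
  assumes s: "s \<le> s'" and \<beta>: "continuous_on {s..s'} \<beta>"
    and Y: "Y s' = Y s - integral {s..s'} \<beta> + \<xi>"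
    and B: "\<And>r. r \<in> {s..s'} \<Longrightarrow> norm (\<beta> r) \<le> B" "0 \<le> B"
    and \<kappa>: "\<And>r. r \<in> {s..s'} \<Longrightarrow> \<kappa> \<le> Y r \<bullet> \<beta> r"
    and \<delta>: "\<And>r. r \<in> {s..s'} \<Longrightarrow> norm (Y r - Y s) \<le> \<delta>"
  shows "(norm (Y s'))\<^sup>2 \<le> (norm (Y s + \<xi>))\<^sup>2 - 2 * (\<kappa> - 2 * \<delta> * B) * (s' - s)"
proof -
  define I where "I = integral {s..s'} \<beta>"
  define h where "h = s' - s"
  have int: "\<beta> integrable_on {s..s'}" using \<beta> by (rule integrable_continuous_real)
  have I: "norm I \<le> B * h"
    unfolding I_def h_def using integral_bound[OF s \<beta> B(1)] by simp
  have "\<kappa> - \<delta> * B \<le> Y s \<bullet> \<beta> r" if r: "r \<in> {s..s'}" for r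
  proof -
    have "(Y r - Y s) \<bullet> \<beta> r \<le> norm (Y r - Y s) * norm (\<beta> r)" by (rule norm_cauchy_schwarz)
    also have "\<dots> \<le> \<delta> * B" using \<delta>[OF r] B(1)[OF r] by (intro mult_mono) (auto intro: order_trans[OF norm_ge_zero])
    finally show ?thesis using \<kappa>[OF r] by (simp add: inner_diff_left)
  qed
  then have "integral {s..s'} (\<lambda>r. \<kappa> - \<delta> * B) \<le> integral {s..s'} (\<lambda>r. Y s \<bullet> \<beta> r)"
    using \<beta> by (intro integral_le integrable_continuous_real continuous_intros) auto
  also have "\<dots> = Y s \<bullet> I"
    unfolding I_def using integral_linear[OF int bounded_linear_inner_right[of "Y s"]] by (simp add: o_def)
  finally have YI: "(\<kappa> - \<delta> * B) * h \<le> Y s \<bullet> I" using s by (simp add: h_def mult.commute)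
  define d where "d = Y s' - Y s"
  have d: "d = \<xi> - I" "\<xi> = d + I" using Y by (simp_all add: d_def I_def)
  have nd: "norm d \<le> \<delta>" unfolding d_def using \<delta>[of s'] s by simp
  have "- (d \<bullet> I) \<le> norm d * norm I" using norm_cauchy_schwarz[of "- d" I] by simp
  also have "\<dots> \<le> \<delta> * (B * h)" using nd I by (intro mult_mono) (auto intro: order_trans[OF norm_ge_zero])
  finally have dI: "- (d \<bullet> I) \<le> \<delta> * (B * h)" .
  \<comment> \<open>With \<xi> = d + I, the squares of |Y s + \<xi>| and |Y s'| differ by 2 (Y s .
    I) + 2 (d . I) + |I|^2. The last term is dropped; replacing Y r by Y s and estimating the cross
    term cost \<delta> B each, whence the 2 \<delta> B.\<close>
  have "(norm (Y s + \<xi>))\<^sup>2 = (norm (Y s))\<^sup>2 + 2 * (Y s \<bullet> d) + 2 * (Y s \<bullet> I) + (norm d)\<^sup>2 + 2 * (d \<bullet> I) + (norm I)\<^sup>2"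
    unfolding d(2) power2_norm_eq_inner by (simp add: inner_add_left inner_add_right inner_commute algebra_simps)
  moreover have "(norm (Y s'))\<^sup>2 = (norm (Y s))\<^sup>2 + 2 * (Y s \<bullet> d) + (norm d)\<^sup>2"
  proof -
    have "Y s' = Y s + d" by (simp add: d_def)
    then show ?thesis unfolding power2_norm_eq_inner by (simp add: inner_add_left inner_add_right inner_commute)
  qed
  moreover have "0 \<le> (norm I)\<^sup>2" by simp
  ultimately have "(norm (Y s'))\<^sup>2 \<le> (norm (Y s + \<xi>))\<^sup>2 - 2 * ((\<kappa> - \<delta> * B) * h) + 2 * (\<delta> * (B * h))"
    using YI dI by linarith
  then show ?thesis by (simp add: h_def algebra_simps)
qed

lemma exit_time_le: "0 \<le> q \<Longrightarrow> (X q w, t - q) \<notin> S \<Longrightarrow> exit_time S t X w \<le> ereal q"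
  unfolding exit_time_def by (intro Inf_lower) auto

text \<open>S is open, so a path that is still in S at time r stays there a little longer. The
  strict inequality is what makes the equation available at r.\<close>

lemma exit_time_greater:
  assumes S: "open S" and c: "continuous_on {0..} (\<lambda>s. X s w)" and r: "0 \<le> r"
    and in_S: "\<And>q. q \<in> {0..r} \<Longrightarrow> (X q w, t - q) \<in> S"
  shows "ereal r < exit_time S t X w"
proof -
  have cont: "continuous_on {0..} (\<lambda>q. (X q w, t - q))" by (intro continuous_intros c)
  have "(X r w, t - r) \<in> S" using in_S[of r] r by simp
  then obtain e where e: "0 < e" "ball (X r w, t - r) e \<subseteq> S"
    using S unfolding open_contains_ball by blast
  from cont[unfolded continuous_on_iff, rule_format, of r e] r e(1)
  obtain d where d: "0 < d"
      "\<forall>q\<in>{0..}. dist q r < d \<longrightarrow> dist (X q w, t - q) (X r w, t - r) < e"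
    by auto
  have "ereal (r + d) \<le> exit_time S t X w"
    unfolding exit_time_def
  proof (rule Inf_greatest, clarify)
    fix s assume s: "0 \<le> s" "(X s w, t - s) \<notin> S"
    have "\<not> dist s r < d" using d(2) s subsetD[OF e(2), of "(X s w, t - s)"] by (auto simp: dist_commute)
    moreover have "\<not> s \<le> r" using in_S[of s] s by auto
    ultimately show "ereal (r + d) \<le> ereal s" by (simp add: dist_real_def)
  qed
  then show ?thesis by (rule less_le_trans[rotated]) (use d(1) in simp)
qed

section \<open>The diffusion\<close>

locale screened_diffusion = screening +
  fixes M :: "'w measure" and F :: "real \<Rightarrow> 'w measure" and W X :: "real \<Rightarrow> 'w \<Rightarrow> real^3"
    and x :: "real^3" and t :: real
  assumes xt: "(x, t) \<in> A" and bm: "standard_brownian_motion M F W"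
    and sde: "solves_sde_until_exit M F W \<nu> b A x t X"
begin

sublocale prob_space M
  using bm by (simp add: standard_brownian_motion_def)

lemma filtration: "space (F s) = space M" "sets (F s) \<subseteq> events" "r \<le> s \<Longrightarrow> sets (F r) \<subseteq> sets (F s)"
  using bm filtration.space_F[of "space M" F] filtration.sets_F_mono[of "space M" F]
  by (auto simp: standard_brownian_motion_def)

lemma measurable_F_mono: "f \<in> borel_measurable (F r) \<Longrightarrow> r \<le> s \<Longrightarrow> f \<in> borel_measurable (F s)"
  by (erule measurable_from_subalg[rotated]) (simp add: subalgebra_def filtration(1) filtration(3))

lemma measurable_F_M: "f \<in> borel_measurable (F r) \<Longrightarrow> f \<in> borel_measurable M"
  by (erule measurable_from_subalg[rotated]) (simp add: subalgebra_def filtration(1) filtration(2))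

lemma W_measurable: "0 \<le> s \<Longrightarrow> W s \<in> borel_measurable (F s)"
  and W_0: "w \<in> space M \<Longrightarrow> W 0 w = 0"
  and W_continuous: "w \<in> space M \<Longrightarrow> continuous_on {0..} (\<lambda>s. W s w)"
  and increment_indep: "0 \<le> s \<Longrightarrow> s < r \<Longrightarrow>
    indep_set (sets (F s)) {(\<lambda>w. W r w - W s w) -` B \<inter> space M | B. B \<in> sets borel}"
  using bm by (auto simp: standard_brownian_motion_def)

lemma X_measurable: "0 \<le> q \<Longrightarrow> q \<le> r \<Longrightarrow> X q \<in> borel_measurable (F r)"
  and X_continuous: "w \<in> space M \<Longrightarrow> continuous_on {0..} (\<lambda>s. X s w)"
  and X_sde: "AE w in M. X 0 w = x \<and> (\<forall>s. 0 \<le> s \<and> ereal s < exit_time A t X w \<longrightarrow>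
     X s w = x - integral {0..s} (\<lambda>r. b (X r w, t - r)) + sqrt (2 * \<nu>) *\<^sub>R W s w)"
  using sde measurable_F_mono by (auto simp: solves_sde_until_exit_def)

lemma increment_distr:
  assumes "0 \<le> s" "s < r"
  shows "distr M borel (\<lambda>w. W r w - W s w) = gaussian (sqrt (r - s))"
proof -
  have "distributed M lborel (\<lambda>w. W r w - W s w)
      (\<lambda>y. ennreal (\<Prod>i\<in>UNIV. normal_density 0 (sqrt (r - s)) (y $ i)))"
    using bm assms by (auto simp: standard_brownian_motion_def)
  then have "distr M lborel (\<lambda>w. W r w - W s w) = gaussian (sqrt (r - s))"
    by (simp add: distributed_def gaussian_def)
  moreover have "distr M borel (\<lambda>w. W r w - W s w) = distr M lborel (\<lambda>w. W r w - W s w)"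
    by (rule distr_cong) simp_all
  ultimately show ?thesis by simp
qed

lemma increment_measurable: "0 \<le> s \<Longrightarrow> s \<le> r \<Longrightarrow> (\<lambda>w. W r w - W s w) \<in> borel_measurable M"
  by (intro borel_measurable_diff measurable_F_M[OF W_measurable]) auto

text \<open>Survival on a closed time interval. It depends on the path up to r only, so it is known
  at time r; \<open>inside_exit_time\<close> and \<open>exit_time_inside\<close> link it to the exit
  time.\<close>

definition inside :: "real \<Rightarrow> 'w \<Rightarrow> bool" where
  "inside r w \<longleftrightarrow> (\<forall>q\<in>{0..r}. (X q w, t - q) \<in> A)"

lemma inside_exit_time: "w \<in> space M \<Longrightarrow> 0 \<le> r \<Longrightarrow> inside r w \<Longrightarrow> ereal r < exit_time A t X w"
  using X_continuous by (intro exit_time_greater open_A) (auto simp: inside_def)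

lemma exit_time_inside: "ereal s \<le> exit_time A t X w \<Longrightarrow> r < s \<Longrightarrow> inside r w"
  using exit_time_le[of _ X w t A] unfolding inside_def
  by (metis atLeastAtMost_iff ereal_less_eq(3) le_less_trans not_le order_trans)

text \<open>A compact piece of path lies in the open region exactly when its distance to the
  complement is at least some 1 / (n + 1), which is a countable union of conditions on a continuous
  process.\<close>

lemma sets_inside:
  assumes r: "0 \<le> r"
  shows "{w\<in>space M. inside r w} \<in> sets (F r)"
proof -
  let ?d = "\<lambda>q w. infdist (X q w, t - q) (- A)"
  \<comment> \<open>\<open>infdist\<close> to the empty set is 0, so the complement must have a
    point; the origin is one.\<close>
  have A: "closed (- A)" "- A \<noteq> {}"
    using open_A norm_pos[of 0 t] by auto
  have pos: "p \<in> A \<longleftrightarrow> 0 < infdist p (- A)" for p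
    using in_closed_iff_infdist_zero[OF A, of p] infdist_nonneg[of p "- A"] by auto
  have cont: "continuous_on {0..r} (\<lambda>q. ?d q w)" if "w \<in> space M" for w
    by (intro continuous_on_infdist continuous_on_Pair continuous_on_prefix[OF X_continuous] continuous_intros that) auto
  have "inside r w \<longleftrightarrow> (\<exists>n. \<forall>q\<in>{0..r}. 1 / real (Suc n) \<le> ?d q w)" if w: "w \<in> space M" for w
  proof
    assume "inside r w"
    obtain q0 where q0: "q0 \<in> {0..r}" "\<And>q. q \<in> {0..r} \<Longrightarrow> ?d q0 w \<le> ?d q w"
      using continuous_attains_inf[OF compact_Icc _ cont[OF w]] r by auto
    then have "0 < ?d q0 w" using \<open>inside r w\<close> pos by (auto simp: inside_def)
    then obtain n where "1 / real (Suc n) < ?d q0 w" by (rule nat_approx_posE)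
    then show "\<exists>n. \<forall>q\<in>{0..r}. 1 / real (Suc n) \<le> ?d q w"
      using q0(2) by (meson less_imp_le order_trans)
  next
    assume "\<exists>n. \<forall>q\<in>{0..r}. 1 / real (Suc n) \<le> ?d q w"
    then obtain n where n: "\<And>q. q \<in> {0..r} \<Longrightarrow> 1 / real (Suc n) \<le> ?d q w" by blast
    have "0 < 1 / real (Suc n)" by simp
    from less_le_trans[OF this n] show "inside r w" unfolding inside_def pos by blast
  qed
  then have "{w\<in>space M. inside r w} =
      (\<Union>n. {w\<in>space (F r). \<forall>q\<in>{0..r}. 1 / real (Suc n) \<le> ?d q w})"
    by (auto simp: filtration(1))
  also have "\<dots> \<in> sets (F r)"
  proof (rule sets.countable_UN, clarify)
    fix n show "{w\<in>space (F r). \<forall>q\<in>{0..r}. 1 / real (Suc n) \<le> ?d q w} \<in> sets (F r)"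
    proof (rule sets_all_interval[OF r])
      show "?d q \<in> borel_measurable (F r)" if "q \<in> {0..r}" for q
      proof -
        have 1: "(\<lambda>w. (X q w, t - q)) \<in> borel_measurable (F r)"
          using that by (intro borel_measurable_Pair X_measurable borel_measurable_const) auto
        have 2: "(\<lambda>p. infdist p (- A)) \<in> borel_measurable borel"
          by (intro borel_measurable_continuous_onI continuous_on_infdist continuous_on_id)
        show ?thesis by (rule measurable_compose[OF 1 2])
      qed
      show "continuous_on {0..r} (\<lambda>q. ?d q w)" if "w \<in> space (F r)" for w
        using cont that by (simp add: filtration(1))
    qed
  qed
  finally show ?thesis .
qed

text \<open>On these paths the one-step bound is deterministic, and the event is known at the start of the next step.\<close>

definition tame :: "real \<Rightarrow> real \<Rightarrow> nat \<Rightarrow> 'w set" where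
  "tame h \<delta> n = {w\<in>space M. inside (real n * h) w} \<inter>
     {w\<in>space M. \<forall>j<n. \<forall>q\<in>{real j * h..real (Suc j) * h}. norm (X q w - X (real j * h) w) \<le> \<delta>}"

lemma sets_tame:
  assumes h: "0 \<le> h"
  shows "tame h \<delta> n \<in> sets (F (real n * h))"
proof -
  let ?N = "F (real n * h)"
  have one: "{w\<in>space ?N. \<forall>q\<in>{real j * h..real (Suc j) * h}. - \<delta> \<le> - norm (X q w - X (real j * h) w)} \<in> sets ?N"
    if j: "j \<in> {..<n}" for j
  proof (rule sets_all_interval)
    have le: "real (Suc j) * h \<le> real n * h" using j h by (intro mult_right_mono) auto
    show "real j * h \<le> real (Suc j) * h" using h by (intro mult_right_mono) auto
    then have j0: "0 \<le> real j * h" "real j * h \<le> real n * h" using h le by auto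
    show "(\<lambda>w. - norm (X q w - X (real j * h) w)) \<in> borel_measurable ?N"
      if "q \<in> {real j * h..real (Suc j) * h}" for q
      using that j0 le by (intro borel_measurable_uminus measurable_compose[OF _ borel_measurable_norm]
          borel_measurable_diff X_measurable) auto
    show "continuous_on {real j * h..real (Suc j) * h} (\<lambda>q. - norm (X q w - X (real j * h) w))"
      if "w \<in> space ?N" for w
      using that j0 by (intro continuous_intros continuous_on_prefix X_continuous) (auto simp: filtration(1))
  qed
  have "{w\<in>space ?N. \<forall>j\<in>{..<n}. \<forall>q\<in>{real j * h..real (Suc j) * h}. - \<delta> \<le> - norm (X q w - X (real j * h) w)} \<in> sets ?N"
    by (rule sets.sets_Collect_finite_All[OF one]) simp_all
  then have "{w\<in>space M. \<forall>j<n. \<forall>q\<in>{real j * h..real (Suc j) * h}. norm (X q w - X (real j * h) w) \<le> \<delta>} \<in> sets ?N"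
    by (simp only: filtration(1) neg_le_iff_le lessThan_iff Ball_def)
  moreover have "{w\<in>space M. inside (real n * h) w} \<in> sets ?N"
    using h by (intro sets_inside) simp
  ultimately show ?thesis
    unfolding tame_def by (rule sets.Int[rotated])
qed

lemma tame_Suc: "0 \<le> h \<Longrightarrow> w \<in> tame h \<delta> (Suc n) \<Longrightarrow> w \<in> tame h \<delta> n"
proof -
  assume h: "0 \<le> h" and w: "w \<in> tame h \<delta> (Suc n)"
  have "real n * h \<le> real (Suc n) * h" using h by (intro mult_right_mono) auto
  then show ?thesis using w by (auto simp: tame_def inside_def)
qed

section \<open>The equation along paths that stay in the region\<close>

lemma drift_path_continuous:
  assumes "w \<in> space M" "0 \<le> a" "inside c w"
  shows "continuous_on {a..c} (\<lambda>r. b (X r w, t - r))"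
  using assms by (intro continuous_on_compose2[OF continuous_on_drift] continuous_intros continuous_on_prefix X_continuous)
    (auto simp: inside_def)

lemma sde_increment:
  assumes w: "w \<in> space M"
    and eq: "\<forall>s. 0 \<le> s \<and> ereal s < exit_time A t X w \<longrightarrow>
     X s w = x - integral {0..s} (\<lambda>r. b (X r w, t - r)) + sqrt (2 * \<nu>) *\<^sub>R W s w"
    and s: "0 \<le> s" "s \<le> s'" and ins: "inside s' w"
  shows "X s' w = X s w - integral {s..s'} (\<lambda>r. b (X r w, t - r)) + sqrt (2 * \<nu>) *\<^sub>R (W s' w - W s w)"
proof -
  have "inside s w" using ins s by (auto simp: inside_def)
  then have "ereal s < exit_time A t X w" "ereal s' < exit_time A t X w"
    using inside_exit_time w s ins by auto
  then have X: "X s w = x - integral {0..s} (\<lambda>r. b (X r w, t - r)) + sqrt (2 * \<nu>) *\<^sub>R W s w"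
      "X s' w = x - integral {0..s'} (\<lambda>r. b (X r w, t - r)) + sqrt (2 * \<nu>) *\<^sub>R W s' w"
    using eq s by auto
  have "integral {0..s} (\<lambda>r. b (X r w, t - r)) + integral {s..s'} (\<lambda>r. b (X r w, t - r))
      = integral {0..s'} (\<lambda>r. b (X r w, t - r))"
    using s by (intro Henstock_Kurzweil_Integration.integral_combine integrable_continuous_real
        drift_path_continuous w ins) auto
  then show ?thesis unfolding X by (simp add: scaleR_diff_right algebra_simps)
qed

text \<open>Paths in the region keep the distance m from the origin, which bounds the drift and
  keeps the argument of \<open>lower_gamma\<close> away from 0. The strict s' < t - t0 places the
  compact interval of times inside (t0, T), where \<open>l\<close> is continuous and
  positive.\<close>

lemma l_lower_bound:
  assumes "0 \<le> s'" "s' < t - t0"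
  obtains m where "0 < m" "\<And>q. q \<in> {0..s'} \<Longrightarrow> m \<le> l (t - q)"
proof -
  have t: "t < T" using xt by (auto simp: region_def)
  have sub: "{t - s'..t} \<subseteq> {t0<..<T}" using assms t by auto
  then have "continuous_on {t - s'..t} l" using basic(5) by (rule continuous_on_subset[rotated])
  moreover have "{t - s'..t} \<noteq> {}" using assms by simp
  ultimately obtain r where r: "r \<in> {t - s'..t}" "\<forall>r'\<in>{t - s'..t}. l r \<le> l r'"
    using continuous_attains_inf[OF compact_Icc] by blast
  have "0 < l r" using setting r sub by (auto simp: annular_setting_def)
  then show thesis
  proof (rule that)
    fix q assume "q \<in> {0..s'}"
    then show "l r \<le> l (t - q)" using r(2) by simp
  qed
qed


text \<open>The quantity followed along the grid is the expectation, over the tame paths, of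
  \<open>lower_gamma\<close> (k' / 2) at |X|^2 / (4 \<nu> T), where T is the remaining time plus
  \<theta>. It grows by at most a constant times h^(3/2) per step, hence by O(sqrt h) over n = s' /
  h steps; at the end |X| \<ge> m bounds it from below.\<close>

lemma tame_probability_le:
  assumes k': "0 < k'" "k' < k" and s': "0 < s'" and \<theta>: "0 < \<theta>"
    and m: "0 < m" "\<And>q. q \<in> {0..s'} \<Longrightarrow> m \<le> l (t - q)"
    and B: "0 < B" "\<nu> * (Cu / \<nu> + 4 + 2 * C\<Phi>) / m \<le> B"
    and \<delta>: "2 * \<delta> * B \<le> (k - k') * \<nu>"
  shows "\<exists>C. \<forall>n. 0 < n \<and> s' \<le> real n \<longrightarrow>
    prob (tame (s' / real n) \<delta> n) * lower_gamma (k' / 2) (m\<^sup>2 / (4 * \<nu> * \<theta>)) \<le>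
      lower_gamma (k' / 2) ((norm x)\<^sup>2 / (4 * \<nu> * (s' + \<theta>))) + C * sqrt (s' / real n)"
proof -
  have \<nu>: "0 < \<nu>" by (rule basic(1))
  define f where "f = lower_gamma (k' / 2)"
  define c where "c = m\<^sup>2 / (8 * \<nu> * (s' + \<theta>))"
  have k'3: "k' < 3" using k k' by simp
  have S: "0 < s' + \<theta>" using s' \<theta> by simp
  obtain C where C: "0 \<le> C" and step: "\<forall>x h T. m \<le> norm x \<longrightarrow> norm x \<le> R0 \<longrightarrow> 0 < h \<longrightarrow> h \<le> 1 \<longrightarrow> \<theta> \<le> T - h \<longrightarrow> T \<le> s' + \<theta> \<longrightarrow>
    (\<integral>n. f (max (((norm (x + sqrt (2 * \<nu> * h) *\<^sub>R n))\<^sup>2 - 2 * (k' + 1) * \<nu> * h) / (4 * \<nu> * (T - h))) c)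
       \<partial>gaussian 1) \<le> f ((norm x)\<^sup>2 / (4 * \<nu> * T)) + C * (h * sqrt h)"
    using gaussian_step[OF k'(1) k'3 \<nu> basic(4) m(1) \<theta> S, folded f_def c_def] by (elim exE conjE) (rule that)
  have f: "0 \<le> f y" "f y \<le> 1" "y \<le> z \<Longrightarrow> f y \<le> f z" for y z
    using k' by (auto simp: f_def lower_gamma_nonneg lower_gamma_le_1 lower_gamma_mono)
  have "mono (\<lambda>z. f (max z c))" by (auto intro!: monoI f(3))
  then have fm[measurable]: "(\<lambda>z. f (max z c)) \<in> borel_measurable borel" by (rule borel_measurable_mono)
  show ?thesis
  proof (intro exI[of _ "s' * C"] allI impI)
    fix n :: nat assume n: "0 < n \<and> s' \<le> real n"
    define h where "h = s' / real n"
    have h: "0 < h" "h \<le> 1" "real n * h = s'" using n s' by (auto simp: h_def)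
    define Tm where "Tm i = s' + \<theta> - real i * h" for i
    \<comment> \<open>On tame paths the clamp is inactive, see \<open>unclamp\<close>. It is there
      because the comparison step, a free Gaussian move, may reach any point.\<close>
    define Q where "Q i w = f (max ((norm (X (real i * h) w))\<^sup>2 / (4 * \<nu> * Tm i)) c)" for i w
    define P where "P i = (\<integral>w. indicator (tame h \<delta> i) w * Q i w \<partial>M)" for i
    have Tm: "\<theta> \<le> Tm i" "Tm i \<le> s' + \<theta>" "0 < Tm i" if "i \<le> n" for i
    proof -
      have "real i * h \<le> real n * h" using that h by (intro mult_right_mono) auto
      then show "\<theta> \<le> Tm i" using h by (simp add: Tm_def)
      then show "0 < Tm i" using \<theta> by simp
    qed (use h in \<open>auto simp: Tm_def\<close>)
    have ih: "0 \<le> real i * h" for i using h by simp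
    have tame_M[measurable]: "tame h \<delta> i \<in> events" for i
      using sets_tame[of h \<delta> i] h filtration(2) by auto
    have X_M[measurable]: "X (real i * h) \<in> borel_measurable M" for i
      using measurable_F_M[OF X_measurable[OF ih order_refl]] .
    have Q_meas[measurable]: "Q i \<in> borel_measurable M" for i
      unfolding Q_def[abs_def] by measurable
    have Q: "0 \<le> Q i w" "Q i w \<le> 1" for i w by (auto simp: Q_def f)
    have int: "integrable M (\<lambda>w. indicator (tame h \<delta> i) w * Q i w)" for i
      by (intro integrable_const_bound[of _ 1]) (auto simp: Q indicator_def)
    have in_A: "(X (real i * h) w, t - real i * h) \<in> A" if "w \<in> tame h \<delta> i" for i w
      using that ih[of i] by (auto simp: tame_def inside_def)
    have X_bounds: "m \<le> norm (X (real i * h) w)" "norm (X (real i * h) w) \<le> R0"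
      if "w \<in> tame h \<delta> i" "i \<le> n" for i w
    proof -
      have "real i * h \<le> real n * h" using that h by (intro mult_right_mono) auto
      then have "m \<le> l (t - real i * h)" using m(2)[of "real i * h"] ih[of i] h by simp
      then show "m \<le> norm (X (real i * h) w)" "norm (X (real i * h) w) \<le> R0"
        using in_A[OF that(1)] by (auto simp: region_def)
    qed
    have unclamp: "f (max (r\<^sup>2 / (4 * \<nu> * Tm i)) c) = f (r\<^sup>2 / (4 * \<nu> * Tm i))" if "i \<le> n" "m \<le> r" for i r
    proof -
      have "c \<le> m\<^sup>2 / (4 * \<nu> * (s' + \<theta>))"
        unfolding c_def using \<nu> S by (intro frac_le mult_right_mono) auto
      also have "\<dots> \<le> r\<^sup>2 / (4 * \<nu> * Tm i)"
        using that m(1) \<nu> Tm[OF that(1)] by (intro frac_le power_mono mult_left_mono) auto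
      finally show ?thesis by (simp add: max_def)
    qed
    have P_step: "P (Suc i) \<le> P i + C * (h * sqrt h)" if i: "i < n" for i
    proof -
      let ?s = "real i * h" and ?s' = "real (Suc i) * h"
      have ss: "0 \<le> ?s" "?s < ?s'" "?s' - ?s = h" "?s' \<le> s'"
      proof -
        have "?s' \<le> real n * h" using i h by (intro mult_right_mono) auto
        then show "?s' \<le> s'" using h by simp
      qed (use h in \<open>auto simp: algebra_simps\<close>)
      have TT: "Tm (Suc i) = Tm i - h" "\<theta> \<le> Tm i - h" "0 < Tm i - h"
        using Tm[of "Suc i"] i by (auto simp: Tm_def algebra_simps)
      define D where "D w = W ?s' w - W ?s w" for w
      \<comment> \<open>The event enters as a real coordinate, so that event and position form one
        variable known at time \<open>?s\<close>; the factor \<open>indicator {1}\<close> in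
        \<open>H\<close> decodes it.\<close>
      define Z where "Z w = (indicator (tame h \<delta> i) w :: real, X ?s w)" for w
      define H where "H p = indicator {1} (fst (fst p)) *
        f (max (((norm (snd (fst p) + sqrt (2 * \<nu>) *\<^sub>R snd p))\<^sup>2 - 2 * (k' + 1) * \<nu> * h) / (4 * \<nu> * (Tm i - h))) c)"
        for p :: "(real \<times> (real^3)) \<times> (real^3)"
      have H_meas: "H \<in> borel_measurable (borel \<Otimes>\<^sub>M borel)"
      proof -
        have "(\<lambda>p. ((norm (snd (fst p) + sqrt (2 * \<nu>) *\<^sub>R snd p))\<^sup>2 - 2 * (k' + 1) * \<nu> * h) / (4 * \<nu> * (Tm i - h)))
            \<in> borel_measurable ((borel \<Otimes>\<^sub>M borel) \<Otimes>\<^sub>M (borel :: (real^3) measure))"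
          by measurable
        from measurable_compose[OF this fm]
        have "H \<in> borel_measurable ((borel \<Otimes>\<^sub>M borel) \<Otimes>\<^sub>M borel)"
          unfolding H_def[abs_def] by (intro borel_measurable_times) measurable
        then show ?thesis by (simp add: borel_prod)
      qed
      have H: "0 \<le> H p" "H p \<le> 1" for p by (auto simp: H_def f indicator_def)
      have Z_meas: "Z \<in> borel_measurable (F ?s)"
        unfolding Z_def[abs_def] using sets_tame[of h \<delta> i] h
        by (intro borel_measurable_Pair X_measurable borel_measurable_indicator ss(1)) auto
      have D_meas: "D \<in> borel_measurable M"
        unfolding D_def[abs_def] using ss by (intro increment_measurable) auto
      have D_distr: "distr M borel D = distr (gaussian 1) borel (\<lambda>y. sqrt h *\<^sub>R y)"
        unfolding D_def[abs_def] increment_distr[OF ss(1,2)] ss(3) using h by (intro gaussian_scale) auto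
      define J where "J w = (\<integral>y. H (Z w, sqrt h *\<^sub>R y) \<partial>gaussian 1)" for w
      \<comment> \<open>Pathwise domination: on a tame path |X|^2 after the step is at most the
        square after the free Gaussian move minus 2 (k' + 1) \<nu> h, and f is increasing.\<close>
      have "AE w in M. indicator (tame h \<delta> (Suc i)) w * Q (Suc i) w \<le> H (Z w, D w)"
        using X_sde AE_space
      proof eventually_elim
        case (elim w)
        show ?case
        proof (cases "w \<in> tame h \<delta> (Suc i)")
          case True
          have ti: "w \<in> tame h \<delta> i" using tame_Suc True h by auto
          have ins: "inside ?s' w" using True by (simp add: tame_def)
          let ?\<beta> = "\<lambda>r. b (X r w, t - r)"
          have rA: "(X r w, t - r) \<in> A" "m \<le> norm (X r w)" if "r \<in> {?s..?s'}" for r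
          proof -
            have a: "?s \<le> r" "r \<le> ?s'" using that by (simp_all only: atLeastAtMost_iff)
            have r: "0 \<le> r" "r \<le> s'" using ss(1,4) a by linarith+
            show rA: "(X r w, t - r) \<in> A"
              using ins[unfolded inside_def, THEN bspec, of r] a(2) r(1) by (simp only: atLeastAtMost_iff)
            show "m \<le> norm (X r w)" using rA m(2)[of r] r by (simp add: region_def)
          qed
          have "(norm (X ?s' w))\<^sup>2 \<le> (norm (X ?s w + sqrt (2 * \<nu>) *\<^sub>R D w))\<^sup>2 - 2 * ((k + 1) * \<nu> - 2 * \<delta> * B) * (?s' - ?s)"
          proof (rule step_bound[where \<beta> = ?\<beta>])
            show "continuous_on {?s..?s'} ?\<beta>" using elim ss ins by (intro drift_path_continuous) auto
            show "X ?s' w = X ?s w - integral {?s..?s'} ?\<beta> + sqrt (2 * \<nu>) *\<^sub>R D w"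
              unfolding D_def using elim ss ins by (intro sde_increment) auto
            show "norm (?\<beta> r) \<le> B" if r: "r \<in> {?s..?s'}" for r
            proof -
              have "norm (?\<beta> r) \<le> \<nu> * (Cu / \<nu> + 4 + 2 * C\<Phi>) / norm (X r w)"
                by (rule drift_norm[OF rA(1)[OF r]])
              moreover have "0 \<le> \<nu> * (Cu / \<nu> + 4 + 2 * C\<Phi>)"
                using calculation norm_pos[OF rA(1)[OF r]] norm_ge_zero[of "?\<beta> r"]
                by (metis order_trans zero_le_divide_iff not_le less_imp_le)
              ultimately show ?thesis
                using B(2) rA(2)[OF r] m(1) by (meson divide_left_mono order_trans mult_pos_pos less_le_trans)
            qed
            show "(k + 1) * \<nu> \<le> X r w \<bullet> ?\<beta> r" if "r \<in> {?s..?s'}" for r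
              by (rule drift_inner[OF rA(1)[OF that]])
            show "norm (X r w - X ?s w) \<le> \<delta>" if "r \<in> {?s..?s'}" for r
              using True that by (auto simp: tame_def)
          qed (use ss B in auto)
          \<comment> \<open>The oscillation error 2 \<delta> B uses up at most the gap (k - k')
            \<nu>.\<close>
          also have "\<dots> \<le> (norm (X ?s w + sqrt (2 * \<nu>) *\<^sub>R D w))\<^sup>2 - 2 * ((k' + 1) * \<nu>) * h"
          proof -
            have "(k' + 1) * \<nu> \<le> (k + 1) * \<nu> - 2 * \<delta> * B" using \<delta> by (simp add: algebra_simps)
            then have "(k' + 1) * \<nu> * h \<le> ((k + 1) * \<nu> - 2 * \<delta> * B) * h" using h by (intro mult_right_mono) auto
            then show ?thesis unfolding ss(3) by (simp add: algebra_simps)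
          qed
          finally have "(norm (X ?s' w))\<^sup>2 / (4 * \<nu> * (Tm i - h)) \<le>
              ((norm (X ?s w + sqrt (2 * \<nu>) *\<^sub>R D w))\<^sup>2 - 2 * (k' + 1) * \<nu> * h) / (4 * \<nu> * (Tm i - h))"
            using \<nu> TT by (intro divide_right_mono) (simp_all add: algebra_simps)
          then have "Q (Suc i) w \<le> f (max (((norm (X ?s w + sqrt (2 * \<nu>) *\<^sub>R D w))\<^sup>2 - 2 * (k' + 1) * \<nu> * h) / (4 * \<nu> * (Tm i - h))) c)"
            unfolding Q_def TT(1) by (intro f(3) max.mono) auto
          then show ?thesis using True ti by (simp add: H_def Z_def)
        qed (simp add: H)
      qed
      then have "P (Suc i) \<le> (\<integral>w. H (Z w, D w) \<partial>M)"
        unfolding P_def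
      proof (intro integral_mono_AE int)
        show "integrable M (\<lambda>w. H (Z w, D w))"
          using measurable_F_M[OF Z_meas] D_meas
          by (intro integrable_const_bound[of _ 1] measurable_compose[OF measurable_Pair H_meas])
            (auto simp: H)
      qed
      also have "\<dots> = (\<integral>w. (\<integral>y. H (Z w, y) \<partial>distr M borel D) \<partial>M)"
        by (rule integral_indep_pair[OF filtration(2,1) Z_meas D_meas _ H_meas, of 1])
          (use increment_indep[OF ss(1,2)] H in \<open>auto simp: D_def[abs_def]\<close>)
      also have "\<dots> = (\<integral>w. J w \<partial>M)"
      proof (rule Bochner_Integration.integral_cong[OF refl])
        fix w
        show "(\<integral>y. H (Z w, y) \<partial>distr M borel D) = J w"
          unfolding D_distr J_def by (rule integral_distr) (auto intro!: measurable_compose[OF _ H_meas])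
      qed
      also have "\<dots> \<le> (\<integral>w. indicator (tame h \<delta> i) w * Q i w + C * (h * sqrt h) \<partial>M)"
      proof (rule integral_mono_AE)
        have "J \<in> borel_measurable M"
          unfolding J_def[abs_def]
        proof (rule gaussian.borel_measurable_lebesgue_integral)
          have "(\<lambda>p. ((Z (fst p)), sqrt h *\<^sub>R snd p)) \<in> (M \<Otimes>\<^sub>M gaussian 1) \<rightarrow>\<^sub>M (borel \<Otimes>\<^sub>M borel)"
            by (intro measurable_Pair measurable_compose[OF measurable_fst measurable_F_M[OF Z_meas]] borel_measurable_scaleR)
              (auto intro: measurable_snd'')
          from measurable_compose[OF this H_meas]
          show "(\<lambda>(w, y). H (Z w, sqrt h *\<^sub>R y)) \<in> borel_measurable (M \<Otimes>\<^sub>M gaussian 1)"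
            by (simp add: case_prod_beta)
        qed
        moreover have "\<bar>J w\<bar> \<le> 1" for w
        proof -
          have i: "integrable (gaussian 1) (\<lambda>y. H (Z w, sqrt h *\<^sub>R y))"
            by (intro gaussian.integrable_const_bound[of _ 1] measurable_compose[OF _ H_meas]) (auto simp: H)
          have "0 \<le> J w" unfolding J_def by (intro integral_nonneg_AE) (auto simp: H)
          moreover have "J w \<le> 1"
            unfolding J_def by (rule gaussian.integral_le_const[OF i]) (auto simp: H)
          ultimately show ?thesis by simp
        qed
        ultimately show "integrable M J"
          by (intro integrable_const_bound[of _ 1]) auto
        show "integrable M (\<lambda>w. indicator (tame h \<delta> i) w * Q i w + C * (h * sqrt h))"
          by (intro Bochner_Integration.integrable_add int) auto
        show "AE w in M. J w \<le> indicator (tame h \<delta> i) w * Q i w + C * (h * sqrt h)"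
        proof (rule AE_I2)
          fix w assume "w \<in> space M"
          show "J w \<le> indicator (tame h \<delta> i) w * Q i w + C * (h * sqrt h)"
          proof (cases "w \<in> tame h \<delta> i")
            case True
            have sq: "sqrt (2 * \<nu> * h) = sqrt (2 * \<nu>) * sqrt h" by (rule real_sqrt_mult)
            have "J w =
              (\<integral>y. f (max (((norm (X ?s w + sqrt (2 * \<nu> * h) *\<^sub>R y))\<^sup>2 - 2 * (k' + 1) * \<nu> * h) / (4 * \<nu> * (Tm i - h))) c) \<partial>gaussian 1)"
              using True by (simp add: J_def H_def Z_def sq)
            also have "\<dots> \<le> f ((norm (X ?s w))\<^sup>2 / (4 * \<nu> * Tm i)) + C * (h * sqrt h)"
              using step X_bounds[OF True] h TT(2) Tm(2)[of i] i by auto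
            also have "\<dots> = Q i w + C * (h * sqrt h)"
              unfolding Q_def using X_bounds[OF True] i by (simp add: unclamp)
            finally show ?thesis using True by simp
          qed (use C h in \<open>simp add: J_def H_def Z_def\<close>)
        qed
      qed
      also have "\<dots> = P i + C * (h * sqrt h)"
        unfolding P_def using int by (simp add: prob_space)
      finally show ?thesis .
    qed
    have P_n: "P i \<le> P 0 + real i * (C * (h * sqrt h))" if "i \<le> n" for i
      using that
    proof (induction i)
      case (Suc i)
      then show ?case using P_step[of i] by (simp add: algebra_simps)
    qed simp
    have "P 0 \<le> f ((norm x)\<^sup>2 / (4 * \<nu> * (s' + \<theta>)))"
      unfolding P_def
    proof (rule integral_le_const[OF int])
      have xm: "m \<le> norm x" using xt m(2)[of 0] s' by (auto simp: region_def)
      show "AE w in M. indicator (tame h \<delta> 0) w * Q 0 w \<le> f ((norm x)\<^sup>2 / (4 * \<nu> * (s' + \<theta>)))"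
        using X_sde
      proof eventually_elim
        case (elim w)
        then show ?case using unclamp[of 0 "norm x"] xm by (auto simp: Q_def Tm_def f indicator_def)
      qed
    qed
    moreover have "prob (tame h \<delta> n) * f (m\<^sup>2 / (4 * \<nu> * \<theta>)) \<le> P n"
    proof -
      have "prob (tame h \<delta> n) * f (m\<^sup>2 / (4 * \<nu> * \<theta>)) = (\<integral>w. indicator (tame h \<delta> n) w * f (m\<^sup>2 / (4 * \<nu> * \<theta>)) \<partial>M)"
        by simp
      also have "\<dots> \<le> P n"
        unfolding P_def
      proof (intro integral_mono int)
        show "integrable M (\<lambda>w. indicator (tame h \<delta> n) w * f (m\<^sup>2 / (4 * \<nu> * \<theta>)))"
          by (intro integrable_const_bound[of _ 1]) (auto simp: f indicator_def)
        show "indicator (tame h \<delta> n) w * f (m\<^sup>2 / (4 * \<nu> * \<theta>)) \<le> indicator (tame h \<delta> n) w * Q n w" for w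
        proof (cases "w \<in> tame h \<delta> n")
          case True
          have "m\<^sup>2 / (4 * \<nu> * \<theta>) \<le> (norm (X (real n * h) w))\<^sup>2 / (4 * \<nu> * \<theta>)"
            using X_bounds[OF True] m(1) \<nu> \<theta> by (intro divide_right_mono power_mono) auto
          then show ?thesis using True h by (auto simp: Q_def Tm_def intro!: f(3))
        qed simp
      qed
      finally show ?thesis .
    qed
    ultimately have "prob (tame h \<delta> n) * f (m\<^sup>2 / (4 * \<nu> * \<theta>)) \<le>
        f ((norm x)\<^sup>2 / (4 * \<nu> * (s' + \<theta>))) + real n * (C * (h * sqrt h))"
      using P_n[of n] by simp
    also have "real n * (C * (h * sqrt h)) = s' * C * sqrt h"
      using h(3) by (metis mult.assoc mult.commute)
    finally show "prob (tame (s' / real n) \<delta> n) * lower_gamma (k' / 2) (m\<^sup>2 / (4 * \<nu> * \<theta>)) \<le>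
      lower_gamma (k' / 2) ((norm x)\<^sup>2 / (4 * \<nu> * (s' + \<theta>))) + s' * C * sqrt (s' / real n)"
      by (simp add: f_def h_def)
  qed
qed


text \<open>A path is uniformly continuous on [0, s], so its oscillation over one step is below
  \<delta> once the grid is fine. How fine depends on the path, so tameness holds eventually and not
  uniformly.\<close>

lemma eventually_tame:
  assumes w: "w \<in> space M" and s: "0 < s" and ins: "inside s w" and \<delta>: "0 < \<delta>"
  shows "\<forall>\<^sub>F n in sequentially. w \<in> tame (s / real n) \<delta> n"
proof -
  have "uniformly_continuous_on {0..s} (\<lambda>q. X q w)"
    by (intro compact_uniformly_continuous continuous_on_prefix X_continuous w) auto
  then obtain d where d: "0 < d"
      "\<And>q q'. q \<in> {0..s} \<Longrightarrow> q' \<in> {0..s} \<Longrightarrow> dist q' q < d \<Longrightarrow> dist (X q' w) (X q w) < \<delta>"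
    using \<delta> unfolding uniformly_continuous_on_def by meson
  have "(\<lambda>n. s / real n) \<longlonglongrightarrow> 0" by (rule lim_const_over_n)
  then have "\<forall>\<^sub>F n in sequentially. s / real n < d" using d(1) by (rule order_tendstoD)
  then show ?thesis
    using eventually_gt_at_top[of 0]
  proof eventually_elim
    case (elim n)
    define h where "h = s / real n"
    have h: "0 < h" "h < d" "real n * h = s" using elim s by (auto simp: h_def)
    have "norm (X q w - X (real j * h) w) \<le> \<delta>" if j: "j < n" and q: "q \<in> {real j * h..real (Suc j) * h}" for j q
    proof -
      define g where "g = real j * h"
      have "real (Suc j) * h \<le> real n * h" using j h by (intro mult_right_mono) auto
      then have g: "0 \<le> g" "g + h \<le> s" "g \<le> q" "q \<le> g + h"
        using q h by (auto simp: g_def algebra_simps)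
      have "dist (X q w) (X g w) < \<delta>"
        using g h(1,2) by (intro d(2)) (auto simp: dist_real_def)
      then show ?thesis by (simp add: dist_norm g_def)
    qed
    then have "w \<in> tame h \<delta> n" using w ins h by (auto simp: tame_def)
    then show ?case by (simp add: h_def)
  qed
qed

text \<open>Two limits in succession: the grid is refined for a fixed \<theta>, and then \<theta>
  tends to 0, where the factor beside the probability tends to 1.\<close>

lemma prob_inside_le:
  assumes E: "\<And>w. w \<in> E \<Longrightarrow> w \<in> space M \<and> inside s w"
    and k': "0 < k'" "k' < k" and s: "0 < s" "s < t - t0"
  shows "prob E \<le> 1 / Gamma (k' / 2 + 1) * ((norm x)\<^sup>2 / (4 * \<nu> * s)) powr (k' / 2)"
proof -
  have \<nu>: "0 < \<nu>" by (rule basic(1))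
  obtain m where m: "0 < m" "\<And>q. q \<in> {0..s} \<Longrightarrow> m \<le> l (t - q)"
    using l_lower_bound[of s] s by auto
  define B where "B = max 1 (\<nu> * (Cu / \<nu> + 4 + 2 * C\<Phi>) / m)"
  have B: "0 < B" "\<nu> * (Cu / \<nu> + 4 + 2 * C\<Phi>) / m \<le> B" by (auto simp: B_def)
  \<comment> \<open>Meets the requirement of \<open>tame_probability_le\<close> with equality; the
    maximum with 1 in B makes the division safe.\<close>
  define \<delta> where "\<delta> = (k - k') * \<nu> / (2 * B)"
  have \<delta>: "0 < \<delta>" "2 * \<delta> * B \<le> (k - k') * \<nu>" using k' \<nu> B(1) by (auto simp: \<delta>_def)
  define f where "f = lower_gamma (k' / 2)"
  have a: "0 < k' / 2" using k' by simp
  define R where "R = 1 / Gamma (k' / 2 + 1) * ((norm x)\<^sup>2 / (4 * \<nu> * s)) powr (k' / 2)"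
  have G: "0 < Gamma (k' / 2 + 1)" using a by (intro Gamma_real_pos) simp
  have R0: "0 \<le> R" using G by (simp add: R_def)
  have main: "prob E * f (real n0) \<le> R" if n0: "0 < n0" for n0 :: nat
  proof (cases "f (real n0) = 0")
    case False
    then have f0: "0 < f (real n0)" using lower_gamma_nonneg[OF a, of "real n0"] by (simp add: f_def)
    \<comment> \<open>Makes the factor beside the probability equal to f at n0, so that large n0
      means small \<theta>.\<close>
    define \<theta> where "\<theta> = m\<^sup>2 / (4 * \<nu> * real n0)"
    have \<theta>: "0 < \<theta>" "m\<^sup>2 / (4 * \<nu> * \<theta>) = real n0" using m \<nu> n0 by (auto simp: \<theta>_def)
    obtain C where C: "\<And>n. 0 < n \<Longrightarrow> s \<le> real n \<Longrightarrow>
        prob (tame (s / real n) \<delta> n) * f (real n0) \<le> f ((norm x)\<^sup>2 / (4 * \<nu> * (s + \<theta>))) + C * sqrt (s / real n)"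
      using tame_probability_le[OF k' s(1) \<theta>(1) m B \<delta>(2)] unfolding \<theta>(2) f_def by blast
    have fR: "f ((norm x)\<^sup>2 / (4 * \<nu> * (s + \<theta>))) \<le> R"
    proof -
      have "f ((norm x)\<^sup>2 / (4 * \<nu> * (s + \<theta>))) \<le> 1 / Gamma (k' / 2 + 1) * ((norm x)\<^sup>2 / (4 * \<nu> * (s + \<theta>))) powr (k' / 2)"
        unfolding f_def using \<nu> s \<theta> by (intro lower_gamma_le_powr a) auto
      also have "\<dots> \<le> R"
        unfolding R_def using \<nu> s \<theta> G a
        by (intro mult_left_mono powr_mono2 frac_le) auto
      finally show ?thesis .
    qed
    have "prob E \<le> (R + C * 0) / f (real n0)"
    proof (rule measure_le_of_eventually)
      show "tame (s / real n) \<delta> n \<in> events" for n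
        using sets_tame[of "s / real n" \<delta> n] s filtration(2) by auto
      show "AE w in M. w \<in> E \<longrightarrow> (\<forall>\<^sub>F n in sequentially. w \<in> tame (s / real n) \<delta> n)"
        using E eventually_tame s \<delta> by (intro AE_I2) auto
      show "\<forall>\<^sub>F n in sequentially. prob (tame (s / real n) \<delta> n) \<le> (R + C * sqrt (s / real n)) / f (real n0)"
        using eventually_gt_at_top[of 0] eventually_ge_at_top[of "nat \<lceil>s\<rceil>"]
      proof eventually_elim
        case (elim n)
        then have "s \<le> real n" by (simp add: nat_le_iff ceiling_le_iff)
        from C[OF elim(1) this] fR f0 show ?case by (simp add: pos_le_divide_eq)
      qed
      have "(\<lambda>n. s / real n) \<longlonglongrightarrow> 0" by (rule lim_const_over_n)
      then have "(\<lambda>n. sqrt (s / real n)) \<longlonglongrightarrow> sqrt 0" by (rule tendsto_real_sqrt)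
      then have "(\<lambda>n. sqrt (s / real n)) \<longlonglongrightarrow> 0" by simp
      then show "(\<lambda>n. (R + C * sqrt (s / real n)) / f (real n0)) \<longlonglongrightarrow> (R + C * 0) / f (real n0)"
        using False by (intro tendsto_divide tendsto_add tendsto_mult tendsto_const)
    qed
    then show ?thesis using f0 by (simp add: pos_le_divide_eq)
  qed (use R0 in simp)
  have "(\<lambda>n. prob E * f (real n)) \<longlonglongrightarrow> prob E * 1"
    unfolding f_def by (intro tendsto_mult tendsto_const lower_gamma_tendsto a)
  then have "prob E * 1 \<le> R"
    by (rule LIMSEQ_le_const2) (use main in \<open>auto intro!: exI[of _ 1]\<close>)
  then show ?thesis by (simp add: R_def)
qed

text \<open>\<open>prob_inside_le\<close> needs k' < k and a time short of both s and t - t0.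
  Scaling k and s by the same factor c n < 1 gives both, and the bound is continuous as c n tends to
  1. \<open>P\<close> stands for the condition on the hitting time, which only shrinks the
  event.\<close>

theorem survival_probability_le:
  assumes s: "0 < s"
  shows "prob {w\<in>space M. ereal s \<le> exit_time A t X w \<and> P w}
    \<le> 1 / Gamma (k / 2 + 1) * ((norm x)\<^sup>2 / (4 * \<nu> * s)) powr (k / 2)" (is "prob ?E \<le> _")
\<comment> \<open>A path in the event supplies s \<le> t - t0, because no point of the region has
  time t0.\<close>
proof (cases "?E = {}")
  case True
  have "0 < Gamma (k / 2 + 1)" using k by (intro Gamma_real_pos) simp
  then show ?thesis unfolding True by simp
next
  case False
  then obtain w where w: "ereal s \<le> exit_time A t X w" by blast
  have t: "t0 < t" using xt by (auto simp: region_def)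
  have "exit_time A t X w \<le> ereal (t - t0)"
    using t by (intro exit_time_le) (auto simp: region_def)
  then have st: "s \<le> t - t0" using w by (metis ereal_less_eq(3) order_trans)
  define c where "c n = 1 - inverse (real (Suc n))" for n
  have c: "c \<longlonglongrightarrow> 1"
    unfolding c_def[abs_def] using tendsto_diff[OF tendsto_const LIMSEQ_inverse_real_of_nat, of 1] by simp
  \<comment> \<open>The value c 0 = 0 is left out, since k' and the time must be positive.\<close>
  have cb: "0 < c n" "c n < 1" if "1 \<le> n" for n
    using that by (auto simp: c_def field_simps)
  have nu: "0 < \<nu>" "0 < norm x" using basic(1) norm_pos[OF xt] by auto
  have "(\<lambda>n. 1 / Gamma (k * c n / 2 + 1) * ((norm x)\<^sup>2 / (4 * \<nu> * (s * c n))) powr (k * c n / 2))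
      \<longlonglongrightarrow> 1 / Gamma (k * 1 / 2 + 1) * ((norm x)\<^sup>2 / (4 * \<nu> * (s * 1))) powr (k * 1 / 2)"
  proof (intro tendsto_mult tendsto_divide tendsto_powr tendsto_Gamma tendsto_add tendsto_const c)
    have p: "0 < k * 1 / 2 + 1" using k by simp
    show "k * 1 / 2 + 1 \<notin> \<int>\<^sub>\<le>\<^sub>0" using p nonpos_Ints_nonpos by (meson not_le)
    show "Gamma (k * 1 / 2 + 1) \<noteq> 0" using Gamma_real_pos[OF p] by linarith
  qed (use nu s in auto)
  then have "(\<lambda>n. 1 / Gamma (k * c n / 2 + 1) * ((norm x)\<^sup>2 / (4 * \<nu> * (s * c n))) powr (k * c n / 2))
      \<longlonglongrightarrow> 1 / Gamma (k / 2 + 1) * ((norm x)\<^sup>2 / (4 * \<nu> * s)) powr (k / 2)" by simp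
  then show ?thesis
  proof (rule LIMSEQ_le_const)
    have "prob ?E \<le> 1 / Gamma (k * c n / 2 + 1) * ((norm x)\<^sup>2 / (4 * \<nu> * (s * c n))) powr (k * c n / 2)"
      if n: "1 \<le> n" for n
    proof (rule prob_inside_le)
      have sc: "s * c n < s" using cb[OF n] s by simp
      show "w \<in> space M \<and> inside (s * c n) w" if "w \<in> ?E" for w
        using that exit_time_inside[OF _ sc] by auto
      show "s * c n < t - t0" using sc st by simp
    qed (use cb[OF n] k s in auto)
    then show "\<exists>N. \<forall>n\<ge>N. prob ?E \<le> 1 / Gamma (k * c n / 2 + 1) * ((norm x)\<^sup>2 / (4 * \<nu> * (s * c n))) powr (k * c n / 2)"
      by blast
  qed
qed

section \<open>Maximal inequality for Brownian motion\<close>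

lemma increment_tail:
  assumes s: "0 \<le> s" "s < r" and \<rho>: "0 < \<rho>"
  shows "prob {w\<in>space M. \<rho> \<le> norm (W r w - W s w)} \<le> 3 * (r - s) / \<rho>\<^sup>2"
proof -
  let ?D = "\<lambda>w. W r w - W s w"
  have D[measurable]: "?D \<in> borel_measurable M" using s by (intro increment_measurable) auto
  have distr: "distr M borel ?D = distr (gaussian 1) borel (\<lambda>y. sqrt (r - s) *\<^sub>R y)"
    unfolding increment_distr[OF s(1,2)] using s by (intro gaussian_scale) simp
  have eq: "(norm (sqrt (r - s) *\<^sub>R y))\<^sup>2 = (r - s) * (norm y)\<^sup>2" for y :: "real^3"
    using s by (simp add: power_mult_distrib)
  have i0: "integrable (gaussian 1) (\<lambda>y. (norm y)\<^sup>2)" "(\<integral>y. (norm y)\<^sup>2 \<partial>gaussian 1) = 3"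
    using gaussian_norm_sq by (simp_all add: has_bochner_integral_iff)
  have "integrable (distr M borel ?D) (\<lambda>y. (norm y)\<^sup>2)"
    unfolding distr by (subst integrable_distr_eq) (auto simp: eq i0 simp del: norm_scaleR)
  then have i2: "integrable M (\<lambda>w. (norm (?D w))\<^sup>2)"
    by (subst (asm) integrable_distr_eq) auto
  have "(\<integral>w. (norm (?D w))\<^sup>2 \<partial>M) = (\<integral>y. (norm y)\<^sup>2 \<partial>distr M borel ?D)"
    by (subst integral_distr) auto
  also have "\<dots> = (r - s) * 3"
    unfolding distr by (subst integral_distr) (auto simp: eq i0 simp del: norm_scaleR)
  finally have i3: "(\<integral>w. (norm (?D w))\<^sup>2 \<partial>M) = (r - s) * 3" .
  have "{w\<in>space M. \<rho> \<le> norm (?D w)} = {w\<in>space M. \<rho>\<^sup>2 \<le> (norm (?D w))\<^sup>2}"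
    using \<rho> by (auto simp: abs_le_square_iff[symmetric])
  \<comment> \<open>Chebyshev's inequality; the second moment is the dimension 3 times the variance
    r - s.\<close>
  then show ?thesis
    using integral_Markov_inequality_measure[OF i2, of "{}" "\<rho>\<^sup>2"] \<rho> i3 by (simp add: mult.commute)
qed

text \<open>Ottaviani's inequality: at the first grid time where \<open>W\<close> exceeds \<open>2 \<rho>\<close>, the remaining increment is
  independent and exceeds \<open>\<rho>\<close> with probability at most one half.\<close>

lemma grid_maximal_inequality:
  assumes S: "0 < S" and \<rho>: "0 < \<rho>" and p: "3 * S / \<rho>\<^sup>2 \<le> 1 / 2"
  defines "D \<equiv> \<lambda>n. {w\<in>space M. \<exists>j\<le>n. 2 * \<rho> < norm (W (real j * (S / real n)) w)}"
  shows "D n \<in> events" "0 < n \<Longrightarrow> prob (D n) \<le> 6 * S / \<rho>\<^sup>2"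
proof -
  define s where "s j = real j * (S / real n)" for j
  have s0: "0 \<le> s j" for j using S by (simp add: s_def)
  have mono: "s i \<le> s j" if "i \<le> j" for i j unfolding s_def using that S by (intro mult_right_mono) auto
  define E where "E j = {w\<in>space M. 2 * \<rho> < norm (W (s j) w)} \<inter> {w\<in>space M. \<forall>i<j. norm (W (s i) w) \<le> 2 * \<rho>}" for j
  have W_F[measurable]: "W (s i) \<in> borel_measurable (F (s j))" if "i \<le> j" for i j
    by (rule measurable_F_mono[OF W_measurable[OF s0] mono[OF that]])
  have E_F: "E j \<in> sets (F (s j))" for j
  proof -
    have "{w\<in>space (F (s j)). 2 * \<rho> < norm (W (s j) w)} \<in> sets (F (s j))"
      by (intro borel_measurable_less borel_measurable_const measurable_compose[OF W_F[OF order_refl] borel_measurable_norm])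
    moreover have "{w\<in>space (F (s j)). \<forall>i\<in>{..<j}. norm (W (s i) w) \<le> 2 * \<rho>} \<in> sets (F (s j))"
    proof (rule sets.sets_Collect_finite_All)
      fix i assume "i \<in> {..<j}"
      then show "{w\<in>space (F (s j)). norm (W (s i) w) \<le> 2 * \<rho>} \<in> sets (F (s j))"
        by (intro borel_measurable_le borel_measurable_const measurable_compose[OF W_F borel_measurable_norm]) simp
    qed simp
    ultimately show ?thesis unfolding E_def filtration(1) lessThan_iff Ball_def by (rule sets.Int)
  qed
  then have E_M: "E j \<in> events" for j using filtration(2) by blast
  have D: "D n = (\<Union>j\<in>{..n}. E j)"
  proof (intro equalityI subsetI)
    fix w assume w: "w \<in> D n"
    then obtain j where j: "j \<le> n" "2 * \<rho> < norm (W (s j) w)" by (auto simp: D_def s_def)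
    define i where "i = (LEAST i. 2 * \<rho> < norm (W (s i) w))"
    have i: "2 * \<rho> < norm (W (s i) w)" unfolding i_def by (rule LeastI[of _ j]) (rule j)
    have "i \<le> j" unfolding i_def by (rule Least_le) (rule j)
    moreover have "norm (W (s i') w) \<le> 2 * \<rho>" if "i' < i" for i'
      using not_less_Least[of i' "\<lambda>i. 2 * \<rho> < norm (W (s i) w)"] that by (simp add: i_def)
    ultimately show "w \<in> (\<Union>j\<in>{..n}. E j)" using i j(1) w by (auto simp: E_def D_def intro!: bexI[of _ i])
  qed (auto simp: D_def E_def s_def)
  show "D n \<in> events" unfolding D using E_M by auto
  assume n: "0 < n"
  have sn: "s n = S" using n by (simp add: s_def)
  have disj: "disjoint_family_on E {..n}"
    unfolding disjoint_family_on_def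
  proof (intro ballI impI)
    fix i j :: nat assume "i \<noteq> j"
    then show "E i \<inter> E j = {}" by (cases i j rule: linorder_cases) (force simp: E_def)+
  qed
  define G where "G j = {w\<in>space M. norm (W S w - W (s j) w) < \<rho>}" for j
  let ?p = "3 * S / \<rho>\<^sup>2"
  have p0: "0 \<le> ?p" using S by simp
  have EG: "prob (E j) * (1 - ?p) \<le> prob (E j \<inter> G j)" and EG_M: "E j \<inter> G j \<in> events" if j: "j \<le> n" for j
  proof -
    have "s j \<le> S" using mono[OF j] sn by simp
    then consider "s j = S" | "s j < S" by linarith
    then have "prob (E j) * (1 - ?p) \<le> prob (E j \<inter> G j) \<and> E j \<inter> G j \<in> events"
    proof cases
      \<comment> \<open>Independence of increments is stated for distinct times, so the last grid
        point is separate: its remaining increment is 0.\<close>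
      case 1
      then have "G j = space M" using \<rho> by (simp add: G_def)
      moreover have "E j \<inter> space M = E j" by (auto simp: E_def)
      ultimately show ?thesis using E_M[of j] p0 by (simp add: mult_left_le)
    next
      case 2
      let ?I = "\<lambda>w. W S w - W (s j) w"
      have [measurable]: "?I \<in> borel_measurable M" using 2 s0 by (intro increment_measurable) auto
      have G_eq: "G j = ?I -` ball 0 \<rho> \<inter> space M" by (auto simp: G_def dist_norm norm_minus_commute)
      have G_M: "G j \<in> events" unfolding G_def by measurable
      have "prob (E j \<inter> G j) = prob (E j) * prob (G j)"
        by (rule indep_setD[OF increment_indep[OF s0 2] E_F]) (use G_eq in auto)
      moreover have "1 - ?p \<le> prob (G j)"
      proof -
        have "space M - G j = {w\<in>space M. \<rho> \<le> norm (?I w)}" by (auto simp: G_def)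
        then have "prob (space M - G j) \<le> 3 * (S - s j) / \<rho>\<^sup>2"
          using increment_tail[OF s0 2 \<rho>] by simp
        also have "\<dots> \<le> ?p" using s0[of j] by (intro divide_right_mono) auto
        finally show ?thesis using prob_compl[OF G_M] by simp
      qed
      ultimately show ?thesis using E_M[of j] G_M by (auto intro!: mult_left_mono)
    qed
    then show "prob (E j) * (1 - ?p) \<le> prob (E j \<inter> G j)" "E j \<inter> G j \<in> events" by auto
  qed
  have "prob (D n) * (1 - ?p) = (\<Sum>j\<le>n. prob (E j) * (1 - ?p))"
    unfolding D by (subst finite_measure_finite_Union) (use E_M disj in \<open>auto simp: sum_distrib_right\<close>)
  also have "\<dots> \<le> (\<Sum>j\<le>n. prob (E j \<inter> G j))" by (intro sum_mono EG) auto
  also have "\<dots> = prob (\<Union>j\<in>{..n}. E j \<inter> G j)"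
    using disj by (intro finite_measure_finite_Union[symmetric]) (auto intro: EG_M simp: disjoint_family_on_def)
  also have "\<dots> \<le> prob {w\<in>space M. \<rho> \<le> norm (W S w - W 0 w)}"
  proof (rule finite_measure_mono)
    have [measurable]: "(\<lambda>w. W S w - W 0 w) \<in> borel_measurable M" using S by (intro increment_measurable) auto
    show "{w\<in>space M. \<rho> \<le> norm (W S w - W 0 w)} \<in> events" by measurable
    show "(\<Union>j\<in>{..n}. E j \<inter> G j) \<subseteq> {w\<in>space M. \<rho> \<le> norm (W S w - W 0 w)}"
    proof clarify
      fix j w assume "w \<in> E j" "w \<in> G j"
      then have w: "w \<in> space M" "2 * \<rho> < norm (W (s j) w)" "norm (W S w - W (s j) w) < \<rho>"
        by (auto simp: E_def G_def)
      have "norm (W (s j) w) \<le> norm (W S w) + norm (W S w - W (s j) w)"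
        using norm_triangle_ineq4[of "W S w" "W S w - W (s j) w"] by simp
      then show "w \<in> space M \<and> \<rho> \<le> norm (W S w - W 0 w)"
        using w W_0[OF w(1)] by simp
    qed
  qed
  also have "\<dots> \<le> ?p" using increment_tail[OF order_refl S \<rho>] by simp
  finally have "prob (D n) * (1 - ?p) \<le> ?p" .
  \<comment> \<open>The tail bound is at most 1 / 2, so dividing by its complement costs at most a
    factor 2.\<close>
  moreover have "prob (D n) * (1 / 2) \<le> prob (D n) * (1 - ?p)" using p by (intro mult_left_mono) auto
  ultimately have "prob (D n) \<le> 2 * ?p" by linarith
  then show "prob (D n) \<le> 6 * S / \<rho>\<^sup>2" by simp
qed

text \<open>A continuous path that is above the level at time q is above it at nearby times, and
  every fine grid contains one of these. The grid inequality has a bound that does not depend on the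
  grid, so it survives the limit.\<close>

lemma maximal_inequality:
  assumes S: "0 < S" and \<rho>: "0 < \<rho>" and p: "3 * S / \<rho>\<^sup>2 \<le> 1 / 2"
    and E: "AE w in M. w \<in> E \<longrightarrow> (\<exists>q\<in>{0..S}. 2 * \<rho> < norm (W q w))"
  shows "prob E \<le> 6 * S / \<rho>\<^sup>2"
proof -
  define D where "D n = {w\<in>space M. \<exists>j\<le>n. 2 * \<rho> < norm (W (real j * (S / real n)) w)}" for n
  show ?thesis
  proof (rule measure_le_of_eventually)
    show "D n \<in> events" for n unfolding D_def by (rule grid_maximal_inequality[OF S \<rho> p])
    show "\<forall>\<^sub>F n in sequentially. prob (D n) \<le> 6 * S / \<rho>\<^sup>2"
      using eventually_gt_at_top[of 0]
      by eventually_elim (unfold D_def, rule grid_maximal_inequality[OF S \<rho> p])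
    show "AE w in M. w \<in> E \<longrightarrow> (\<forall>\<^sub>F n in sequentially. w \<in> D n)"
      using E AE_space
    proof eventually_elim
      case (elim w)
      show ?case
      proof
        assume "w \<in> E"
        then obtain q where q: "q \<in> {0..S}" "2 * \<rho> < norm (W q w)" using elim by blast
        have "continuous_on {0..} (\<lambda>q. norm (W q w))" using elim by (intro continuous_intros W_continuous)
        from this[unfolded continuous_on_iff, rule_format, of q "norm (W q w) - 2 * \<rho>"] q
        obtain d where d: "0 < d"
            "\<forall>q'\<in>{0..}. dist q' q < d \<longrightarrow> dist (norm (W q' w)) (norm (W q w)) < norm (W q w) - 2 * \<rho>"
          by auto
        have "(\<lambda>n. S / real n) \<longlonglongrightarrow> 0" by (rule lim_const_over_n)
        then have "\<forall>\<^sub>F n in sequentially. S / real n < d" using d(1) by (rule order_tendstoD)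
        then show "\<forall>\<^sub>F n in sequentially. w \<in> D n"
          using eventually_gt_at_top[of 0]
        proof eventually_elim
          case (elim n)
          define h where "h = S / real n"
          have h: "0 < h" "h < d" "real n * h = S" using elim S by (auto simp: h_def)
          \<comment> \<open>The grid point at or just below q.\<close>
          define j where "j = nat \<lfloor>q / h\<rfloor>"
          have qh: "0 \<le> q / h" using q h by simp
          then have rj: "real j = of_int \<lfloor>q / h\<rfloor>" by (simp add: j_def)
          have "real j \<le> q / h" "q / h < real j + 1" unfolding rj by linarith+
          then have j: "real j * h \<le> q" "q < real j * h + h" using h by (auto simp: field_simps)
          have "real j * h \<le> real n * h" using j(1) q h by simp
          then have "j \<le> n" using mult_le_cancel_right_pos[OF h(1), of "real j" "real n"] by simp
          moreover have "2 * \<rho> < norm (W (real j * h) w)"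
          proof -
            have "dist (real j * h) q < d" using j h by (simp add: dist_real_def)
            moreover have "real j * h \<in> {0..}" using h by simp
            ultimately have "dist (norm (W (real j * h) w)) (norm (W q w)) < norm (W q w) - 2 * \<rho>"
              using d(2) by blast
            then show ?thesis by (simp add: dist_real_def abs_less_iff)
          qed
          ultimately show "w \<in> D n" using \<open>w \<in> space M\<close> unfolding D_def h_def by blast
        qed
      qed
    qed
  qed (rule tendsto_const)
qed

end

lemma parabolic_op_const: "parabolic_op \<nu> c (\<lambda>_. a) p = 0"
  by (cases p) (simp add: parabolic_op_def laplacian_def grad_def flip: zero_vec_def)

text \<open>The first condition keeps the displacement by the drift below |x| / 8, the second keeps
  the tail bound in Ottaviani's inequality below 1 / 2. With S / \<rho>^2 = 128 \<epsilon>, the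
  numbers 384 and 768 are 3 and 6 times 128. If a condition fails, the trivial bound 1 is
  taken.\<close>

definition hitting_modulus :: "real \<Rightarrow> real \<Rightarrow> real \<Rightarrow> real" where
  "hitting_modulus a c \<epsilon> = (if 2 * (a + 4 + 2 * c) * \<epsilon> \<le> 1 / 8 \<and> 384 * \<epsilon> \<le> 1 / 2 then 768 * \<epsilon> else 1)"

lemma hitting_modulus_tendsto: "(hitting_modulus a c \<longlongrightarrow> 0) (at_right 0)"
proof -
  have l: "((\<lambda>\<epsilon>. C * \<epsilon>) \<longlongrightarrow> 0) (at_right 0)" for C :: real
    by (rule tendsto_eq_intros refl | simp)+
  have "\<forall>\<^sub>F \<epsilon> in at_right 0. 2 * (a + 4 + 2 * c) * \<epsilon> < 1 / 8"
    by (rule order_tendstoD(2)[OF l]) simp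
  moreover have "\<forall>\<^sub>F \<epsilon> :: real in at_right 0. 384 * \<epsilon> < 1 / 2"
    by (rule order_tendstoD(2)[OF l]) simp
  ultimately have "\<forall>\<^sub>F \<epsilon> in at_right 0. 768 * \<epsilon> = hitting_modulus a c \<epsilon>"
    by eventually_elim (simp add: hitting_modulus_def)
  with l show ?thesis by (rule Lim_transform_eventually)
qed

section \<open>Hitting the inner scale early\<close>

context screened_diffusion begin

text \<open>A budget of displacements: at most |x| / 8 by the drift and |x| / 4 by the noise would
  leave |X| \<ge> 5 |x| / 8, too far out for a hit at |x| / 2 or below. So an early hit forces |W|
  above 2 \<rho>.\<close>

theorem early_hitting_probability_le:
  assumes \<epsilon>: "0 < \<epsilon>"
    and small: "\<And>s. 0 \<le> s \<Longrightarrow> s \<le> \<epsilon> * (norm x)\<^sup>2 / \<nu> \<Longrightarrow> t0 < t - s \<Longrightarrow> l (t - s) \<le> norm x / 2"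
  shows "prob {w\<in>space M. inner_hitting_time l t0 A t X w < ereal (\<epsilon> * (norm x)\<^sup>2 / \<nu>)}
    \<le> hitting_modulus (Cu / \<nu>) C\<Phi> \<epsilon>"
proof (cases "2 * (Cu / \<nu> + 4 + 2 * C\<Phi>) * \<epsilon> \<le> 1 / 8 \<and> 384 * \<epsilon> \<le> 1 / 2")
  case True
  have \<nu>: "0 < \<nu>" by (rule basic(1))
  have n: "0 < norm x" by (rule norm_pos[OF xt])
  define S where "S = \<epsilon> * (norm x)\<^sup>2 / \<nu>"
  \<comment> \<open>Chosen so that noise at the level 2 \<rho> moves the path by |x| / 4.\<close>
  define \<rho> where "\<rho> = norm x / (8 * sqrt (2 * \<nu>))"
  define K where "K = Cu / \<nu> + 4 + 2 * C\<Phi>"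
  have S: "0 < S" using \<epsilon> \<nu> n by (simp add: S_def)
  have \<rho>: "0 < \<rho>" "sqrt (2 * \<nu>) * (2 * \<rho>) = norm x / 4" using n \<nu> by (auto simp: \<rho>_def)
  have S\<rho>: "S / \<rho>\<^sup>2 = 128 * \<epsilon>"
    using n \<nu> by (simp add: S_def \<rho>_def power_divide power_mult_distrib field_simps)
  have K: "0 \<le> K"
    using order_trans[OF norm_ge_zero drift_norm[OF xt]] n \<nu> by (simp add: K_def zero_le_divide_iff zero_le_mult_iff)
  have "prob {w\<in>space M. inner_hitting_time l t0 A t X w < ereal S} \<le> 6 * S / \<rho>\<^sup>2"
  proof (rule maximal_inequality[OF S \<rho>(1)])
    show "3 * S / \<rho>\<^sup>2 \<le> 1 / 2" using True S\<rho> by simp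
    show "AE w in M. w \<in> {w\<in>space M. inner_hitting_time l t0 A t X w < ereal S} \<longrightarrow>
        (\<exists>q\<in>{0..S}. 2 * \<rho> < norm (W q w))"
      using X_sde AE_space
    proof eventually_elim
      case (elim w)
      show ?case
      proof (rule impI, rule ccontr)
        assume "w \<in> {w\<in>space M. inner_hitting_time l t0 A t X w < ereal S}"
          and no: "\<not> (\<exists>q\<in>{0..S}. 2 * \<rho> < norm (W q w))"
        then have "inner_hitting_time l t0 A t X w < ereal S" by simp
        then obtain q where q: "0 \<le> q" "q < S" "ereal q \<le> exit_time A t X w" "t0 < t - q" "norm (X q w) = l (t - q)"
          unfolding inner_hitting_time_def Inf_less_iff by auto
        have Xq: "norm (X q w) \<le> norm x / 2" using small[of q] q by (simp add: S_def)
        have cont: "continuous_on {0..} (\<lambda>r. norm (X r w))" using elim by (intro continuous_intros X_continuous)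
        \<comment> \<open>Its minimum r is the first time with |X| \<le> |x| / 2. Before r the drift
          is at most 2 \<nu> K / |x|, a bound that no longer involves the inner scale.\<close>
        define Z where "Z = {0..q} \<inter> (\<lambda>r. norm (X r w)) -` {..norm x / 2}"
        have "closed Z" unfolding Z_def
          by (intro continuous_closed_preimage continuous_on_prefix[OF cont]) auto
        moreover have "bounded Z" unfolding Z_def by (rule bounded_subset[OF bounded_closed_interval]) auto
        ultimately have "compact Z" by (simp add: compact_eq_bounded_closed)
        have "Z \<noteq> {}" using q(1) Xq by (auto simp: Z_def)
        from compact_attains_inf[OF \<open>compact Z\<close> this]
        obtain r where r: "r \<in> Z" "\<forall>r'\<in>Z. r \<le> r'" by blast
        have r_pos: "0 < r"
        proof (rule ccontr)
          assume "\<not> 0 < r"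
          then have "r = 0" using r(1) by (auto simp: Z_def)
          then show False using r(1) elim n by (auto simp: Z_def)
        qed
        have r_le: "r \<le> q" "norm (X r w) \<le> norm x / 2" using r(1) by (auto simp: Z_def)
        have before: "norm x / 2 < norm (X r' w)" if "r' \<in> {0..<r}" for r'
        proof (rule ccontr)
          assume "\<not> norm x / 2 < norm (X r' w)"
          then have "r' \<in> Z" using that r_le(1) by (simp add: Z_def)
          then have "r \<le> r'" using r(2) by blast
          then show False using that by simp
        qed
        have far: "norm x * 5 / 8 \<le> norm (X r' w)" if r': "r' \<in> {0..<r}" for r'
        proof -
          have r'S: "0 \<le> r'" "r' < q" "r' < S" using r' r_le q by auto
          define I where "I = integral {0..r'} (\<lambda>s. b (X s w, t - s))"
          have ins: "inside r' w" using exit_time_inside[OF q(3) r'S(2)] .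
          have "norm I \<le> \<nu> * K / (norm x / 2) * (r' - 0)"
            unfolding I_def
          proof (rule integral_bound)
            show "continuous_on {0..r'} (\<lambda>s. b (X s w, t - s))" using elim ins by (intro drift_path_continuous) auto
            fix s assume s: "s \<in> {0..r'}"
            have sA: "(X s w, t - s) \<in> A" using ins s by (auto simp: inside_def)
            have "norm (b (X s w, t - s)) \<le> \<nu> * K / norm (X s w)" using drift_norm[OF sA] by (simp add: K_def)
            also have "\<dots> \<le> \<nu> * K / (norm x / 2)"
              using before[of s] s r' n \<nu> K by (intro frac_le) auto
            finally show "norm (b (X s w, t - s)) \<le> \<nu> * K / (norm x / 2)" .
          qed (use r'S in auto)
          also have "\<dots> \<le> \<nu> * K / (norm x / 2) * S"
            using r'S \<nu> K n by (intro mult_left_mono) auto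
          also have "\<dots> = 2 * K * \<epsilon> * norm x"
            using \<nu> n by (simp add: S_def power2_eq_square)
          also have "\<dots> \<le> 1 / 8 * norm x"
            using True by (intro mult_right_mono) (auto simp: K_def)
          finally have Ib: "norm I \<le> norm x / 8" by simp
          have "norm (sqrt (2 * \<nu>) *\<^sub>R W r' w) = sqrt (2 * \<nu>) * norm (W r' w)" using \<nu> by simp
          also have "\<dots> \<le> sqrt (2 * \<nu>) * (2 * \<rho>)"
            using no r'S \<nu> by (intro mult_left_mono) (auto simp: not_less)
          finally have Wb: "norm (sqrt (2 * \<nu>) *\<^sub>R W r' w) \<le> norm x / 4" using \<rho> by simp
          have "ereal r' < exit_time A t X w" using elim r'S ins by (intro inside_exit_time) auto
          then have "X r' w = x - I + sqrt (2 * \<nu>) *\<^sub>R W r' w"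
            unfolding I_def using elim r'S by blast
          then have eq: "x = X r' w + I - sqrt (2 * \<nu>) *\<^sub>R W r' w" by simp
          have tri: "norm (p + q - r) \<le> norm p + norm q + norm r" for p q r :: "real^3"
            using norm_triangle_ineq4[of "p + q" r] norm_triangle_ineq[of p q] by linarith
          have "norm x \<le> norm (X r' w) + norm I + norm (sqrt (2 * \<nu>) *\<^sub>R W r' w)"
            by (rule ord_eq_le_trans[OF arg_cong[where f = norm, OF eq] tri])
          with Ib Wb show ?thesis by simp
        qed
        have "norm x * 5 / 8 \<le> norm (X r w)"
        proof (rule continuous_ge_on_closure[of "{0..<r}" "\<lambda>r. norm (X r w)"])
          show "continuous_on (closure {0..<r}) (\<lambda>r. norm (X r w))"
            using r_pos continuous_on_prefix[OF cont] by simp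
          show "r \<in> closure {0..<r}" using r_pos by simp
        qed (rule far)
        then show False using r_le(2) n by simp
      qed
    qed
  qed
  also have "6 * S / \<rho>\<^sup>2 = 768 * \<epsilon>" using S\<rho> by simp
  finally show ?thesis using True by (simp add: hitting_modulus_def S_def)
next
  case False
  then show ?thesis by (auto simp: hitting_modulus_def)
qed

end

text \<open>The witnesses \<eta> and \<open>rstar\<close> are chosen before all other data, which
  expresses that they depend only on (Cu / \<nu>, C\<Phi>) and on (\<gamma>, k). The event for
  \<tau> > s includes s \<le> \<tau>A, because \<tau> is infinite on paths that leave the region
  without meeting the inner scale.\<close>

theorem lemma4p4:
  shows "\<exists>(\<eta> :: real \<Rightarrow> real \<Rightarrow> real \<Rightarrow> real) (rstar :: real \<Rightarrow> real \<Rightarrow> real).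
    (\<forall>a c. (\<eta> a c \<longlongrightarrow> 0) (at_right 0)) \<and>
    (\<forall>\<gamma> k. 0 < \<gamma> \<and> 0 < k \<and> k < 3 \<longrightarrow> 0 < rstar \<gamma> k \<and> rstar \<gamma> k \<le> exp (-1)) \<and>
    (\<forall>\<nu> (u :: spacetime \<Rightarrow> real^3) (\<Phi> :: spacetime \<Rightarrow> real) (l :: real \<Rightarrow> real)
        R0 t0 T c0 C0 C\<Phi> Cu k A PA b L.
      annular_setting \<nu> u \<Phi> l R0 t0 T c0 C0 C\<Phi> \<and>
      A = region l R0 t0 T \<and> PA = parabolic_boundary l R0 t0 T \<and>
      b = drift \<nu> u \<Phi> \<and> L = parabolic_op \<nu> b \<and>
      (\<forall>(x, t)\<in>A. divergence (\<lambda>y. u (y, t)) x = 0) \<and>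
      (\<forall>(x, t)\<in>A. norm (u (x, t)) \<le> Cu / norm x) \<and>
      0 < k \<and> k < 3 \<and>
      (SUP (x, t)\<in>A. ereal (norm x * max (- radial u (x, t)) 0)) + ereal (2 * \<nu> * C\<Phi>)
        \<le> ereal ((3 - k) * \<nu>)
      \<longrightarrow>
      \<comment> \<open>(i)\<close>
      ((\<forall>p\<in>A. L (\<lambda>_. 1) p = 0) \<and>
       (\<forall>(x, t)\<in>A.
          L (\<lambda>(y, s). norm y powr k) (x, t)
            = k * norm x powr (k - 2) * (norm x * radial b (x, t) - (k + 1) * \<nu>) \<and>
          L (\<lambda>(y, s). norm y powr k) (x, t) \<ge> 0) \<and>
       (\<forall>w. C21_on A w \<and> continuous_on (A \<union> PA) w \<and> (\<forall>p\<in>A. L w p \<le> 0) \<longrightarrow>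
          (SUP p\<in>A. ereal (w p)) \<le> (SUP p\<in>PA. ereal (w p))) \<and>
       (\<forall>w s t. C21_on A w \<and> continuous_on (A \<union> PA) w \<and> (\<forall>p\<in>A. L w p = 0) \<and>
          t0 < s \<and> s \<le> t \<and> t < T \<and>
          (\<forall>(y, r)\<in>inner_boundary l R0 t0 T \<union> outer_boundary l R0 t0 T.
             s \<le> r \<and> r \<le> t \<longrightarrow> ennreal \<bar>w (y, r)\<bar> \<le> Linf_slice A w s) \<longrightarrow>
          Linf_slice A w t \<le> Linf_slice A w s)) \<and>
      \<comment> \<open>(ii)\<close>
      (\<forall>w A0. C21_on A w \<and> continuous_on (A \<union> PA) w \<and> (\<forall>p\<in>A. L w p = 0) \<and>
         ((\<forall>(x, t)\<in>PA. \<bar>w (x, t)\<bar> \<le> A0 * (norm x / R0) powr k) \<or>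
          (\<forall>(x, t)\<in>initial_slice l R0 t0 T. \<bar>w (x, t)\<bar> \<le> A0 * (norm x / R0) powr k) \<and>
          (\<forall>p\<in>inner_boundary l R0 t0 T. w p = 0) \<and>
          (\<forall>p\<in>outer_boundary l R0 t0 T. \<bar>w p\<bar> \<le> A0)) \<longrightarrow>
         (\<forall>(x, t)\<in>A. \<bar>w (x, t)\<bar> \<le> A0 * (norm x / R0) powr k)) \<and>
      \<comment> \<open>(iii)\<close>
      (\<forall>x t (M :: 'w measure) F W X \<tau>A \<tau>.
         (x, t) \<in> A \<and> standard_brownian_motion M F W \<and>
         solves_sde_until_exit M F W \<nu> b A x t X \<and>
         \<tau>A = exit_time A t X \<and> \<tau> = inner_hitting_time l t0 A t X \<longrightarrow>
         (\<forall>s>0. measure M {\<omega>\<in>space M. ereal s \<le> \<tau>A \<omega> \<and> ereal s < \<tau> \<omega>}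
            \<le> 1 / Gamma (k / 2 + 1) * ((norm x)\<^sup>2 / (4 * \<nu> * s)) powr (k / 2)) \<and>
         (\<forall>\<epsilon>>0. (\<forall>s. 0 \<le> s \<and> s \<le> \<epsilon> * (norm x)\<^sup>2 / \<nu> \<and> t0 < t - s \<longrightarrow> l (t - s) \<le> norm x / 2) \<longrightarrow>
            measure M {\<omega>\<in>space M. \<tau> \<omega> < ereal (\<epsilon> * (norm x)\<^sup>2 / \<nu>)} \<le> \<eta> (Cu / \<nu>) C\<Phi> \<epsilon>)) \<and>
      \<comment> \<open>(iv)\<close>
      (\<forall>\<gamma>>0. \<forall>B PB.
         B = A \<inter> {(x, t). norm x < rstar \<gamma> k} \<and>
         PB = parabolic_boundary l (min R0 (rstar \<gamma> k)) t0 T \<longrightarrow>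
         (\<forall>(x, t)\<in>B.
            L (\<lambda>(y, s). \<bar>ln (norm y)\<bar> powr (- \<gamma>)) (x, t)
              \<ge> \<nu> * \<gamma> * k / 2 * (1 / ((norm x)\<^sup>2 * \<bar>ln (norm x)\<bar> powr (\<gamma> + 1)))) \<and>
         (\<forall>w \<Lambda>. \<Lambda> \<ge> 0 \<and> C21_on B w \<and> continuous_on (B \<union> PB) w \<and>
            (\<forall>(x, t)\<in>B. L w (x, t) \<le> \<Lambda> / (norm x)\<^sup>2 * \<bar>ln (norm x)\<bar> powr (- \<gamma> - 1)) \<and>
            (\<forall>p\<in>PB. w p \<le> 0) \<longrightarrow>
            (\<forall>(x, t)\<in>B. w (x, t) \<le> 2 * \<Lambda> / (\<nu> * \<gamma> * k) * \<bar>ln (norm x)\<bar> powr (- \<gamma>)))))"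
proof (rule exI[of _ hitting_modulus], rule exI[of _ log_radius], intro conjI, goal_cases)
  case 1
  show ?case by (simp add: hitting_modulus_tendsto)
next
  case 2
  show ?case using log_radius_bounds by blast
next
  case 3
  show ?case
  proof (intro allI, rule impI, goal_cases)
    case hyp: (1 \<nu> u \<Phi> l R0 t0 T c0 C0 C\<Phi> Cu k A PA b L)
    have A: "A = region l R0 t0 T" and PA: "PA = parabolic_boundary l R0 t0 T"
      and b: "b = drift \<nu> u \<Phi>" and L: "L = parabolic_op \<nu> b"
      using hyp by blast+
    interpret S: screening \<nu> u \<Phi> l R0 t0 T c0 C0 C\<Phi> Cu k
    proof
      show "annular_setting \<nu> u \<Phi> l R0 t0 T c0 C0 C\<Phi>" using hyp by blast
      have "\<forall>(x, t)\<in>A. norm (u (x, t)) \<le> Cu / norm x" using hyp by blast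
      then show "norm (u (x, t)) \<le> Cu / norm x" if "(x, t) \<in> region l R0 t0 T" for x t
        using that unfolding A by blast
      show "0 < k" "k < 3" using hyp by blast+
      have "(SUP (x, t)\<in>A. ereal (norm x * max (- radial u (x, t)) 0)) + ereal (2 * \<nu> * C\<Phi>)
        \<le> ereal ((3 - k) * \<nu>)" using hyp by blast
      then show "(SUP (x, t)\<in>region l R0 t0 T. ereal (norm x * max (- radial u (x, t)) 0)) + ereal (2 * \<nu> * C\<Phi>)
        \<le> ereal ((3 - k) * \<nu>)" unfolding A .
    qed
    show ?case
      unfolding L b A PA
    proof (intro conjI, goal_cases)
      case 1
      show ?case by (simp add: parabolic_op_const)
    next
      case 2
      show ?case using S.op_power S.op_power_nonneg by blast
    next
      case 3
      show ?case using S.sup_le_parabolic_boundary by blast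
    next
      case 4
      show ?case
      proof (intro allI impI, goal_cases)
        case (1 w s t)
        then show ?case by (intro S.Linf_slice_antimono) blast+
      qed
    next
      case 5
      show ?case
      proof (intro allI impI, goal_cases)
        case (1 w A0)
        then show ?case using S.screening_bound[of w A0] by blast
      qed
    next
      case 6
      show ?case
      proof (intro allI impI, goal_cases)
        case (1 x t M F W X \<tau>A \<tau>)
        then have \<tau>: "\<tau>A = exit_time S.A t X" "\<tau> = inner_hitting_time l t0 S.A t X" by blast+
        from 1 have "(x, t) \<in> S.A" "standard_brownian_motion M F W"
            "solves_sde_until_exit M F W \<nu> S.b S.A x t X"
          by blast+
        then interpret D: screened_diffusion \<nu> u \<Phi> l R0 t0 T c0 C0 C\<Phi> Cu k M F W X x t
          by unfold_locales
        show ?case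
          unfolding \<tau>
        proof (intro conjI allI impI)
          show "measure M {\<omega>\<in>space M. ereal s \<le> exit_time S.A t X \<omega> \<and> ereal s < inner_hitting_time l t0 S.A t X \<omega>}
              \<le> 1 / Gamma (k / 2 + 1) * ((norm x)\<^sup>2 / (4 * \<nu> * s)) powr (k / 2)" if "0 < s" for s
            using that by (rule D.survival_probability_le)
          show "measure M {\<omega>\<in>space M. inner_hitting_time l t0 S.A t X \<omega> < ereal (\<epsilon> * (norm x)\<^sup>2 / \<nu>)}
              \<le> hitting_modulus (Cu / \<nu>) C\<Phi> \<epsilon>"
            if "0 < \<epsilon>" "\<forall>s. 0 \<le> s \<and> s \<le> \<epsilon> * (norm x)\<^sup>2 / \<nu> \<and> t0 < t - s \<longrightarrow> l (t - s) \<le> norm x / 2" for \<epsilon>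
            using that by (intro D.early_hitting_probability_le) blast+
        qed
      qed
    next
      case 7
      show ?case
      proof (intro allI impI, goal_cases)
        case (1 \<gamma> B PB)
        then have B: "B = S.A \<inter> {(x, t). norm x < log_radius \<gamma> k}"
          and PB: "PB = parabolic_boundary l (min R0 (log_radius \<gamma> k)) t0 T" by blast+
        show ?case
        proof (rule conjI, goal_cases)
          case 1
          show ?case using S.op_log_ge \<open>0 < \<gamma>\<close> unfolding B by blast
        next
          case 2
          show ?case
          proof (intro allI impI ballI, goal_cases)
            case (1 w \<Lambda> p)
            obtain x t where p: "p = (x, t)" by (cases p)
            have "w (x, t) \<le> 2 * \<Lambda> / (\<nu> * \<gamma> * k) * \<bar>ln (norm x)\<bar> powr (- \<gamma>)"
              by (rule S.log_comparison[OF \<open>0 < \<gamma>\<close> _ B PB]) (use 1 p in blast)+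
            then show ?case by (simp add: p)
          qed
        qed
      qed
    qed
  qed
qed

end
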